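(* For $\theta\in[-\frac{\pi}{4},\frac{3\pi}{4}]$ put $R^\theta=\left(1-\sin\left(\theta+\frac{\pi}{4}\right)\right)|\cos 2\theta|+\sin\left(\theta+\frac{\pi}{4}\right)$ and define $\tilde X^\theta:\mathbb{R}^2\to\mathbb{R}^3$ as follows. (a) If $\theta\neq-\frac{\pi}{4},\frac{\pi}{4},\frac{3\pi}{4}$, then, writing $k=\sqrt{\cos 2\theta}$, $$\tilde X^\theta(u,v)=R^\theta\left(\frac{k u\cos\theta-\sin\theta\,\sinh(ku)\cos(kv)}{k^3},\ \frac{k v\sin\theta-\cos\theta\,\cosh(ku)\sin(kv)}{k^3},\ \frac{\cosh(ku)\cos(kv)-1}{k^2}\right).$$ (b) If $\theta=\frac{\pi}{4}$, then $$\tilde X^\theta(u,v)=\left(-\frac{u(-6+u^2-3v^2)}{6\sqrt2},\ \frac{v(-6-3u^2+v^2)}{6\sqrt2},\ \frac{u^2-v^2}{2}\right).$$ (c) If $\theta=-\frac{\pi}{4}$ or $\theta=\frac{3\pi}{4}$, then $\tilde X^\theta(u,v)=\frac{3}{\sqrt2}(u,-v,0)$. If $\tilde X(u,v)$ is a minimal surface in $\mathbb{R}^3$ with planar curvature lines, then, up to isometries and homotheties of $\mathbb{R}^3$, the surface is given on its domain by the parametrization $\tilde X^\theta(u,v)$ for some $\theta\in[-\frac{\pi}{4},\frac{3\pi}{4}]$. In fact, it must be a piece of one, and only one, of the following: - plane ($\theta=-\frac{\pi}{4},\frac{3\pi}{4}$), - catenoid ($\theta=0,\frac{\pi}{2}$),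 - Enneper's surface ($\theta=\frac{\pi}{4}$), or - a surface in the Bonnet family ($\theta\in(-\frac{\pi}{4},\frac{3\pi}{4})\setminus\{0,\frac{\pi}{4},\frac{\pi}{2}\}$). Moreover, the deformation $\tilde X^\theta(u,v)$ depending on the parameter $\theta\in[-\frac{\pi}{4},\frac{3\pi}{4}]$ is continuous.
   Context: Surfaces are conformal immersions $X:\Sigma\to\mathbb{R}^3$ of simply-connected domains $\Sigma\subset\mathbb{R}^2$; minimal means mean curvature zero. A surface has planar curvature lines if each of its curvature lines lies in some plane; planes are regarded as trivially having this property. A non-planar such surface is taken umbilic-free and with isothermic coordinates, i.e. $(u,v)$ are conformal curvature line coordinates. Saying that the surface is given by a parametrization on its domain means that, in suitable such coordinates, it agrees with a piece of the parametrized surface, up to isometries and homotheties of $\mathbb{R}^3$. When $\cos 2\theta<0$, $k=\sqrt{\cos2\theta}$ is purely imaginary and the formulas are read with the same choice of $k$ throughout; they give real values. Weierstrass data $(h,\eta\,dz)$ on a simply-connected domain give the minimal surface $\mathrm{Re}\int(1-h^2,\,i(1+h^2),\,2h)\,\eta\,dz$. Up to isometries and homotheties of $\mathbb{R}^3$: the plane has data $(0,1\,dz)$, the catenoid $(e^z,e^{-z}dz)$, Enneper's surface $(z,1\,dz)$, and the Bonnet family is $\{(e^z+t,e^{-z}dz): t>0\}$. Continuity of a deformation in $\theta$ means: as $\theta\to\theta_0$, the maps $\tilde X^{\theta}$ converge to $\tilde X^{\theta_0}$ component-wise, uniformly over compact subdomains. *)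

theory Defs
  imports "HOL-Complex_Analysis.Complex_Analysis"
begin

text \<open>The parameter plane is the type \<^typ>\<open>complex\<close>, a point being \<open>z = u + \<i>v\<close>; the directions
  \<open>\<partial>/\<partial>u\<close> and \<open>\<partial>/\<partial>v\<close> are the vectors \<open>1\<close> and \<open>\<i>\<close>.\<close>

definition dd :: "complex \<Rightarrow> (complex \<Rightarrow> 'a::real_normed_vector) \<Rightarrow> complex \<Rightarrow> 'a" where
  "dd w f z = frechet_derivative f (at z) w"

primrec Ck_on :: "nat \<Rightarrow> complex set \<Rightarrow> (complex \<Rightarrow> 'a::real_normed_vector) \<Rightarrow> bool" where
  "Ck_on 0 S f \<longleftrightarrow> continuous_on S f"
| "Ck_on (Suc n) S f \<longleftrightarrow> (\<forall>z\<in>S. f differentiable (at z)) \<and> (\<forall>w. Ck_on n S (dd w f))"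

definition smooth_on :: "complex set \<Rightarrow> (complex \<Rightarrow> 'a::real_normed_vector) \<Rightarrow> bool" where
  "smooth_on S f \<longleftrightarrow> (\<forall>n. Ck_on n S f)"

definition conformal_immersion :: "complex set \<Rightarrow> (complex \<Rightarrow> 'a::real_inner) \<Rightarrow> bool" where
  "conformal_immersion S f \<longleftrightarrow> smooth_on S f \<and>
     (\<forall>z\<in>S. dd 1 f z \<noteq> 0 \<and> norm (dd 1 f z) = norm (dd \<i> f z) \<and> dd 1 f z \<bullet> dd \<i> f z = 0)"

definition surface :: "complex set \<Rightarrow> (complex \<Rightarrow> real^3) \<Rightarrow> bool" where
  "surface \<Sigma> X \<longleftrightarrow> open \<Sigma> \<and> \<Sigma> \<noteq> {} \<and> simply_connected \<Sigma> \<and> conformal_immersion \<Sigma> X"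

text \<open>In the forms below, \<open>w\<close> and \<open>w'\<close> are constant vector fields on the parameter plane, so that
  \<open>dd w (dd w' X)\<close> is bilinear and symmetric in \<open>w, w'\<close> for smooth \<open>X\<close>.\<close>

definition unit_normal :: "(complex \<Rightarrow> real^3) \<Rightarrow> complex \<Rightarrow> real^3" where
  "unit_normal X z = sgn (cross3 (dd 1 X z) (dd \<i> X z))"

definition first_form :: "(complex \<Rightarrow> real^3) \<Rightarrow> complex \<Rightarrow> complex \<Rightarrow> complex \<Rightarrow> real" where
  "first_form X z w w' = dd w X z \<bullet> dd w' X z"

definition second_form :: "(complex \<Rightarrow> real^3) \<Rightarrow> complex \<Rightarrow> complex \<Rightarrow> complex \<Rightarrow> real" where
  "second_form X z w w' = dd w (dd w' X) z \<bullet> unit_normal X z"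

definition mean_curvature :: "(complex \<Rightarrow> real^3) \<Rightarrow> complex \<Rightarrow> real" where
  "mean_curvature X z =
     (second_form X z 1 1 * first_form X z \<i> \<i> - 2 * second_form X z 1 \<i> * first_form X z 1 \<i>
        + second_form X z \<i> \<i> * first_form X z 1 1)
     / (2 * (first_form X z 1 1 * first_form X z \<i> \<i> - (first_form X z 1 \<i>)\<^sup>2))"

definition minimal_on :: "complex set \<Rightarrow> (complex \<Rightarrow> real^3) \<Rightarrow> bool" where
  "minimal_on \<Sigma> X \<longleftrightarrow> (\<forall>z\<in>\<Sigma>. mean_curvature X z = 0)"

definition umbilic :: "(complex \<Rightarrow> real^3) \<Rightarrow> complex \<Rightarrow> bool" where
  "umbilic X z \<longleftrightarrow> (\<exists>\<kappa>. \<forall>w w'. second_form X z w w' = \<kappa> * first_form X z w w')"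

definition principal_direction :: "(complex \<Rightarrow> real^3) \<Rightarrow> complex \<Rightarrow> complex \<Rightarrow> bool" where
  "principal_direction X z w \<longleftrightarrow>
     w \<noteq> 0 \<and> (\<exists>\<kappa>. \<forall>w'. second_form X z w w' = \<kappa> * first_form X z w w')"

definition in_some_plane :: "(real^3) set \<Rightarrow> bool" where
  "in_some_plane A \<longleftrightarrow> (\<exists>n d. n \<noteq> 0 \<and> (\<forall>x\<in>A. n \<bullet> x = d))"

definition curvature_line ::
  "complex set \<Rightarrow> (complex \<Rightarrow> real^3) \<Rightarrow> real set \<Rightarrow> (real \<Rightarrow> complex) \<Rightarrow> bool" where
  "curvature_line \<Sigma> X I \<gamma> \<longleftrightarrow> open I \<and> is_interval I \<and> I \<noteq> {} \<and>
     (\<exists>\<gamma>'. continuous_on I \<gamma>' \<and>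
        (\<forall>t\<in>I. (\<gamma> has_vector_derivative \<gamma>' t) (at t) \<and> \<gamma> t \<in> \<Sigma> \<and>
               principal_direction X (\<gamma> t) (\<gamma>' t)))"

text \<open>Every curve in a planar surface is a curvature line, so such a surface satisfies the
  following condition automatically.\<close>

definition planar_curvature_lines :: "complex set \<Rightarrow> (complex \<Rightarrow> real^3) \<Rightarrow> bool" where
  "planar_curvature_lines \<Sigma> X \<longleftrightarrow>
     (\<forall>I \<gamma>. curvature_line \<Sigma> X I \<gamma> \<longrightarrow> in_some_plane (X ` \<gamma> ` I))"

text \<open>For \<open>X\<close> given in conformal parameters \<open>z\<close>, the map \<open>\<phi>\<close> provides (local) conformal curvature
  line coordinates \<open>\<phi> z\<close>: its coordinate directions, pulled back to the \<open>z\<close>-plane, are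
  principal. For \<open>\<phi> z = z\<close> this says that the given parameters are isothermic.\<close>

definition isothermic_coords ::
  "complex set \<Rightarrow> (complex \<Rightarrow> real^3) \<Rightarrow> (complex \<Rightarrow> complex) \<Rightarrow> bool" where
  "isothermic_coords \<Sigma> X \<phi> \<longleftrightarrow> conformal_immersion \<Sigma> \<phi> \<and>
     (\<forall>z\<in>\<Sigma>. \<forall>w. dd w \<phi> z \<in> {1, \<i>} \<longrightarrow> principal_direction X z w)"

definition similarity :: "(real^3 \<Rightarrow> real^3) \<Rightarrow> bool" where
  "similarity F \<longleftrightarrow>
     (\<exists>c A b. c > 0 \<and> orthogonal_transformation A \<and> F = (\<lambda>x. c *\<^sub>R A x + b))"

text \<open>\<open>X\<close> agrees on \<open>\<Sigma>\<close>, in suitable isothermic coordinates and up to a similarity, with a piece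
  of \<open>Y\<close>. A planar conformal immersion need not be injective (for instance \<open>exp\<close>), hence
  neither need \<open>\<phi>\<close> be in that case.\<close>

definition piece_of ::
  "complex set \<Rightarrow> (complex \<Rightarrow> real^3) \<Rightarrow> (complex \<Rightarrow> real^3) \<Rightarrow> bool" where
  "piece_of \<Sigma> X Y \<longleftrightarrow>
     (\<exists>\<phi> F. isothermic_coords \<Sigma> X \<phi> \<and> (\<not> in_some_plane (X ` \<Sigma>) \<longrightarrow> inj_on \<phi> \<Sigma>) \<and>
            similarity F \<and> (\<forall>z\<in>\<Sigma>. X z = F (Y (\<phi> z))))"

definition R_factor :: "real \<Rightarrow> real" where
  "R_factor \<theta> = (1 - sin (\<theta> + pi/4)) * \<bar>cos (2*\<theta>)\<bar> + sin (\<theta> + pi/4)"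

definition bonnet_formula :: "real \<Rightarrow> real \<Rightarrow> real \<Rightarrow> complex^3" where
  "bonnet_formula \<theta> u v =
     (let k = csqrt (of_real (cos (2*\<theta>)));
          u = of_real u; v = of_real v; c = of_real (cos \<theta>); s = of_real (sin \<theta>)
      in vector
        [(k * u * c - s * sinh (k * u) * cos (k * v)) / k^3,
         (k * v * s - c * cosh (k * u) * sin (k * v)) / k^3,
         (cosh (k * u) * cos (k * v) - 1) / k^2])"

definition X_tilde :: "real \<Rightarrow> complex \<Rightarrow> real^3" where
  "X_tilde \<theta> z =
     (let u = Re z; v = Im z in
      if \<theta> = pi/4 then
        vector [- (u * (-6 + u^2 - 3 * v^2)) / (6 * sqrt 2),
                v * (-6 - 3 * u^2 + v^2) / (6 * sqrt 2),
                (u^2 - v^2) / 2]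
      else if \<theta> = -pi/4 \<or> \<theta> = 3*pi/4 then (3 / sqrt 2) *\<^sub>R vector [u, -v, 0]
      else R_factor \<theta> *\<^sub>R (\<chi> i. Re (bonnet_formula \<theta> u v $ i)))"

text \<open>Taking real parts in \<^const>\<open>X_tilde\<close> is only a type conversion.\<close>

lemma bonnet_formula_real: "bonnet_formula \<theta> u v $ i \<in> \<real>"
proof -
  define k where "k = csqrt (of_real (cos (2*\<theta>)))"
  have "k\<^sup>2 = of_real (cos (2*\<theta>))"
    by (simp add: k_def)
  then have "(cnj k)\<^sup>2 = k\<^sup>2"
    by (metis complex_cnj_power complex_cnj_complex_of_real)
  then have k: "cnj k = k \<or> cnj k = - k"
    by (simp add: power2_eq_iff)
  have sh: "cnj (sinh x) = sinh (cnj x)" and ch: "cnj (cosh x) = cosh (cnj x)" for x :: complex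
    by (simp_all add: sinh_def cosh_def exp_cnj scaleR_conv_of_real)
  have "i = 1 \<or> i = 2 \<or> i = 3" by (rule exhaust_3)
  then have "cnj (bonnet_formula \<theta> u v $ i) = bonnet_formula \<theta> u v $ i"
    unfolding bonnet_formula_def Let_def k_def[symmetric]
    using k
    by (auto simp: vector_3 sh ch cnj_sin cnj_cos; simp add: minus_divide_left)
  then show ?thesis by (simp add: Reals_cnj_iff)
qed

text \<open>The integrands below are entire, so the integral does not depend on the path, and the choice
  of the base point \<open>0\<close> only affects a translation.\<close>

definition weierstrass :: "(complex \<Rightarrow> complex) \<Rightarrow> (complex \<Rightarrow> complex) \<Rightarrow> complex \<Rightarrow> real^3" where
  "weierstrass h \<eta> z = vector
     [Re (contour_integral (linepath 0 z) (\<lambda>w. (1 - (h w)\<^sup>2) * \<eta> w)),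
      Re (contour_integral (linepath 0 z) (\<lambda>w. \<i> * (1 + (h w)\<^sup>2) * \<eta> w)),
      Re (contour_integral (linepath 0 z) (\<lambda>w. 2 * h w * \<eta> w))]"

datatype surface_type = Plane | Catenoid | Enneper | Bonnet

fun models :: "surface_type \<Rightarrow> (complex \<Rightarrow> real^3) set" where
  "models Plane = {weierstrass (\<lambda>z. 0) (\<lambda>z. 1)}"
| "models Catenoid = {weierstrass (\<lambda>z. exp z) (\<lambda>z. exp (- z))}"
| "models Enneper = {weierstrass (\<lambda>z. z) (\<lambda>z. 1)}"
| "models Bonnet = {weierstrass (\<lambda>z. exp z + of_real t) (\<lambda>z. exp (- z)) | t. t > 0}"

fun angles :: "surface_type \<Rightarrow> real set" where
  "angles Plane = {-pi/4, 3*pi/4}"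
| "angles Catenoid = {0, pi/2}"
| "angles Enneper = {pi/4}"
| "angles Bonnet = {-pi/4<..<3*pi/4} - {0, pi/4, pi/2}"

definition piece_of_type :: "complex set \<Rightarrow> (complex \<Rightarrow> real^3) \<Rightarrow> surface_type \<Rightarrow> bool" where
  "piece_of_type \<Sigma> X T \<longleftrightarrow> (\<exists>Y\<in>models T. piece_of \<Sigma> X Y)"

end

theory Submission
  imports Defs
begin

text \<open>For a conformal immersion \<open>X\<close> put \<open>f = X\<^sub>u - \<i> X\<^sub>v\<close>. If \<open>X\<close> is minimal, then \<open>f\<close> is holomorphic, it is
  null for the complex bilinear product (\<open>f \<cdot> f = 0\<close>), and \<open>X\<close> is the real part of a primitive of \<open>f\<close>.
  In isothermic coordinates the product of \<open>f'\<close> with the unit normal is real, and \<open>f' \<cdot> f'\<close> is its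
  square; so \<open>f' \<cdot> f'\<close> is holomorphic and real, hence a constant \<open>L\<^sup>2\<close>, and \<open>L \<noteq> 0\<close> without umbilics.

  A coordinate line lies in a plane only if \<open>X\<^sub>u\<close>, \<open>X\<^sub>u\<^sub>u\<close>, \<open>X\<^sub>u\<^sub>u\<^sub>u\<close> are dependent. In the orthonormal frame of
  the surface their determinant is a nonzero multiple of the imaginary part of \<open>f'' \<cdot> f''\<close>. Planarity thus
  makes a second holomorphic function real, hence constant. Comparing products with the basis
  \<open>f, f', f''\<close> then yields the linear equation \<open>f''' = \<mu> f'\<close> with a real constant \<open>\<mu>\<close>
  (lemma \<open>surface_null_jet\<close>).

  From here on the surface is forgotten: \<open>f\<close> continues to an entire solution, with the same constant Gram
  matrix of \<open>f, f', f''\<close>. Somewhere in the plane, possibly outside the original domain, the conformal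
  factor has a critical point \<open>z\<^sub>0\<close>, that is, \<open>f' z\<^sub>0\<close> is a real vector (\<open>null_jet_critical_point\<close>). There
  \<open>f = \<rho> (e\<^sub>1 + \<i> e\<^sub>2)\<close> and \<open>f' = L e\<^sub>3\<close> in a real orthonormal frame, and the Gram matrix fixes \<open>f''\<close>
  (\<open>null_jet_frame\<close>). So a surface is described by \<open>(\<rho>, L, \<mu>)\<close>. Scaling the coordinates and scaling space
  leave the single invariant \<open>\<mu> \<rho>\<^sup>2 / L\<^sup>2\<close>, which for \<open>X_tilde \<theta>\<close> is \<open>tan (\<pi>/4 - \<theta>)\<close>. This tangent takes each
  real value exactly once for \<open>-\<pi>/4 < \<theta> < 3\<pi>/4\<close>, which gives the existence of \<open>\<theta>\<close>
  (\<open>null_jet_similar_to_X_tilde\<close>). The same normal form, applied to the Weierstrass data of the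
  models, shows which model \<open>X_tilde \<theta>\<close> is (\<open>axis_similar_to_model\<close>).

  The types exclude each other because a change between isothermic coordinates has, up to a reflection,
  a constant derivative \<open>p\<close> with \<open>p\<^sup>2\<close> real (\<open>piece_of_null_curve\<close>): it maps principal directions to principal
  directions, and again a real holomorphic function is constant. So the null curve of a piece of a model is
  a rotated and scaled copy of the null curve of the model. This preserves the properties that separate
  the models: in \<open>f''' = M f'\<close> one has \<open>M = 0\<close> only for Enneper's surface, and the constant vector
  \<open>D = f'' - M f\<close> is a complex multiple of a real vector for the catenoid but not in the Bonnet family.
  Planar surfaces correspond to the two ends of the interval of angles, where they serve as their own
  conformal coordinates, and no open piece of another model is planar.

  For the continuity, all cases of the definition of \<open>X_tilde\<close> are brought into one formula built from
  entire functions (\<open>X_unified\<close>), which is continuous in \<open>\<theta>\<close> and the point together.\<close>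

text \<open>Formal power series also use the symbol \<open>$\<close>, which would make every vector component ambiguous.\<close>

unbundle no Formal_Power_Series.fps_syntax

section \<open>Partial derivatives of maps on the plane\<close>

lemma has_derivative_dd:
  "f differentiable (at z) \<Longrightarrow> (f has_derivative (\<lambda>w. dd w f z)) (at z)"
  unfolding dd_def by (simp add: frechet_derivative_works[symmetric])

lemma dd_eqI: "(f has_derivative D) (at z) \<Longrightarrow> dd w f z = D w"
  unfolding dd_def by (metis frechet_derivative_at)

lemma dd_cong_open:
  assumes "open S" "z \<in> S" "\<And>x. x \<in> S \<Longrightarrow> f x = g x"
  shows "dd w f z = dd w g z"
proof -
  have "(f has_derivative D) (at z) \<longleftrightarrow> (g has_derivative D) (at z)" for D
    using has_derivative_transform_within_open[of _ _ z UNIV S] assms by metis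
  then show ?thesis
    unfolding dd_def frechet_derivative_def by simp
qed

lemma differentiable_cong_open:
  assumes "open S" "z \<in> S" "\<And>x. x \<in> S \<Longrightarrow> f x = g x" "f differentiable (at z)"
  shows "g differentiable (at z)"
  using assms has_derivative_transform_within_open[of f _ z UNIV S g]
  unfolding differentiable_def by metis

lemma Ck_on_cong:
  assumes "open S"
  shows "Ck_on n S f \<Longrightarrow> (\<And>x. x \<in> S \<Longrightarrow> f x = g x) \<Longrightarrow> Ck_on n S g"
proof (induction n arbitrary: f g)
  case 0
  then show ?case using continuous_on_cong[of S S f g] by simp
next
  case (Suc n)
  have "Ck_on n S (dd w g)" for w
    using Suc.IH[of "dd w f" "dd w g"] Suc.prems dd_cong_open[OF assms] by (metis Ck_on.simps(2))
  moreover have "g differentiable (at z)" if "z \<in> S" for z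
    using differentiable_cong_open[OF assms that, of f g] Suc.prems that by auto
  ultimately show ?case by simp
qed

lemma dd_bounded_linear:
  assumes "bounded_linear T" "f differentiable (at z)"
  shows "dd w (\<lambda>x. T (f x) + b) z = T (dd w f z)"
    and "(\<lambda>x. T (f x) + b) differentiable (at z)"
proof -
  have "((\<lambda>x. T (f x) + b) has_derivative (\<lambda>w. T (dd w f z))) (at z)"
    using bounded_linear.has_derivative[OF assms(1) has_derivative_dd[OF assms(2)]]
    by (auto intro!: derivative_eq_intros)
  then show "dd w (\<lambda>x. T (f x) + b) z = T (dd w f z)"
    "(\<lambda>x. T (f x) + b) differentiable (at z)"
    by (auto intro: dd_eqI simp: differentiable_def)
qed

lemma Ck_on_bounded_linear:
  assumes "open S" "bounded_linear T"
  shows "Ck_on n S f \<Longrightarrow> Ck_on n S (\<lambda>x. T (f x) + b)"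
proof (induction n arbitrary: f b)
  case 0
  then show ?case
    using bounded_linear.continuous_on[OF assms(2)] by (auto intro!: continuous_intros)
next
  case (Suc n)
  have "Ck_on n S (dd w (\<lambda>x. T (f x) + b))" for w
  proof (rule Ck_on_cong[OF assms(1)])
    show "Ck_on n S (\<lambda>x. T (dd w f x) + 0)" using Suc by (metis Ck_on.simps(2))
    show "T (dd w f x) + 0 = dd w (\<lambda>x. T (f x) + b) x" if "x \<in> S" for x
      using dd_bounded_linear(1)[OF assms(2)] Suc.prems that by simp
  qed
  then show ?case using Suc.prems dd_bounded_linear(2)[OF assms(2)] by simp
qed

lemma smooth_on_bounded_linear:
  assumes "open S" "bounded_linear T" "smooth_on S f"
  shows "smooth_on S (\<lambda>x. T (f x) + b)"
  using assms Ck_on_bounded_linear unfolding smooth_on_def by blast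

lemma smooth_on_differentiable: "smooth_on S f \<Longrightarrow> z \<in> S \<Longrightarrow> f differentiable (at z)"
  unfolding smooth_on_def by (metis Ck_on.simps(2))

lemma smooth_on_dd: "smooth_on S f \<Longrightarrow> smooth_on S (dd w f)"
  unfolding smooth_on_def by (metis Ck_on.simps(2))

lemma smooth_on_continuous: "smooth_on S f \<Longrightarrow> continuous_on S f"
  unfolding smooth_on_def by (metis Ck_on.simps(1))

lemma dd_lincomb:
  assumes "f differentiable (at z)"
  shows "dd w f z = Re w *\<^sub>R dd 1 f z + Im w *\<^sub>R dd \<i> f z"
proof -
  interpret bounded_linear "\<lambda>w. dd w f z"
    using has_derivative_dd[OF assms] by (rule has_derivative_bounded_linear)
  have "w = Re w *\<^sub>R 1 + Im w *\<^sub>R \<i>" by (simp add: complex_eq_iff)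
  then show ?thesis by (metis add scaleR)
qed

text \<open>The mean value theorem, applied once in each direction to the second difference of \<open>g\<close> over a small
  parallelogram, produces a value of a mixed derivative.\<close>
lemma second_difference_eq_mixed_derivative:
  fixes g :: "complex \<Rightarrow> real"
  assumes sm: "smooth_on S g" and s: "0 < s"
    and S: "\<And>x y. 0 \<le> x \<Longrightarrow> x \<le> s \<Longrightarrow> 0 \<le> y \<Longrightarrow> y \<le> s \<Longrightarrow> z + x *\<^sub>R a + y *\<^sub>R b \<in> S"
  shows "\<exists>x y. 0 \<le> x \<and> x \<le> s \<and> 0 \<le> y \<and> y \<le> s \<and>
    g (z + s *\<^sub>R a + s *\<^sub>R b) - g (z + s *\<^sub>R a) - g (z + s *\<^sub>R b) + g z
      = s\<^sup>2 * dd b (dd a g) (z + x *\<^sub>R a + y *\<^sub>R b)"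
proof -
  have along: "((\<lambda>t. h (p + t *\<^sub>R w)) has_real_derivative dd w h (p + t *\<^sub>R w)) (at t)"
    if "smooth_on S h" "p + t *\<^sub>R w \<in> S" for h :: "complex \<Rightarrow> real" and p w t
  proof -
    have h: "(h has_derivative (\<lambda>v. dd v h (p + t *\<^sub>R w))) (at (p + t *\<^sub>R w))"
      by (rule has_derivative_dd[OF smooth_on_differentiable[OF that]])
    interpret bounded_linear "\<lambda>v. dd v h (p + t *\<^sub>R w)"
      using h by (rule has_derivative_bounded_linear)
    have "((\<lambda>t. h (p + t *\<^sub>R w)) has_derivative (\<lambda>r. dd (r *\<^sub>R w) h (p + t *\<^sub>R w))) (at t)"
      by (rule has_derivative_compose[where f = "\<lambda>t. p + t *\<^sub>R w", OF _ h]) (auto intro!: derivative_eq_intros)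
    then show ?thesis
      unfolding has_field_derivative_def
      by (rule has_derivative_eq_rhs) (auto simp: scaleR)
  qed
  define \<phi> where "\<phi> t = g ((z + s *\<^sub>R b) + t *\<^sub>R a) - g (z + t *\<^sub>R a)" for t
  have "(\<phi> has_real_derivative dd a g ((z + s *\<^sub>R b) + t *\<^sub>R a) - dd a g (z + t *\<^sub>R a)) (at t)"
    if "0 \<le> t" "t \<le> s" for t
  proof -
    have "(z + s *\<^sub>R b) + t *\<^sub>R a \<in> S" "z + t *\<^sub>R a \<in> S"
      using S[of t s] S[of t 0] that s by (simp_all add: add_ac)
    then show ?thesis
      unfolding \<phi>_def by (intro DERIV_diff along sm)
  qed
  from MVT2[OF s, of \<phi>, OF this] obtain x where x: "0 < x" "x < s"
    "\<phi> s - \<phi> 0 = s * (dd a g ((z + s *\<^sub>R b) + x *\<^sub>R a) - dd a g (z + x *\<^sub>R a))"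
    by auto
  have "((\<lambda>t. dd a g ((z + x *\<^sub>R a) + t *\<^sub>R b)) has_real_derivative
      dd b (dd a g) ((z + x *\<^sub>R a) + t *\<^sub>R b)) (at t)" if "0 \<le> t" "t \<le> s" for t
    using S[of x t] that x by (intro along smooth_on_dd sm) simp_all
  from MVT2[OF s, OF this] obtain y where y: "0 < y" "y < s"
    "dd a g ((z + x *\<^sub>R a) + s *\<^sub>R b) - dd a g (z + x *\<^sub>R a)
       = s * dd b (dd a g) ((z + x *\<^sub>R a) + y *\<^sub>R b)"
    by auto
  have "\<phi> s - \<phi> 0 = s * (s * dd b (dd a g) (z + x *\<^sub>R a + y *\<^sub>R b))"
    using x(3) y(3) by (simp add: algebra_simps)
  then show ?thesis
    unfolding \<phi>_def using x y
    by (intro exI[of _ x] exI[of _ y]) (simp add: power2_eq_square mult.assoc add_ac)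
qed

text \<open>Clairaut's theorem: the second difference is symmetric in the two directions, so on a small enough
  parallelogram the two mixed derivatives share values close to those at \<open>z\<close>.\<close>
lemma dd_commute_real:
  fixes g :: "complex \<Rightarrow> real"
  assumes "open S" "smooth_on S g" "z \<in> S"
  shows "dd a (dd b g) z = dd b (dd a g) z"
proof (rule ccontr)
  assume ne: "dd a (dd b g) z \<noteq> dd b (dd a g) z"
  define e where "e = \<bar>dd a (dd b g) z - dd b (dd a g) z\<bar> / 2"
  have e: "e > 0" using ne by (simp add: e_def)
  have "isCont (dd a (dd b g)) z" "isCont (dd b (dd a g)) z"
    using smooth_on_continuous[OF smooth_on_dd[OF smooth_on_dd[OF assms(2)]]]
      continuous_on_eq_continuous_at[OF assms(1)] assms(3) by auto
  then have "\<exists>d>0. \<forall>x. dist x z < d \<longrightarrow> dist (dd a (dd b g) x) (dd a (dd b g) z) < e"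
    "\<exists>d>0. \<forall>x. dist x z < d \<longrightarrow> dist (dd b (dd a g) x) (dd b (dd a g) z) < e"
    unfolding continuous_at_eps_delta using e by auto
  then obtain d1 d2 where d: "d1 > 0" "\<And>x. dist x z < d1 \<Longrightarrow> dist (dd a (dd b g) x) (dd a (dd b g) z) < e"
    "d2 > 0" "\<And>x. dist x z < d2 \<Longrightarrow> dist (dd b (dd a g) x) (dd b (dd a g) z) < e"
    by auto
  obtain d3 where d3: "d3 > 0" "ball z d3 \<subseteq> S"
    using assms openE by blast
  define d where "d = min d3 (min d1 d2)"
  define s where "s = d / (2 * (norm a + norm b + 1))"
  have pos: "norm a + norm b + 1 > 0" by (smt (verit) norm_ge_zero)
  have s: "s > 0" using d(1,3) d3 pos by (simp add: s_def d_def)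
  have near: "dist (z + x *\<^sub>R v + y *\<^sub>R w) z < d"
    if "0 \<le> x" "x \<le> s" "0 \<le> y" "y \<le> s" "{v, w} = {a, b}" for x y v w
  proof -
    have "dist (z + x *\<^sub>R v + y *\<^sub>R w) z \<le> x * norm v + y * norm w"
      using norm_triangle_ineq[of "x *\<^sub>R v" "y *\<^sub>R w"] that by (simp add: dist_norm)
    also have "\<dots> \<le> s * norm v + s * norm w"
      using that by (intro add_mono mult_right_mono) auto
    also have "\<dots> = s * (norm a + norm b)"
      using that(5) by (auto simp: doubleton_eq_iff algebra_simps)
    also have "\<dots> < s * (2 * (norm a + norm b + 1))"
      using s by (intro mult_strict_left_mono) (auto intro: add_nonneg_pos simp: add.assoc, smt (verit) norm_ge_zero)
    also have "\<dots> = d" using pos by (simp add: s_def)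
    finally show ?thesis .
  qed
  have inS: "z + x *\<^sub>R v + y *\<^sub>R w \<in> S"
    if "0 \<le> x" "x \<le> s" "0 \<le> y" "y \<le> s" "{v, w} = {a, b}" for x y v w
    using near[OF that] d3(2) by (auto simp: d_def dist_commute)
  obtain x y where xy: "0 \<le> x" "x \<le> s" "0 \<le> y" "y \<le> s"
    "g (z + s *\<^sub>R a + s *\<^sub>R b) - g (z + s *\<^sub>R a) - g (z + s *\<^sub>R b) + g z
      = s\<^sup>2 * dd b (dd a g) (z + x *\<^sub>R a + y *\<^sub>R b)"
    using second_difference_eq_mixed_derivative[OF assms(2) s, of z a b] inS[of _ _ a b] by blast
  have ba: "{b, a} = {a, b}" by auto
  obtain x' y' where xy': "0 \<le> x'" "x' \<le> s" "0 \<le> y'" "y' \<le> s"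
    "g (z + s *\<^sub>R b + s *\<^sub>R a) - g (z + s *\<^sub>R b) - g (z + s *\<^sub>R a) + g z
      = s\<^sup>2 * dd a (dd b g) (z + x' *\<^sub>R b + y' *\<^sub>R a)"
    using second_difference_eq_mixed_derivative[OF assms(2) s, of z b a] inS[of _ _ b a] ba by blast
  have "s\<^sup>2 * dd b (dd a g) (z + x *\<^sub>R a + y *\<^sub>R b) = s\<^sup>2 * dd a (dd b g) (z + x' *\<^sub>R b + y' *\<^sub>R a)"
    using xy(5) xy'(5) by (simp add: algebra_simps)
  then have eq: "dd b (dd a g) (z + x *\<^sub>R a + y *\<^sub>R b) = dd a (dd b g) (z + x' *\<^sub>R b + y' *\<^sub>R a)"
    using s by simp
  have "dist (dd b (dd a g) (z + x *\<^sub>R a + y *\<^sub>R b)) (dd b (dd a g) z) < e"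
    using near[OF xy(1-4), of a b] by (intro d) (simp add: d_def)
  moreover have "dist (dd a (dd b g) (z + x' *\<^sub>R b + y' *\<^sub>R a)) (dd a (dd b g) z) < e"
    using near[OF xy'(1-4) ba] by (intro d) (simp add: d_def)
  ultimately show False
    unfolding eq e_def dist_real_def by (auto simp: abs_if split: if_splits)
qed

lemma dd_nth:
  fixes X :: "complex \<Rightarrow> real^3"
  assumes "X differentiable (at z)"
  shows "dd w (\<lambda>x. X x $ i) z = dd w X z $ i"
  using dd_bounded_linear(1)[OF bounded_linear_vec_nth[of i] assms, of w 0] by simp

lemma dd_commute:
  fixes X :: "complex \<Rightarrow> real^3"
  assumes "open S" "smooth_on S X" "z \<in> S"
  shows "dd a (dd b X) z = dd b (dd a X) z"
proof -
  have sm: "smooth_on S (\<lambda>x. X x $ i)" for i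
    using smooth_on_bounded_linear[OF assms(1) bounded_linear_vec_nth[of i] assms(2), of 0] by simp
  have "dd a (dd b (\<lambda>x. X x $ i)) z = dd a (dd b X) z $ i" for a b i
  proof -
    have "dd a (dd b (\<lambda>x. X x $ i)) z = dd a (\<lambda>x. dd b X x $ i) z"
      using assms by (intro dd_cong_open[OF assms(1,3)] dd_nth smooth_on_differentiable)
    also have "\<dots> = dd a (dd b X) z $ i"
      using assms by (intro dd_nth smooth_on_differentiable smooth_on_dd)
    finally show ?thesis .
  qed
  then show ?thesis
    using dd_commute_real[OF assms(1) sm assms(3), of a b] by (simp add: vec_eq_iff)
qed

section \<open>Null curves and their Gram matrix\<close>

text \<open>The product is bilinear and not Hermitian, so that it is holomorphic along holomorphic curves;
  it has nonzero null vectors.\<close>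
definition cdot :: "complex^3 \<Rightarrow> complex^3 \<Rightarrow> complex" where
  "cdot v w = (\<Sum>i\<in>UNIV. v $ i * w $ i)"

lemma cdot_3: "cdot v w = v$1 * w$1 + v$2 * w$2 + v$3 * w$3"
  by (simp add: cdot_def sum_3)

lemma cdot_commute: "cdot v w = cdot w v"
  by (simp add: cdot_def mult.commute)

lemma cdot_simps:
  "cdot (v + v') w = cdot v w + cdot v' w" "cdot w (v + v') = cdot w v + cdot w v'"
  "cdot (v - v') w = cdot v w - cdot v' w" "cdot w (v - v') = cdot w v - cdot w v'"
  "cdot (c *s v) w = c * cdot v w" "cdot w (c *s v) = c * cdot w v"
  "cdot (- v) w = - cdot v w" "cdot w (- v) = - cdot w v"
  by (simp_all add: cdot_3 algebra_simps)

definition vec_deriv :: "(complex \<Rightarrow> complex^3) \<Rightarrow> complex^3 \<Rightarrow> complex \<Rightarrow> bool" where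
  "vec_deriv f f' z \<longleftrightarrow> (\<forall>i. ((\<lambda>x. f x $ i) has_field_derivative f' $ i) (at z))"

lemma vec_deriv_cdot:
  assumes "vec_deriv f f' z" "vec_deriv g g' z"
  shows "((\<lambda>x. cdot (f x) (g x)) has_field_derivative cdot f' (g z) + cdot (f z) g') (at z)"
  using assms unfolding cdot_3 vec_deriv_def
  by (auto intro!: derivative_eq_intros)

lemma deriv_eq_0_if_const_on_open:
  assumes "open S" "z \<in> S" "\<And>x. x \<in> S \<Longrightarrow> g x = c" "(g has_field_derivative d) (at z)"
  shows "d = (0::complex)"
proof -
  have "((\<lambda>x. c) has_field_derivative d) (at z)"
    by (rule has_field_derivative_transform_within_open[OF assms(4,1,2)]) (use assms in auto)
  then show ?thesis using DERIV_unique DERIV_const by blast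
qed

lemma vec_deriv_const: "vec_deriv (\<lambda>_. v) 0 z"
  by (simp add: vec_deriv_def)

lemma vec_deriv_unique: "vec_deriv f a z \<Longrightarrow> vec_deriv f b z \<Longrightarrow> a = b"
  unfolding vec_deriv_def vec_eq_iff using DERIV_unique by blast

lemma vec_deriv_cong_open:
  assumes "vec_deriv f a z" "open S" "z \<in> S" "\<And>x. x \<in> S \<Longrightarrow> f x = g x"
  shows "vec_deriv g a z"
  unfolding vec_deriv_def
proof
  fix i
  have "((\<lambda>x. f x $ i) has_field_derivative a $ i) (at z)"
    using assms(1) by (simp add: vec_deriv_def)
  then show "((\<lambda>x. g x $ i) has_field_derivative a $ i) (at z)"
    by (rule has_field_derivative_transform_within_open[OF _ assms(2,3)]) (simp add: assms(4))
qed

text \<open>A holomorphic null curve together with its first two derivatives, which solves \<open>f''' = \<mu> f'\<close>. For the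
  gradient of a surface, \<open>L\<close> is the absolute value of the coefficient of its second fundamental form.\<close>
definition null_jet ::
  "complex set \<Rightarrow> real \<Rightarrow> real \<Rightarrow> (complex \<Rightarrow> complex^3) \<Rightarrow> (complex \<Rightarrow> complex^3)
     \<Rightarrow> (complex \<Rightarrow> complex^3) \<Rightarrow> bool" where
  "null_jet S L \<mu> f f1 f2 \<longleftrightarrow> (\<forall>z\<in>S. vec_deriv f (f1 z) z \<and> vec_deriv f1 (f2 z) z \<and>
      vec_deriv f2 (of_real \<mu> *s f1 z) z \<and>
      cdot (f z) (f z) = 0 \<and> cdot (f1 z) (f1 z) = of_real (L\<^sup>2))"

lemma null_jetD:
  assumes "null_jet S L \<mu> f f1 f2" "z \<in> S"
  shows "vec_deriv f (f1 z) z" "vec_deriv f1 (f2 z) z" "vec_deriv f2 (of_real \<mu> *s f1 z) z"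
    "cdot (f z) (f z) = 0" "cdot (f1 z) (f1 z) = of_real (L\<^sup>2)"
  using assms unfolding null_jet_def by auto

text \<open>Repeated differentiation of \<open>f \<cdot> f = 0\<close> and \<open>f' \<cdot> f' = L\<^sup>2\<close> gives all products: the Gram matrix of
  \<open>f, f', f''\<close> is the same at every point.\<close>
lemma null_jet_gram:
  assumes j: "null_jet S L \<mu> f f1 f2" and S: "open S" and z: "z \<in> S"
  shows "cdot (f z) (f1 z) = 0" "cdot (f1 z) (f2 z) = 0" "cdot (f z) (f2 z) = - of_real (L\<^sup>2)"
    "cdot (f2 z) (f2 z) = - of_real (\<mu> * L\<^sup>2)"
proof -
  have 1: "cdot (f x) (f1 x) = 0" if "x \<in> S" for x
    using deriv_eq_0_if_const_on_open[OF S that _ vec_deriv_cdot[OF null_jetD(1,1)[OF j that]], of 0]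
      null_jetD[OF j] by (simp add: cdot_commute)
  have 2: "cdot (f1 x) (f2 x) = 0" if "x \<in> S" for x
    using deriv_eq_0_if_const_on_open[OF S that _ vec_deriv_cdot[OF null_jetD(2,2)[OF j that]], of "of_real (L\<^sup>2)"]
      null_jetD[OF j] by (simp add: cdot_commute)
  have 3: "cdot (f x) (f2 x) = - of_real (L\<^sup>2)" if "x \<in> S" for x
    using deriv_eq_0_if_const_on_open[OF S that _ vec_deriv_cdot[OF null_jetD(1,2)[OF j that]], of 0]
      null_jetD[OF j that] 1 by (simp add: cdot_commute add_eq_0_iff)
  have 4: "cdot (f2 x) (f2 x) = - of_real (\<mu> * L\<^sup>2)" if "x \<in> S" for x
    using deriv_eq_0_if_const_on_open[OF S that _ vec_deriv_cdot[OF null_jetD(2,3)[OF j that]], of 0]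
      null_jetD[OF j that] 2 by (simp add: cdot_simps add_eq_0_iff)
  show "cdot (f z) (f1 z) = 0" "cdot (f1 z) (f2 z) = 0" "cdot (f z) (f2 z) = - of_real (L\<^sup>2)"
    "cdot (f2 z) (f2 z) = - of_real (\<mu> * L\<^sup>2)"
    using 1 2 3 4 z by auto
qed

text \<open>The determinant of the Gram matrix of \<open>a, b, c\<close> is \<open>- l\<^sup>3\<close> for every value of \<open>cdot c c\<close>; so \<open>a, b, c\<close> form
  a basis.\<close>
lemma gram_nondegenerate:
  fixes v a b c :: "complex^3" and l :: complex
  assumes "l \<noteq> 0"
    and gram: "cdot a a = 0" "cdot a b = 0" "cdot a c = - l" "cdot b b = l" "cdot b c = 0"
    and v: "cdot v a = 0" "cdot v b = 0" "cdot v c = 0"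
  shows "v = 0"
proof -
  define M :: "complex^3^3" where "M = vector [a, b, c]"
  have M: "M $ 1 = a" "M $ 2 = b" "M $ 3 = c" by (simp_all add: M_def)
  have e: "((M ** transpose M) $ i) $ j = cdot (M $ i) (M $ j)" for i j
    by (simp add: matrix_matrix_mult_def transpose_def cdot_def)
  have "det M * det M = det (M ** transpose M)"
    by (simp add: det_mul)
  also have "\<dots> = - (l ^ 3)"
    unfolding det_3 e M using gram cdot_commute[of b a] cdot_commute[of c a] cdot_commute[of c b]
    by (simp add: power3_eq_cube)
  finally have "det M \<noteq> 0" using assms(1) by auto
  then have "invertible M" by (simp add: invertible_det_nz)
  moreover have "M *v v = 0"
    using v by (simp add: vec_eq_iff forall_3 matrix_vector_mult_def M cdot_def mult.commute)
  ultimately show "v = 0"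
    by (metis invertible_def matrix_left_invertible_ker)
qed

section \<open>Kernels of the linear equation\<close>

text \<open>The tail of the exponential series from \<open>x\<^sup>m\<close> on, divided by \<open>x\<^sup>m\<close>. It removes the singularities at \<open>k = 0\<close>
  of \<open>(cosh (k z) - 1) / k\<^sup>2\<close> and \<open>(sinh (k z) - k z) / k\<^sup>3\<close>, and keeps them continuous in \<open>k\<close>.\<close>
definition exp_rem :: "nat \<Rightarrow> complex \<Rightarrow> complex" where
  "exp_rem m x = (\<Sum>n. inverse (fact (n + m)) * x ^ n)"

lemma summable_exp_rem: "summable (\<lambda>n. inverse (fact (n + m)) * x ^ n :: complex)"
proof (rule summable_comparison_test')
  show "summable (\<lambda>n. norm (x ^ n /\<^sub>R fact n))" by (rule summable_norm_exp)
  fix n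
  have "(fact n :: real) \<le> fact (n + m)" by (rule fact_mono) simp
  then have "inverse (fact (n + m)) \<le> (inverse (fact n) :: real)"
    by (intro le_imp_inverse_le) auto
  then show "norm (inverse (fact (n + m)) * x ^ n) \<le> norm (x ^ n /\<^sub>R fact n)"
    by (simp add: norm_mult norm_inverse mult_right_mono)
qed

lemma exp_eq_exp_rem: "exp x = (\<Sum>i<m. x ^ i / fact i) + x ^ m * exp_rem m x"
proof -
  have "exp x = (\<Sum>n. x ^ n /\<^sub>R fact n)" by (simp add: exp_def)
  also have "\<dots> = (\<Sum>n. x ^ (n + m) /\<^sub>R fact (n + m)) + (\<Sum>i<m. x ^ i /\<^sub>R fact i)"
    by (rule suminf_split_initial_segment[OF summable_exp_generic])
  also have "(\<Sum>n. x ^ (n + m) /\<^sub>R fact (n + m)) = (\<Sum>n. x ^ m * (inverse (fact (n + m)) * x ^ n))"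
    by (simp add: scaleR_conv_of_real power_add algebra_simps)
  also have "\<dots> = x ^ m * exp_rem m x"
    unfolding exp_rem_def by (rule suminf_mult[OF summable_exp_rem])
  finally show ?thesis by (simp add: scaleR_conv_of_real divide_inverse mult.commute)
qed

lemma exp_rem_0: "exp_rem m 0 = inverse (fact m)"
  using powser_zero[of "\<lambda>n. inverse (fact (n + m)) :: complex"] by (simp add: exp_rem_def)

lemma continuous_on_exp_rem [continuous_intros]:
  "continuous_on S f \<Longrightarrow> continuous_on S (\<lambda>x. exp_rem m (f x))"
proof (rule continuous_on_compose2[of UNIV "exp_rem m"])
  have "isCont (exp_rem m) x" for x
    unfolding exp_rem_def[abs_def] by (rule isCont_powser_converges_everywhere[OF summable_exp_rem])
  then show "continuous_on UNIV (exp_rem m)" by (simp add: continuous_at_imp_continuous_on)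
qed auto

text \<open>The functions \<open>K3\<close>, \<open>K2\<close>, \<open>K1\<close> are successive derivatives of each other and vanish at \<open>0\<close>. The
  solutions of \<open>g''' = k\<^sup>2 g'\<close> are the combinations of \<open>1\<close>, \<open>K1 k\<close> and \<open>K2 k\<close>, and \<open>K3\<close> appears when these
  are integrated once more to obtain the surface.\<close>
definition K2 :: "complex \<Rightarrow> complex \<Rightarrow> complex" where
  "K2 k z = z\<^sup>2 * (exp_rem 2 (k * z) + exp_rem 2 (- (k * z))) / 2"

definition K3 :: "complex \<Rightarrow> complex \<Rightarrow> complex" where
  "K3 k z = z ^ 3 * (exp_rem 3 (k * z) + exp_rem 3 (- (k * z))) / 2"

text \<open>Equal to \<open>sinh (k z) / k\<close> for \<open>k \<noteq> 0\<close> and to \<open>z\<close> for \<open>k = 0\<close>.\<close>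
definition K1 :: "complex \<Rightarrow> complex \<Rightarrow> complex" where
  "K1 k z = z + k\<^sup>2 * K3 k z"

lemma K2_closed: "k \<noteq> 0 \<Longrightarrow> K2 k z = (cosh (k * z) - 1) / k\<^sup>2" "K2 0 z = z\<^sup>2 / 2"
proof -
  have "cosh x - 1 = x\<^sup>2 * (exp_rem 2 x + exp_rem 2 (- x)) / 2" for x :: complex
  proof -
    have 1: "exp x = 1 + x + x\<^sup>2 * exp_rem 2 x" for x
      using exp_eq_exp_rem[of x 2] by (simp add: eval_nat_numeral)
    show ?thesis
      unfolding cosh_field_def 1[of x] 1[of "- x"] by (simp add: field_simps)
  qed
  from this[of "k * z"] show "k \<noteq> 0 \<Longrightarrow> K2 k z = (cosh (k * z) - 1) / k\<^sup>2"
    by (simp add: K2_def power_mult_distrib)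
qed (simp add: K2_def exp_rem_0)

lemma K3_closed: "k \<noteq> 0 \<Longrightarrow> K3 k z = (sinh (k * z) - k * z) / k ^ 3" "K3 0 z = z ^ 3 / 6"
proof -
  have "sinh x - x = x ^ 3 * (exp_rem 3 x + exp_rem 3 (- x)) / 2" for x :: complex
  proof -
    have 1: "exp x = 1 + x + x\<^sup>2 / 2 + x ^ 3 * exp_rem 3 x" for x
      using exp_eq_exp_rem[of x 3] by (simp add: eval_nat_numeral)
    show ?thesis
      unfolding sinh_field_def 1[of x] 1[of "- x"] by (simp add: field_simps)
  qed
  from this[of "k * z"] show "k \<noteq> 0 \<Longrightarrow> K3 k z = (sinh (k * z) - k * z) / k ^ 3"
    by (simp add: K3_def power_mult_distrib)
qed (simp add: K3_def exp_rem_0 fact_numeral)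

lemma K1_closed: "k \<noteq> 0 \<Longrightarrow> K1 k z = sinh (k * z) / k" "K1 0 z = z"
  by (simp_all add: K1_def K3_closed field_simps power2_eq_square power3_eq_cube)

lemma K_0 [simp]: "K1 k 0 = 0" "K2 k 0 = 0" "K3 k 0 = 0"
  by (simp_all add: K1_def K2_def K3_def)

lemma K_deriv:
  "(K3 k has_field_derivative K2 k z) (at z)"
  "(K2 k has_field_derivative K1 k z) (at z)"
  "(K1 k has_field_derivative 1 + k\<^sup>2 * K2 k z) (at z)"
proof -
  show 3: "(K3 k has_field_derivative K2 k z) (at z)"
  proof (cases "k = 0")
    case True
    then show ?thesis
      by (auto simp: K3_closed(2)[abs_def] K2_closed(2) intro!: derivative_eq_intros)
  next
    case False
    have "((\<lambda>z. (sinh (k * z) - k * z) / k ^ 3) has_field_derivative K2 k z) (at z)"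
      using False by (auto intro!: derivative_eq_intros simp: K2_closed field_simps power2_eq_square power3_eq_cube)
    moreover have "K3 k = (\<lambda>z. (sinh (k * z) - k * z) / k ^ 3)"
      using K3_closed(1)[OF False] by (simp add: fun_eq_iff)
    ultimately show ?thesis by simp
  qed
  show "(K2 k has_field_derivative K1 k z) (at z)"
  proof (cases "k = 0")
    case True
    then show ?thesis
      by (auto simp: K2_closed(2)[abs_def] K1_closed(2) intro!: derivative_eq_intros)
  next
    case False
    have "((\<lambda>z. (cosh (k * z) - 1) / k\<^sup>2) has_field_derivative K1 k z) (at z)"
      using False by (auto intro!: derivative_eq_intros simp: K1_closed field_simps power2_eq_square)
    moreover have "K2 k = (\<lambda>z. (cosh (k * z) - 1) / k\<^sup>2)"
      using K2_closed(1)[OF False] by (simp add: fun_eq_iff)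
    ultimately show ?thesis by simp
  qed
  show "(K1 k has_field_derivative 1 + k\<^sup>2 * K2 k z) (at z)"
    unfolding K1_def[abs_def] by (auto intro!: derivative_eq_intros 3)
qed

text \<open>All three kernels are even in \<open>k\<close>, so any square root of the coefficient of the equation may be used.\<close>
lemma K_cong:
  assumes "k\<^sup>2 = k'\<^sup>2"
  shows "K1 k = K1 k'" "K2 k = K2 k'" "K3 k = K3 k'"
proof -
  have "k = k' \<or> k = - k'" using assms by (simp add: power2_eq_iff)
  then show "K2 k = K2 k'" "K3 k = K3 k'"
    by (auto simp: fun_eq_iff K2_def K3_def add.commute)
  then show "K1 k = K1 k'" using assms by (simp add: fun_eq_iff K1_def)
qed

lemma K_scale: "K2 k (a * z) = a\<^sup>2 * K2 (a * k) z" "K3 k (a * z) = a ^ 3 * K3 (a * k) z"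
  by (simp_all add: K2_def K3_def power_mult_distrib mult_ac)

text \<open>On the conic \<open>x\<^sup>2 - k\<^sup>2 y\<^sup>2 = 1\<close> the product of \<open>x + k y\<close> and \<open>x - k y\<close> is \<open>1\<close>; so \<open>x + k y\<close> is some
  \<open>exp (k z)\<close> and \<open>x - k y\<close> is \<open>exp (- k z)\<close>. At \<open>k = 0\<close> the conic splits into two lines, of which only
  \<open>x = 1\<close> is parametrized.\<close>
lemma K_surjective_conic:
  assumes "x\<^sup>2 - k\<^sup>2 * y\<^sup>2 = 1" "k = 0 \<Longrightarrow> x = 1"
  obtains z where "1 + k\<^sup>2 * K2 k z = x" "K1 k z = y"
proof (cases "k = 0")
  case True
  then show ?thesis using assms that[of y] by (simp add: K1_closed)
next
  case False
  have *: "(x + k * y) * (x - k * y) = 1"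
    using assms(1) by (simp add: algebra_simps power2_eq_square)
  then have "x + k * y \<noteq> 0" by auto
  then have e: "exp (Ln (x + k * y)) = x + k * y" by simp
  have e': "exp (- Ln (x + k * y)) = x - k * y"
    unfolding exp_minus e using * by (metis inverse_unique)
  define z where "z = Ln (x + k * y) / k"
  have kz: "k * z = Ln (x + k * y)" using False by (simp add: z_def)
  have "cosh (k * z) = x" "sinh (k * z) = k * y"
    unfolding cosh_def sinh_def kz e e' by (simp_all add: scaleR_conv_of_real)
  then show ?thesis
    using False by (intro that[of z]) (simp_all add: K1_closed K2_closed)
qed

section \<open>One formula for the whole family, and its continuity\<close>

text \<open>The quotient of \<open>R_factor \<theta>\<close> by \<open>cos \<theta> + sin \<theta>\<close>, in a form that is continuous up to the ends of the
  interval, where both vanish. It is the coefficient of \<open>z\<close> that remains of \<open>X_tilde \<theta>\<close> when the singular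
  terms are combined.\<close>
definition A_factor :: "real \<Rightarrow> real" where
  "A_factor \<theta> = (1 - sin (\<theta> + pi/4)) * sqrt 2 * \<bar>cos (\<theta> + pi/4)\<bar> + 1 / sqrt 2"

definition k_root :: "real \<Rightarrow> complex" where
  "k_root \<theta> = csqrt (of_real (cos (2 * \<theta>)))"

lemma k_root_square: "(k_root \<theta>)\<^sup>2 = of_real (cos (2 * \<theta>))"
  by (simp add: k_root_def)

lemma sin_plus_quarter: "sin (\<theta>::real) + cos \<theta> = sqrt 2 * sin (\<theta> + pi/4)"
  by (simp add: sin_add sin_45 cos_45 algebra_simps)

lemma cos_minus_sin: "cos (\<theta>::real) - sin \<theta> = sqrt 2 * cos (\<theta> + pi/4)"
  by (simp add: cos_add sin_45 cos_45 algebra_simps)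

lemma cos_double_factor: "cos (2 * (\<theta>::real)) = (cos \<theta> - sin \<theta>) * (cos \<theta> + sin \<theta>)"
  unfolding cos_double by (simp add: power2_eq_square algebra_simps)

lemma sin_plus_quarter_nonneg: "\<theta> \<in> {-pi/4..3*pi/4} \<Longrightarrow> 0 \<le> sin (\<theta> + pi/4)"
  by (intro sin_ge_zero) auto

lemma sin_plus_quarter_pos: "\<theta> \<in> {-pi/4<..<3*pi/4} \<Longrightarrow> 0 < sin (\<theta> + pi/4)"
  by (intro sin_gt_zero) auto

lemma cos_plus_sin_pos: "\<theta> \<in> {-pi/4<..<3*pi/4} \<Longrightarrow> 0 < cos \<theta> + sin \<theta>"
  using sin_plus_quarter_pos[of \<theta>] sin_plus_quarter[of \<theta>]
  by (simp add: add.commute[of "cos \<theta>"])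

lemma cos_minus_sin_nonzero:
  assumes "\<theta> \<in> {-pi/4<..<3*pi/4}" "\<theta> \<noteq> pi/4"
  shows "cos \<theta> - sin \<theta> \<noteq> 0"
proof
  assume "cos \<theta> - sin \<theta> = 0"
  then have "cos (\<theta> + pi/4) = cos (pi/2)" using cos_minus_sin[of \<theta>] by simp
  then have "\<theta> + pi/4 = pi/2"
    using assms(1) cos_inj_pi[of "\<theta> + pi/4" "pi/2"] by auto
  then show False using assms(2) by simp
qed

lemma R_factor_eq:
  assumes "\<theta> \<in> {-pi/4..3*pi/4}"
  shows "R_factor \<theta> = A_factor \<theta> * (cos \<theta> + sin \<theta>)"
proof -
  have s: "cos \<theta> + sin \<theta> = sqrt 2 * sin (\<theta> + pi/4)"
    using sin_plus_quarter[of \<theta>] by simp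
  have "\<bar>cos (2 * \<theta>)\<bar> = 2 * (\<bar>cos (\<theta> + pi/4)\<bar> * sin (\<theta> + pi/4))"
    unfolding cos_double_factor cos_minus_sin s
    using sin_plus_quarter_nonneg[OF assms] by (simp add: abs_mult)
  moreover have "(x * r * b + 1 / r) * (r * a) = x * (r * r * (b * a)) + a" if "r \<noteq> 0"
    for a b r x :: real
    using that by (simp add: field_simps)
  from this[of "sqrt 2"] have "(x * sqrt 2 * b + 1 / sqrt 2) * (sqrt 2 * a) = x * (2 * (b * a)) + a"
    for a b x :: real by simp
  ultimately show ?thesis
    unfolding R_factor_def A_factor_def s by simp
qed

text \<open>The real part of an expression that is holomorphic in the point and uniform in \<open>\<theta>\<close>.\<close>
definition X_unified :: "real \<Rightarrow> complex \<Rightarrow> real^3" where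
  "X_unified \<theta> z = vector
     [Re (of_real (A_factor \<theta>) * z - of_real (R_factor \<theta> * sin \<theta>) * K3 (k_root \<theta>) z),
      Re (\<i> * (of_real (A_factor \<theta>) * z + of_real (R_factor \<theta> * cos \<theta>) * K3 (k_root \<theta>) z)),
      Re (of_real (R_factor \<theta>) * K2 (k_root \<theta>) z)]"

lemma X_unified_nth:
  "X_unified \<theta> z $ 1 = A_factor \<theta> * Re z - R_factor \<theta> * sin \<theta> * Re (K3 (k_root \<theta>) z)"
  "X_unified \<theta> z $ 2 = - (A_factor \<theta> * Im z) - R_factor \<theta> * cos \<theta> * Im (K3 (k_root \<theta>) z)"
  "X_unified \<theta> z $ 3 = R_factor \<theta> * Re (K2 (k_root \<theta>) z)"
  by (simp_all add: X_unified_def)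

lemma Re_of_real_divide: "Re ((of_real a + of_real b * p) / of_real c) = (a + b * Re p) / c"
  by (simp add: Re_divide_of_real)

text \<open>Since \<open>k\<^sup>2\<close> is real, conjugation maps \<open>k\<close> to \<open>\<plusminus>k\<close> and the functions \<open>p, q, r, t\<close> of the proof are real.
  They are the real and imaginary parts of \<open>sinh (k z) / k\<close> and \<open>cosh (k z)\<close>.\<close>
lemma X_tilde_generic:
  assumes \<theta>: "\<theta> \<in> {-pi/4<..<3*pi/4}" "\<theta> \<noteq> pi/4"
  shows "X_tilde \<theta> z = X_unified \<theta> z"
proof -
  define k where "k = k_root \<theta>"
  define w where "w = cos (2 * \<theta>)"
  define u where "u = Re z"
  define v where "v = Im z"
  define p where "p = sinh (k * of_real u) * cos (k * of_real v) / k"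
  define q where "q = cosh (k * of_real u) * sin (k * of_real v) / k"
  define r where "r = cosh (k * of_real u) * cos (k * of_real v)"
  define t where "t = sinh (k * of_real u) * sin (k * of_real v)"
  have c_s: "cos \<theta> + sin \<theta> > 0" by (rule cos_plus_sin_pos[OF \<theta>(1)])
  have cs0: "cos \<theta> - sin \<theta> \<noteq> 0" by (rule cos_minus_sin_nonzero[OF \<theta>])
  have w: "w = (cos \<theta> - sin \<theta>) * (cos \<theta> + sin \<theta>)" "w \<noteq> 0"
    using cos_double_factor[of \<theta>] c_s cs0 by (auto simp: w_def)
  have k2: "k\<^sup>2 = of_real w" by (simp add: k_def w_def k_root_square)
  then have k0: "k \<noteq> 0" using w(2) by auto
  have "(cnj k)\<^sup>2 = k\<^sup>2" using k2 by (metis complex_cnj_power complex_cnj_complex_of_real)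
  then have kc: "cnj k = k \<or> cnj k = - k" by (simp add: power2_eq_iff)
  have sh: "cnj (sinh x) = sinh (cnj x)" and ch: "cnj (cosh x) = cosh (cnj x)" for x :: complex
    by (simp_all add: sinh_def cosh_def exp_cnj scaleR_conv_of_real)
  have "cnj p = p" "cnj q = q" "cnj r = r" "cnj t = t"
    using kc by (auto simp: p_def q_def r_def t_def sh ch cnj_sin cnj_cos)
  then have im: "Im p = 0" "Im q = 0" "Im r = 0" "Im t = 0"
    by (simp_all add: complex_eq_iff)
  have z: "k * z = k * of_real u + \<i> * (k * of_real v)"
    by (simp add: u_def v_def complex_eq[of z, symmetric] distrib_left[symmetric] mult.left_commute[of \<i>])
  have ihyp: "sinh (\<i> * x) = \<i> * sin x" "cosh (\<i> * x) = cos x" for x :: complex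
    by (simp_all add: sinh_conv_sin cosh_conv_cos sin_minus cos_minus)
  have S: "sinh (k * z) / k = p + \<i> * q"
    unfolding z sinh_add ihyp p_def q_def by (simp add: add_divide_distrib)
  have Ch: "cosh (k * z) = r + \<i> * t"
    unfolding z cosh_add ihyp r_def t_def by simp
  have K3: "K3 k z = (p + \<i> * q - z) / of_real w"
  proof -
    have "K3 k z = (sinh (k * z) / k - z) / k\<^sup>2"
      using k0 by (simp add: K3_closed field_simps power2_eq_square power3_eq_cube)
    then show ?thesis by (simp add: S k2)
  qed
  have K2: "K2 k z = (r + \<i> * t - 1) / of_real w"
    using k0 by (simp add: K2_closed Ch k2)
  have A: "R_factor \<theta> * (cos \<theta> - sin \<theta>) / w = A_factor \<theta>"
    using R_factor_eq[of \<theta>] \<theta> c_s cs0 by (simp add: w)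
  have b1: "Re (bonnet_formula \<theta> u v $ 1) = (u * cos \<theta> - sin \<theta> * Re p) / w"
  proof -
    have "bonnet_formula \<theta> u v $ 1 = (of_real (u * cos \<theta>) + of_real (- sin \<theta>) * p) / k\<^sup>2"
      using k0 unfolding bonnet_formula_def Let_def k_root_def[symmetric] k_def[symmetric]
      by (simp add: p_def field_simps power2_eq_square power3_eq_cube)
    then show ?thesis unfolding k2 using Re_of_real_divide by simp
  qed
  have b2: "Re (bonnet_formula \<theta> u v $ 2) = (v * sin \<theta> - cos \<theta> * Re q) / w"
  proof -
    have "bonnet_formula \<theta> u v $ 2 = (of_real (v * sin \<theta>) + of_real (- cos \<theta>) * q) / k\<^sup>2"
      using k0 unfolding bonnet_formula_def Let_def k_root_def[symmetric] k_def[symmetric]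
      by (simp add: q_def field_simps power2_eq_square power3_eq_cube)
    then show ?thesis unfolding k2 using Re_of_real_divide by simp
  qed
  have b3: "Re (bonnet_formula \<theta> u v $ 3) = (Re r - 1) / w"
  proof -
    have "bonnet_formula \<theta> u v $ 3 = (of_real (- 1) + of_real 1 * r) / k\<^sup>2"
      unfolding bonnet_formula_def Let_def k_root_def[symmetric] k_def[symmetric]
      by (simp add: r_def)
    then show ?thesis unfolding k2 using Re_of_real_divide[of "-1" 1 r w] by simp
  qed
  have "X_tilde \<theta> z = R_factor \<theta> *\<^sub>R (\<chi> i. Re (bonnet_formula \<theta> u v $ i))"
    using \<theta> by (auto simp: X_tilde_def Let_def u_def v_def)
  also have "\<dots> = X_unified \<theta> z"
  proof -
    have "Re (K3 k z) = (Re p - u) / w" "Im (K3 k z) = (Re q - v) / w" "Re (K2 k z) = (Re r - 1) / w"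
      using im by (simp_all add: K3 K2 Re_divide_of_real Im_divide_of_real u_def v_def)
    moreover have "R_factor \<theta> * ((x * a - s * y) / w) = R_factor \<theta> * (a - s) / w * x - R_factor \<theta> * s * ((y - x) / w)"
      for x y a s
      using w(2) by (simp add: field_simps)
    moreover have "R_factor \<theta> * ((x * s - a * y) / w) = - (R_factor \<theta> * (a - s) / w * x) - R_factor \<theta> * a * ((y - x) / w)"
      for x y a s
      using w(2) by (simp add: field_simps)
    ultimately show ?thesis
      unfolding vec_eq_iff forall_3 X_unified_nth k_def[symmetric]
      unfolding A[symmetric] vector_scaleR_component vec_lambda_beta b1 b2 b3
      by (simp only: u_def[symmetric] v_def[symmetric] simp_thms) simp
  qed
  finally show ?thesis .
qed

lemma X_tilde_eq_unified:
  assumes "\<theta> \<in> {-pi/4..3*pi/4}"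
  shows "X_tilde \<theta> z = X_unified \<theta> z"
proof -
  consider "\<theta> = pi/4" | "\<theta> = -pi/4 \<or> \<theta> = 3*pi/4" | "\<theta> \<in> {-pi/4<..<3*pi/4}" "\<theta> \<noteq> pi/4"
    using assms by fastforce
  then show ?thesis
  proof cases
    case 1
    have "k_root (pi/4) = 0" by (simp add: k_root_def)
    moreover have "A_factor (pi/4) = 1 / sqrt 2" "R_factor (pi/4) = 1"
      by (simp_all add: A_factor_def R_factor_def)
    moreover have "sin (pi/4) = 1 / sqrt 2" "cos (pi/4) = 1 / sqrt 2"
      by (simp_all add: sin_45 cos_45 field_simps)
    moreover have "Re (z ^ 3) = Re z ^ 3 - 3 * Re z * (Im z)\<^sup>2" "Im (z ^ 3) = 3 * (Re z)\<^sup>2 * Im z - Im z ^ 3"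
      by (simp_all add: power3_eq_cube power2_eq_square algebra_simps)
    ultimately show ?thesis unfolding 1 vec_eq_iff forall_3 X_unified_nth
      by (simp add: X_tilde_def Let_def K2_closed K3_closed Re_power2 Re_divide_numeral Im_divide_numeral)
        (simp add: field_simps power2_eq_square power3_eq_cube)
  next
    case 2
    then have "\<theta> + pi/4 = 0 \<or> \<theta> + pi/4 = pi" by (auto simp: field_simps)
    have "sqrt 2 + 1 / sqrt 2 = 3 / sqrt 2"
      by (simp add: field_simps)
    moreover have "sin (\<theta> + pi/4) = 0" "\<bar>cos (\<theta> + pi/4)\<bar> = 1"
      using \<open>\<theta> + pi/4 = 0 \<or> \<theta> + pi/4 = pi\<close> by auto
    moreover have "cos (2 * \<theta>) = 0"
      unfolding cos_double_factor using calculation(2) sin_plus_quarter[of \<theta>] by simp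
    ultimately have "A_factor \<theta> = 3 / sqrt 2" "R_factor \<theta> = 0"
      by (simp_all add: A_factor_def R_factor_def)
    then show ?thesis using 2 unfolding vec_eq_iff forall_3 X_unified_nth
      by (auto simp: X_tilde_def Let_def)
  next
    case 3
    then show ?thesis by (rule X_tilde_generic)
  qed
qed

text \<open>The complex square root jumps across the negative real axis but is continuous along the real axis.\<close>
lemma continuous_k_root: "continuous_on UNIV k_root"
proof -
  have *: "k_root \<theta> = of_real (sqrt (max 0 (cos (2*\<theta>)))) + \<i> * of_real (sqrt (max 0 (- cos (2*\<theta>))))" for \<theta>
    unfolding k_root_def
    by (cases "0 \<le> cos (2*\<theta>)") (auto simp: csqrt_of_real_nonneg csqrt_of_real_nonpos max_def)
  show ?thesis
    unfolding *[abs_def] by (intro continuous_intros)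
qed

lemma continuous_X_unified:
  "continuous_on UNIV (\<lambda>(\<theta>, z). X_unified \<theta> z $ i)"
proof -
  have k: "continuous_on UNIV (\<lambda>x :: real \<times> complex. k_root (fst x))"
    by (rule continuous_on_compose2[OF continuous_k_root]) (auto intro: continuous_intros)
  have "continuous_on UNIV (\<lambda>x. X_unified (fst x) (snd x) $ 1)"
    "continuous_on UNIV (\<lambda>x. X_unified (fst x) (snd x) $ 2)"
    "continuous_on UNIV (\<lambda>x. X_unified (fst x) (snd x) $ 3)"
    unfolding X_unified_nth K2_def K3_def R_factor_def A_factor_def
    by (intro continuous_intros k; simp)+
  then have "continuous_on UNIV (\<lambda>x. X_unified (fst x) (snd x) $ i)"
    using exhaust_3[of i] by auto
  then show ?thesis by (simp add: case_prod_beta')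
qed

lemma X_tilde_uniform_limit:
  assumes \<theta>0: "\<theta>\<^sub>0 \<in> {-pi/4..3*pi/4}" and K: "compact K"
  shows "uniform_limit K (\<lambda>\<theta> z. X_tilde \<theta> z $ i) (\<lambda>z. X_tilde \<theta>\<^sub>0 z $ i)
    (at \<theta>\<^sub>0 within {-pi/4..3*pi/4})"
proof (rule uniform_limitI)
  fix e :: real assume e: "e > 0"
  have "uniformly_continuous_on ({-pi/4..3*pi/4} \<times> K) (\<lambda>(\<theta>, z). X_unified \<theta> z $ i)"
    by (intro compact_uniformly_continuous compact_Times K compact_Icc
        continuous_on_subset[OF continuous_X_unified]) auto
  then obtain d where d: "d > 0"
    "\<And>x y. x \<in> {-pi/4..3*pi/4} \<times> K \<Longrightarrow> y \<in> {-pi/4..3*pi/4} \<times> K \<Longrightarrow> dist y x < d \<Longrightarrow>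
      dist (case y of (\<theta>, z) \<Rightarrow> X_unified \<theta> z $ i) (case x of (\<theta>, z) \<Rightarrow> X_unified \<theta> z $ i) < e"
    unfolding uniformly_continuous_on_def using e by metis
  show "\<forall>\<^sub>F \<theta> in at \<theta>\<^sub>0 within {-pi/4..3*pi/4}.
      \<forall>z\<in>K. dist (X_tilde \<theta> z $ i) (X_tilde \<theta>\<^sub>0 z $ i) < e"
    unfolding eventually_at
  proof (intro exI[of _ d] conjI ballI impI d(1))
    fix \<theta> z assume "\<theta> \<in> {-pi/4..3*pi/4}" "\<theta> \<noteq> \<theta>\<^sub>0 \<and> dist \<theta> \<theta>\<^sub>0 < d" "z \<in> K"
    then show "dist (X_tilde \<theta> z $ i) (X_tilde \<theta>\<^sub>0 z $ i) < e"
      using d(2)[of "(\<theta>\<^sub>0, z)" "(\<theta>, z)"] \<theta>0 by (simp add: X_tilde_eq_unified dist_Pair_Pair)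
  qed
qed

section \<open>Normal form of null jets\<close>

lemma K_pythagoras: "(K1 k z)\<^sup>2 = 2 * K2 k z + k\<^sup>2 * (K2 k z)\<^sup>2"
proof (cases "k = 0")
  case True
  then show ?thesis by (simp add: K1_closed K2_closed)
next
  case False
  have "(K1 k z)\<^sup>2 = ((cosh (k * z))\<^sup>2 - 1) / k\<^sup>2"
    using hyperbolic_pythagoras[of "k * z"] False by (simp add: K1_closed power_divide algebra_simps)
  also have "\<dots> = (2 * (cosh (k * z) - 1) + (cosh (k * z) - 1)\<^sup>2) / k\<^sup>2"
    by (simp add: power2_eq_square algebra_simps)
  also have "\<dots> = 2 * K2 k z + k\<^sup>2 * (K2 k z)\<^sup>2"
    using False by (simp add: K2_closed add_divide_distrib power_divide power2_eq_square)
  finally show ?thesis .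
qed

lemma zero_derivative_constant:
  fixes f :: "complex \<Rightarrow> complex"
  assumes "open S" "connected S" "\<And>z. z \<in> S \<Longrightarrow> (f has_field_derivative 0) (at z)" "z \<in> S" "z1 \<in> S"
  shows "f z = f z1"
  using assms by (intro has_derivative_zero_unique_connected[OF assms(1,2) _ assms(4,5)])
    (auto simp: has_field_derivative_def lambda_zero)

text \<open>The functions \<open>g2 - k\<^sup>2 g\<close>, \<open>exp (k z) (g1 - k g)\<close> and \<open>exp (- k z) g\<close> are, in turn, constant.\<close>
lemma linear_ode_unique:
  fixes g g1 g2 :: "complex \<Rightarrow> complex"
  assumes S: "open S" "connected S" and z1: "z1 \<in> S" "g z1 = 0" "g1 z1 = 0" "g2 z1 = 0"
    and d: "\<And>z. z \<in> S \<Longrightarrow> (g has_field_derivative g1 z) (at z)"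
      "\<And>z. z \<in> S \<Longrightarrow> (g1 has_field_derivative g2 z) (at z)"
      "\<And>z. z \<in> S \<Longrightarrow> (g2 has_field_derivative k\<^sup>2 * g1 z) (at z)"
    and z: "z \<in> S"
  shows "g z = 0" "g1 z = 0" "g2 z = 0"
proof -
  have 2: "g2 x = k\<^sup>2 * g x" if "x \<in> S" for x
  proof -
    have "g2 x - k\<^sup>2 * g x = g2 z1 - k\<^sup>2 * g z1"
      by (rule zero_derivative_constant[OF S _ that z1(1)])
        (auto intro!: derivative_eq_intros d)
    then show ?thesis using z1 by simp
  qed
  have 1: "g1 x = k * g x" if "x \<in> S" for x
  proof -
    have "exp (k * x) * (g1 x - k * g x) = exp (k * z1) * (g1 z1 - k * g z1)"
      by (rule zero_derivative_constant[OF S _ that z1(1)])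
        (auto intro!: derivative_eq_intros d simp: 2 algebra_simps power2_eq_square)
    then show ?thesis using z1 by simp
  qed
  have "exp (- (k * z)) * g z = exp (- (k * z1)) * g z1"
    by (rule zero_derivative_constant[OF S _ z z1(1)])
      (auto intro!: derivative_eq_intros d simp: 1)
  then show 0: "g z = 0" using z1 by simp
  show "g1 z = 0" "g2 z = 0" using 1[OF z] 2[OF z] 0 by simp_all
qed

lemma null_jet_solution:
  assumes S: "open S" "connected S" and j: "null_jet S L \<mu> f f1 f2" and z1: "z1 \<in> S"
    and k: "k\<^sup>2 = of_real \<mu>" and z: "z \<in> S"
  shows "f z = f z1 + K1 k (z - z1) *s f1 z1 + K2 k (z - z1) *s f2 z1"
    "f1 z = (1 + k\<^sup>2 * K2 k (z - z1)) *s f1 z1 + K1 k (z - z1) *s f2 z1"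
    "f2 z = (k\<^sup>2 * K1 k (z - z1)) *s f1 z1 + (1 + k\<^sup>2 * K2 k (z - z1)) *s f2 z1"
proof -
  note K = K_deriv[THEN DERIV_chain2]
  have *: "f z $ i - (f z1 $ i + K1 k (z - z1) * f1 z1 $ i + K2 k (z - z1) * f2 z1 $ i) = 0 \<and>
    f1 z $ i - ((1 + k\<^sup>2 * K2 k (z - z1)) * f1 z1 $ i + K1 k (z - z1) * f2 z1 $ i) = 0 \<and>
    f2 z $ i - (k\<^sup>2 * K1 k (z - z1) * f1 z1 $ i + (1 + k\<^sup>2 * K2 k (z - z1)) * f2 z1 $ i) = 0" for i
  proof -
    have d: "((\<lambda>x. f x $ i) has_field_derivative f1 x $ i) (at x)"
      "((\<lambda>x. f1 x $ i) has_field_derivative f2 x $ i) (at x)"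
      "((\<lambda>x. f2 x $ i) has_field_derivative k\<^sup>2 * f1 x $ i) (at x)" if "x \<in> S" for x
      using null_jetD(1-3)[OF j that] k by (simp_all add: vec_deriv_def)
    show ?thesis
      by (intro conjI linear_ode_unique[OF S z1(1), where k = k and z = z,
            of "\<lambda>z. f z $ i - (f z1 $ i + K1 k (z - z1) * f1 z1 $ i + K2 k (z - z1) * f2 z1 $ i)"
               "\<lambda>z. f1 z $ i - ((1 + k\<^sup>2 * K2 k (z - z1)) * f1 z1 $ i + K1 k (z - z1) * f2 z1 $ i)"
               "\<lambda>z. f2 z $ i - (k\<^sup>2 * K1 k (z - z1) * f1 z1 $ i + (1 + k\<^sup>2 * K2 k (z - z1)) * f2 z1 $ i)"])
        (auto intro!: derivative_eq_intros d K z simp: algebra_simps)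
  qed
  show "f z = f z1 + K1 k (z - z1) *s f1 z1 + K2 k (z - z1) *s f2 z1"
    "f1 z = (1 + k\<^sup>2 * K2 k (z - z1)) *s f1 z1 + K1 k (z - z1) *s f2 z1"
    "f2 z = (k\<^sup>2 * K1 k (z - z1)) *s f1 z1 + (1 + k\<^sup>2 * K2 k (z - z1)) *s f2 z1"
    using * by (simp_all add: vec_eq_iff algebra_simps)
qed

text \<open>The explicit solution with the initial values at \<open>z1\<close> is entire. Its products are computed from the Gram
  matrix at \<open>z1\<close> and the identity \<open>K_pythagoras\<close>.\<close>
lemma null_jet_extend:
  assumes S: "open S" "connected S" and j: "null_jet S L \<mu> f f1 f2" and z1: "z1 \<in> S"
  obtains g g1 g2 where "null_jet UNIV L \<mu> g g1 g2" "\<And>z. z \<in> S \<Longrightarrow> f z = g z"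
proof -
  define k where "k = csqrt (of_real \<mu>)"
  have k: "k\<^sup>2 = of_real \<mu>" by (simp add: k_def)
  define g where "g z = f z1 + K1 k (z - z1) *s f1 z1 + K2 k (z - z1) *s f2 z1" for z
  define g1 where "g1 z = (1 + k\<^sup>2 * K2 k (z - z1)) *s f1 z1 + K1 k (z - z1) *s f2 z1" for z
  define g2 where "g2 z = (k\<^sup>2 * K1 k (z - z1)) *s f1 z1 + (1 + k\<^sup>2 * K2 k (z - z1)) *s f2 z1" for z
  note gram = null_jetD(4,5)[OF j z1] null_jet_gram[OF j S(1) z1]
  note K = K_deriv[THEN DERIV_chain2]
  have "cdot (g z) (g z) = of_real (L\<^sup>2) * ((K1 k (z - z1))\<^sup>2 - 2 * K2 k (z - z1) - k\<^sup>2 * (K2 k (z - z1))\<^sup>2)" for z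
    unfolding g_def
    by (simp add: cdot_simps gram cdot_commute[of "f1 z1" "f z1"] cdot_commute[of "f2 z1" "f z1"]
        cdot_commute[of "f2 z1" "f1 z1"] k k[unfolded power2_eq_square] algebra_simps power2_eq_square)
  then have "cdot (g z) (g z) = 0" for z
    by (simp add: K_pythagoras)
  moreover have g1g1: "cdot (g1 z) (g1 z) = of_real (L\<^sup>2) * ((1 + k\<^sup>2 * K2 k (z - z1))\<^sup>2 - k\<^sup>2 * (K1 k (z - z1))\<^sup>2)" for z
    unfolding g1_def
    by (simp add: cdot_simps gram cdot_commute[of "f2 z1" "f1 z1"] k k[unfolded power2_eq_square] algebra_simps power2_eq_square)
  have "cdot (g1 z) (g1 z) = of_real (L\<^sup>2)" for z
  proof -
    have "(1 + k\<^sup>2 * K2 k (z - z1))\<^sup>2 - k\<^sup>2 * (K1 k (z - z1))\<^sup>2 = 1"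
      unfolding K_pythagoras by (simp add: algebra_simps power2_eq_square)
    then show ?thesis using g1g1[of z] by simp
  qed
  moreover have "vec_deriv g (g1 z) z" "vec_deriv g1 (g2 z) z" "vec_deriv g2 (of_real \<mu> *s g1 z) z" for z
    unfolding vec_deriv_def g_def g1_def g2_def k[symmetric]
    by (auto intro!: derivative_eq_intros K simp: algebra_simps)
  ultimately have "null_jet UNIV L \<mu> g g1 g2"
    by (simp add: null_jet_def)
  then show thesis
    using that null_jet_solution(1)[OF S j z1 k] by (auto simp: g_def)
qed

definition cvec :: "real^3 \<Rightarrow> complex^3" where "cvec n = (\<chi> i. of_real (n $ i))"
definition rvec :: "complex^3 \<Rightarrow> real^3" where "rvec v = (\<chi> i. Re (v $ i))"
definition ivec :: "complex^3 \<Rightarrow> real^3" where "ivec v = (\<chi> i. Im (v $ i))"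

lemma inner_3: "(x::real^3) \<bullet> y = x$1 * y$1 + x$2 * y$2 + x$3 * y$3"
  by (simp add: inner_vec_def sum_3)

lemma cdot_cvec: "cdot (cvec n) v = Complex (n \<bullet> rvec v) (n \<bullet> ivec v)"
  by (simp add: complex_eq_iff cdot_3 inner_3 cvec_def rvec_def ivec_def)

lemma cdot_self: "cdot v v = Complex (rvec v \<bullet> rvec v - ivec v \<bullet> ivec v) (2 * (rvec v \<bullet> ivec v))"
  by (simp add: complex_eq_iff cdot_3 inner_3 rvec_def ivec_def)

lemma cdot_cvec_cvec: "cdot (cvec x) (cvec y) = of_real (x \<bullet> y)"
  by (simp add: complex_eq_iff cdot_3 inner_3 cvec_def)

lemma unit_orthogonal_to_two:
  fixes x y :: "real^3"
  obtains n where "norm n = 1" "n \<bullet> x = 0" "n \<bullet> y = 0"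
proof -
  have "dim {x, y} \<le> card {x, y}" by (intro dim_le_card') auto
  also have "\<dots> < DIM(real^3)" by (auto simp: card_insert_if)
  finally obtain a where a: "a \<noteq> 0" "\<And>v. v \<in> span {x, y} \<Longrightarrow> orthogonal a v"
    by (rule orthogonal_to_subspace_exists) blast
  show thesis
    using a a(2)[OF span_base[of x]] a(2)[OF span_base[of y]]
    by (intro that[of "sgn a"]) (simp_all add: norm_sgn sgn_div_norm orthogonal_def)
qed

text \<open>The vector \<open>d = f'' - \<mu> f\<close> is constant and orthogonal to \<open>f'\<close> and \<open>f''\<close>. Let \<open>n\<close> be a real unit vector
  orthogonal to the real and the imaginary part of \<open>d\<close>. Then \<open>L n\<close> lies in the plane spanned by \<open>f'\<close> and
  \<open>f''\<close> at \<open>0\<close>, on the conic of vectors with square \<open>L\<^sup>2\<close>, and \<open>f'\<close> parametrizes this conic.\<close>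
lemma null_jet_critical_point:
  assumes j: "null_jet UNIV L \<mu> f f1 f2" and L: "L > 0"
  obtains z0 n where "norm n = 1" "f1 z0 = of_real L *s cvec n"
proof -
  define k where "k = csqrt (of_real \<mu>)"
  have k: "k\<^sup>2 = of_real \<mu>" by (simp add: k_def)
  note gram = null_jetD(4,5)[OF j UNIV_I, of 0] null_jet_gram[OF j open_UNIV UNIV_I, of 0]
  define d where "d = f2 0 - of_real \<mu> *s f 0"
  obtain n where n: "norm n = 1" "n \<bullet> rvec d = 0" "n \<bullet> ivec d = 0"
    using unit_orthogonal_to_two by blast
  define x where "x = cdot (of_real L *s cvec n) (f1 0) / of_real (L\<^sup>2)"
  define y where "y = - cdot (of_real L *s cvec n) (f 0) / of_real (L\<^sup>2)"
  define r where "r = of_real L *s cvec n - x *s f1 0 - y *s f2 0"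
  have L2: "complex_of_real (L\<^sup>2) \<noteq> 0" using L by simp
  have "cdot (cvec n) d = 0" using n by (simp add: cdot_cvec complex_eq_iff)
  then have nd: "cdot (cvec n) (f2 0) = of_real \<mu> * cdot (cvec n) (f 0)"
    by (simp add: d_def cdot_simps)
  have "r = 0"
  proof (rule gram_nondegenerate[OF L2 gram(1,3,5,2,4)])
    show "cdot r (f 0) = 0" "cdot r (f1 0) = 0"
      using L by (simp_all add: r_def cdot_simps gram cdot_commute[of "f1 0" "f 0"]
          cdot_commute[of "f2 0" "f 0"] cdot_commute[of "f2 0" "f1 0"] x_def y_def)
    show "cdot r (f2 0) = 0"
      using L by (simp add: r_def cdot_simps gram nd x_def y_def)
  qed
  then have eq: "of_real L *s cvec n = x *s f1 0 + y *s f2 0"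
    by (simp add: r_def algebra_simps)
  have "of_real (L\<^sup>2) = cdot (of_real L *s cvec n) (of_real L *s cvec n)"
    using n(1) by (simp add: cdot_simps cdot_cvec_cvec power2_eq_square dot_square_norm)
  also have "\<dots> = of_real (L\<^sup>2) * (x\<^sup>2 - k\<^sup>2 * y\<^sup>2)"
    unfolding eq by (simp add: cdot_simps gram cdot_commute[of "f2 0" "f1 0"] k k[unfolded power2_eq_square] algebra_simps power2_eq_square)
  finally have conic: "x\<^sup>2 - k\<^sup>2 * y\<^sup>2 = 1" using L by simp
  \<comment> \<open>For \<open>k = 0\<close> the conic is a pair of lines and the sign of \<open>n\<close> selects the right one.\<close>
  define \<epsilon> :: real where "\<epsilon> = (if k = 0 \<and> x \<noteq> 1 then -1 else 1)"
  have \<epsilon>: "\<epsilon> * \<epsilon> = 1" by (simp add: \<epsilon>_def)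
  have "(of_real \<epsilon> * x)\<^sup>2 - k\<^sup>2 * (of_real \<epsilon> * y)\<^sup>2 = 1"
    using conic by (auto simp: \<epsilon>_def)
  moreover have "of_real \<epsilon> * x = 1" if "k = 0"
    using conic that by (auto simp: \<epsilon>_def power2_eq_1_iff)
  ultimately obtain z where z: "1 + k\<^sup>2 * K2 k z = of_real \<epsilon> * x" "K1 k z = of_real \<epsilon> * y"
    using K_surjective_conic by metis
  have "f1 z = of_real \<epsilon> *s (of_real L *s cvec n)"
    using null_jet_solution(2)[OF open_UNIV connected_UNIV j UNIV_I k UNIV_I, of z 0] z
    by (simp add: eq vector_add_ldistrib vector_smult_assoc)
  also have "\<dots> = of_real L *s cvec (\<epsilon> *\<^sub>R n)"
    by (simp add: vec_eq_iff cvec_def)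
  finally show thesis
    using that[of "\<epsilon> *\<^sub>R n" z] n by (simp add: \<epsilon>_def)
qed

text \<open>The map \<open>Y\<close> behaves at \<open>z\<close> like the real part of a holomorphic curve with derivative \<open>v\<close>; for conformal
  \<open>Y\<close> this means \<open>v = Y\<^sub>u - \<i> Y\<^sub>v\<close>.\<close>
definition has_cgrad :: "(complex \<Rightarrow> real^3) \<Rightarrow> complex^3 \<Rightarrow> complex \<Rightarrow> bool" where
  "has_cgrad Y v z \<longleftrightarrow> (Y has_derivative (\<lambda>w. \<chi> i. Re (v $ i * w))) (at z)"

lemma has_cgrad_component:
  "has_cgrad Y v z \<longleftrightarrow> (\<forall>i. ((\<lambda>x. Y x $ i) has_derivative (\<lambda>w. Re (v $ i * w))) (at z))"
proof -
  have "has_cgrad Y v z \<longleftrightarrow>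
      (\<forall>i. ((\<lambda>x. Y x \<bullet> axis i 1) has_derivative (\<lambda>w. (\<chi> i. Re (v $ i * w)) \<bullet> axis i 1)) (at z))"
    unfolding has_cgrad_def has_derivative_componentwise_within[of Y] by (auto simp: Basis_vec_def)
  then show ?thesis by (simp add: inner_axis)
qed

lemma has_derivative_Re:
  "(g has_field_derivative d) (at z) \<Longrightarrow> ((\<lambda>x. Re (g x)) has_derivative (\<lambda>w. Re (d * w))) (at z)"
  unfolding has_field_derivative_def by (auto intro!: derivative_eq_intros)

lemma has_cgrad_unique_upto_translation:
  assumes S: "open S" "connected S"
    and "\<And>z. z \<in> S \<Longrightarrow> has_cgrad X (f z) z" "\<And>z. z \<in> S \<Longrightarrow> has_cgrad Y (f z) z"
  obtains b where "\<And>z. z \<in> S \<Longrightarrow> X z = Y z + b"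
proof (cases "S = {}")
  case False
  then obtain z1 where z1: "z1 \<in> S" by blast
  have "X z - Y z = X z1 - Y z1" if "z \<in> S" for z
  proof (rule has_derivative_zero_unique_connected[OF S _ that z1])
    fix z assume "z \<in> S"
    from has_derivative_diff[OF assms(3)[OF this, unfolded has_cgrad_def] assms(4)[OF this, unfolded has_cgrad_def]]
    show "((\<lambda>z. X z - Y z) has_derivative (\<lambda>x. 0)) (at z)" by simp
  qed
  then show thesis using that[of "X z1 - Y z1"] by (metis diff_eq_eq add.commute)
qed (use that in auto)

lemma orthonormal_frame_transformation:
  fixes e1 e2 e3 :: "real^3"
  assumes "e1 \<bullet> e1 = 1" "e2 \<bullet> e2 = 1" "e3 \<bullet> e3 = 1" "e1 \<bullet> e2 = 0" "e1 \<bullet> e3 = 0" "e2 \<bullet> e3 = 0"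
  shows "orthogonal_transformation (\<lambda>x::real^3. x$1 *\<^sub>R e1 + x$2 *\<^sub>R e2 + x$3 *\<^sub>R e3)"
  unfolding orthogonal_transformation_def
proof (intro conjI allI)
  show "linear (\<lambda>x::real^3. x$1 *\<^sub>R e1 + x$2 *\<^sub>R e2 + x$3 *\<^sub>R e3)"
    by (rule linearI) (simp_all add: algebra_simps)
  show "(v$1 *\<^sub>R e1 + v$2 *\<^sub>R e2 + v$3 *\<^sub>R e3) \<bullet> (w$1 *\<^sub>R e1 + w$2 *\<^sub>R e2 + w$3 *\<^sub>R e3) = v \<bullet> w"
    for v w :: "real^3"
    using assms inner_commute[of e2 e1] inner_commute[of e3 e1] inner_commute[of e3 e2]
    by (simp add: inner_add_left inner_add_right inner_3[of v w])
qed

text \<open>Where \<open>f'\<close> is real, the null vector \<open>f\<close> is \<open>\<rho> (e1 + \<i> e2)\<close> for a real frame orthogonal to \<open>f'\<close>, and the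
  three numbers \<open>\<rho>, L, \<mu>\<close> determine \<open>f''\<close>.\<close>
lemma null_jet_frame:
  assumes j: "null_jet UNIV L \<mu> f f1 f2" and L: "L > 0"
    and n: "norm n = 1" "f1 z0 = of_real L *s cvec n"
  obtains \<rho> e1 e2 where "\<rho> > 0" "e1 \<bullet> e1 = 1" "e2 \<bullet> e2 = 1" "e1 \<bullet> e2 = 0" "e1 \<bullet> n = 0" "e2 \<bullet> n = 0"
    "f z0 = of_real \<rho> *s (cvec e1 + \<i> *s cvec e2)"
    "f2 z0 = of_real ((\<mu> * \<rho> - L\<^sup>2 / \<rho>) / 2) *s cvec e1 + (\<i> * of_real ((\<mu> * \<rho> + L\<^sup>2 / \<rho>) / 2)) *s cvec e2"
proof -
  note gram = null_jetD(4,5)[OF j UNIV_I, of z0] null_jet_gram[OF j open_UNIV UNIV_I, of z0]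
  have nn: "n \<bullet> n = 1" using n(1) by (simp add: dot_square_norm)
  define x where "x = rvec (f z0)"
  define y where "y = ivec (f z0)"
  have null: "x \<bullet> x = y \<bullet> y" "x \<bullet> y = 0"
    using gram(1) by (simp_all add: cdot_self complex_eq_iff x_def y_def)
  have "cdot (cvec n) (f z0) = 0"
    using gram(3) L by (simp add: n(2) cdot_simps cdot_commute[of "f z0" "cvec n"])
  then have perp: "n \<bullet> x = 0" "n \<bullet> y = 0"
    by (simp_all add: cdot_cvec complex_eq_iff x_def y_def)
  define \<rho> where "\<rho> = norm x"
  have fxy: "f z0 = cvec x + \<i> *s cvec y"
    by (simp add: vec_eq_iff cvec_def x_def y_def rvec_def ivec_def complex_eq_iff)
  have "x \<noteq> 0"
  proof
    assume x0: "x = 0"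
    then have "y = 0" using null(1) by simp
    then have "f z0 = 0" using fxy x0 by (simp add: vec_eq_iff cvec_def)
    then show False using gram(5) L by (simp add: cdot_3)
  qed
  then have \<rho>: "\<rho> > 0" by (simp add: \<rho>_def)
  define e1 where "e1 = (1 / \<rho>) *\<^sub>R x"
  define e2 where "e2 = (1 / \<rho>) *\<^sub>R y"
  have xx: "x \<bullet> x = \<rho> * \<rho>" "y \<bullet> y = \<rho> * \<rho>"
    using null(1) by (simp_all add: \<rho>_def dot_square_norm power2_eq_square)
  have e: "e1 \<bullet> e1 = 1" "e2 \<bullet> e2 = 1" "e1 \<bullet> e2 = 0" "e1 \<bullet> n = 0" "e2 \<bullet> n = 0"
    using \<rho> xx null(2) perp by (simp_all add: e1_def e2_def inner_commute[of _ n])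
  have f: "f z0 = of_real \<rho> *s (cvec e1 + \<i> *s cvec e2)"
    unfolding fxy e1_def e2_def using \<rho> by (simp add: vec_eq_iff cvec_def distrib_left)
  define \<alpha> where "\<alpha> = (\<mu> * \<rho> - L\<^sup>2 / \<rho>) / 2"
  define \<beta> where "\<beta> = (\<mu> * \<rho> + L\<^sup>2 / \<rho>) / 2"
  define g where "g = of_real \<alpha> *s cvec e1 + (\<i> * of_real \<beta>) *s cvec e2"
  have \<alpha>\<beta>: "\<rho> * (\<alpha> - \<beta>) = - L\<^sup>2" "\<alpha> * \<alpha> - \<beta> * \<beta> = - (\<mu> * L\<^sup>2)"
    using \<rho> by (simp_all add: \<alpha>_def \<beta>_def field_simps power2_eq_square)
  note dots = cdot_simps cdot_cvec_cvec e inner_commute[of e2 e1] inner_commute[of n e1] inner_commute[of n e2] nn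
  have fg: "cdot (f z0) g = - of_real (L\<^sup>2)"
    using arg_cong[OF \<alpha>\<beta>(1), of complex_of_real]
    by (simp add: f g_def dots algebra_simps)
  have gg: "cdot g g = - of_real (\<mu> * L\<^sup>2)"
    using arg_cong[OF \<alpha>\<beta>(2), of complex_of_real]
    by (simp add: g_def dots algebra_simps)
  have ng: "cdot (f1 z0) g = 0" by (simp add: n(2) g_def dots)
  have L2: "complex_of_real (L\<^sup>2) \<noteq> 0" using L by simp
  \<comment> \<open>Both \<open>g\<close> and \<open>f2 z0\<close> have the same products with \<open>f z0\<close> and \<open>f1 z0\<close>, so they differ by a
    multiple of the null vector \<open>f z0\<close>; having the same square, they are equal.\<close>
  define t where "t = - cdot (f2 z0 - g) g / of_real (L\<^sup>2)"
  have "f2 z0 - g - t *s f z0 = 0"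
  proof (rule gram_nondegenerate[OF L2 gram(1,3) fg gram(2) ng])
    show "cdot (f2 z0 - g - t *s f z0) (f z0) = 0"
      using fg by (simp add: cdot_simps gram cdot_commute[of g "f z0"] cdot_commute[of "f2 z0" "f z0"])
    show "cdot (f2 z0 - g - t *s f z0) (f1 z0) = 0"
      using ng gram by (simp add: cdot_simps cdot_commute[of g "f1 z0"] cdot_commute[of "f2 z0" "f1 z0"])
    show "cdot (f2 z0 - g - t *s f z0) g = 0"
      using fg L by (simp add: cdot_simps t_def)
  qed
  then have ft: "f2 z0 = g + t *s f z0" by (simp add: algebra_simps)
  have "cdot (f2 z0) (f2 z0) = cdot g g - 2 * t * of_real (L\<^sup>2)"
    unfolding ft using fg gram(1) by (simp add: cdot_simps cdot_commute[of g "f z0"] algebra_simps)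
  then have "t = 0" using gg gram(6) L by simp
  then have "f2 z0 = g" using ft by simp
  then show thesis
    using that[OF \<rho> e f] unfolding g_def \<alpha>_def \<beta>_def by blast
qed

text \<open>At \<open>z0\<close> the jet is given by a frame and the numbers \<open>\<rho>, L, \<mu>\<close>; the jet of \<open>X_tilde \<theta>\<close> at \<open>0\<close> has the
  numbers \<open>A_factor \<theta>, R_factor \<theta>, cos (2 \<theta>)\<close>. The factor \<open>a\<close> in the coordinates and a factor in space
  match two of them, and the last assumption, which says that \<open>\<mu> \<rho>\<^sup>2 / L\<^sup>2 = tan (\<pi>/4 - \<theta>)\<close>, the third.\<close>
lemma null_jet_similar_to_X_tilde:
  fixes f f1 f2 :: "complex \<Rightarrow> complex^3"
  assumes S: "open S" "connected S"
    and j: "null_jet UNIV L \<mu> f f1 f2" and L: "L > 0"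
    and n: "norm n = 1" "f1 z0 = of_real L *s cvec n"
    and Y: "\<And>z. z \<in> S \<Longrightarrow> has_cgrad Y (f z) z"
    and \<theta>: "\<theta> \<in> {-pi/4<..<3*pi/4}"
    and ang: "\<mu> * (\<Sum>i\<in>UNIV. (norm (f z0 $ i))\<^sup>2) * (cos \<theta> + sin \<theta>) = 2 * L\<^sup>2 * (cos \<theta> - sin \<theta>)"
  obtains a F where "a > 0" "similarity F" "\<And>z. z \<in> S \<Longrightarrow> Y z = F (X_tilde \<theta> (of_real a * (z - z0)))"
proof -
  obtain \<rho> e1 e2 where fr: "\<rho> > 0" "e1 \<bullet> e1 = 1" "e2 \<bullet> e2 = 1" "e1 \<bullet> e2 = 0" "e1 \<bullet> n = 0" "e2 \<bullet> n = 0"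
    "f z0 = of_real \<rho> *s (cvec e1 + \<i> *s cvec e2)"
    "f2 z0 = of_real ((\<mu> * \<rho> - L\<^sup>2 / \<rho>) / 2) *s cvec e1 + (\<i> * of_real ((\<mu> * \<rho> + L\<^sup>2 / \<rho>) / 2)) *s cvec e2"
    using null_jet_frame[OF j L n] by blast
  define c where "c = cos \<theta>"
  define s where "s = sin \<theta>"
  have cs: "c + s > 0"
    using cos_plus_sin_pos[OF \<theta>] by (simp add: c_def s_def)
  have "(norm (f z0 $ i))\<^sup>2 = \<rho>\<^sup>2 * ((e1 $ i)\<^sup>2 + (e2 $ i)\<^sup>2)" for i
    unfolding fr(7) by (simp add: cvec_def cmod_power2 power_mult_distrib distrib_left)
  then have "(\<Sum>i\<in>UNIV. (norm (f z0 $ i))\<^sup>2) = \<rho>\<^sup>2 * (e1 \<bullet> e1 + e2 \<bullet> e2)"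
    by (simp add: sum_3 inner_3 power2_eq_square algebra_simps)
  then have ang': "\<mu> * \<rho>\<^sup>2 * (c + s) = L\<^sup>2 * (c - s)"
    using ang fr(2,3) by (simp add: c_def s_def)
  define a where "a = L / (\<rho> * (c + s))"
  have a: "a > 0" using L fr(1) cs by (simp add: a_def)
  define A where "A = A_factor \<theta>"
  define R where "R = R_factor \<theta>"
  have RA: "R = A * (c + s)" using R_factor_eq[of \<theta>] \<theta> by (simp add: R_def A_def c_def s_def)
  have A: "A > 0"
  proof -
    have "0 \<le> (1 - sin (\<theta> + pi/4)) * sqrt 2 * \<bar>cos (\<theta> + pi/4)\<bar>" by simp
    moreover have "0 < 1 / sqrt (2::real)" by simp
    ultimately show ?thesis unfolding A_def A_factor_def by linarith
  qed
  define C where "C = \<rho> / (a * A)"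
  have C: "C > 0" using a A fr(1) by (simp add: C_def)
  define k where "k = csqrt (of_real \<mu>)"
  have k: "k\<^sup>2 = of_real \<mu>" by (simp add: k_def)
  have \<mu>: "a\<^sup>2 * cos (2 * \<theta>) = \<mu>"
  proof -
    have "a\<^sup>2 * cos (2 * \<theta>) = L\<^sup>2 * (c - s) / (\<rho>\<^sup>2 * (c + s))"
      unfolding cos_double_factor using cs fr(1)
      by (simp add: a_def c_def s_def power_divide power_mult_distrib power2_eq_square)
    also have "\<dots> = \<mu>" using cs fr(1) by (simp add: ang'[symmetric])
    finally show ?thesis .
  qed
  have "(of_real a * k_root \<theta>)\<^sup>2 = k\<^sup>2"
    unfolding k power_mult_distrib k_root_square by (simp add: \<mu>[symmetric])
  note K_cong[OF this]
  then have K: "K2 (k_root \<theta>) (of_real a * \<zeta>) = of_real (a\<^sup>2) * K2 k \<zeta>"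
    "K3 (k_root \<theta>) (of_real a * \<zeta>) = of_real (a ^ 3) * K3 k \<zeta>" for \<zeta>
    by (simp_all add: K_scale)
  define Q where "Q x = x$1 *\<^sub>R e1 + x$2 *\<^sub>R e2 + x$3 *\<^sub>R n" for x :: "real^3"
  have Q: "orthogonal_transformation Q"
    unfolding Q_def[abs_def] using fr n(1)
    by (intro orthonormal_frame_transformation) (auto simp: dot_square_norm)
  define \<alpha> where "\<alpha> = (\<mu> * \<rho> - L\<^sup>2 / \<rho>) / 2"
  define \<beta> where "\<beta> = (\<mu> * \<rho> + L\<^sup>2 / \<rho>) / 2"
  have m: "\<mu> = L\<^sup>2 * (c - s) / (\<rho>\<^sup>2 * (c + s))"
    unfolding ang'[symmetric] using fr(1) cs by simp
  have co: "C * A * a = \<rho>" "C * R * a\<^sup>2 = L" "C * R * s * a ^ 3 = - \<alpha>" "C * R * c * a ^ 3 = \<beta>"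
  proof -
    show "C * A * a = \<rho>" using a A by (simp add: C_def)
    have "C * R * a\<^sup>2 = (C * A * a) * (c + s) * a" by (simp add: RA power2_eq_square)
    also have "\<dots> = L" unfolding \<open>C * A * a = \<rho>\<close> using cs fr(1) by (simp add: a_def)
    finally show 1: "C * R * a\<^sup>2 = L" .
    have e1: "\<mu> * \<rho> = L\<^sup>2 * (c - s) / (\<rho> * (c + s))"
      unfolding m using fr(1) by (simp add: power2_eq_square)
    have e2: "L\<^sup>2 / \<rho> = L\<^sup>2 * (c + s) / (\<rho> * (c + s))" using cs by simp
    have "- \<alpha> = L\<^sup>2 * s / (\<rho> * (c + s))" "\<beta> = L\<^sup>2 * c / (\<rho> * (c + s))"
    proof -
      have "- ((x - y) / 2) = L\<^sup>2 * s / d" "(x + y) / 2 = L\<^sup>2 * c / d"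
        if "x = L\<^sup>2 * (c - s) / d" "y = L\<^sup>2 * (c + s) / d" "d \<noteq> 0" for x y d :: real
        unfolding that(1,2) using that(3) by (simp_all add: field_simps)
      from this[OF e1 e2] show "- \<alpha> = L\<^sup>2 * s / (\<rho> * (c + s))" "\<beta> = L\<^sup>2 * c / (\<rho> * (c + s))"
        using fr(1) cs by (simp_all add: \<alpha>_def \<beta>_def)
    qed
    moreover have "C * R * x * a ^ 3 = L\<^sup>2 * x / (\<rho> * (c + s))" for x
    proof -
      have "C * R * x * a ^ 3 = (C * R * a\<^sup>2) * x * a" by (simp add: power2_eq_square power3_eq_cube)
      then show ?thesis unfolding 1 by (simp add: a_def power2_eq_square)
    qed
    ultimately show "C * R * s * a ^ 3 = - \<alpha>" "C * R * c * a ^ 3 = \<beta>" by simp_all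
  qed
  define G where "G z = C *\<^sub>R Q (X_tilde \<theta> (of_real a * (z - z0)))" for z
  have G: "G z $ i = Re (f z0 $ i * (z - z0) + f1 z0 $ i * K2 k (z - z0) + f2 z0 $ i * K3 k (z - z0))" for z i
  proof -
    define \<zeta> where "\<zeta> = z - z0"
    have "G z $ i = C * A * a * (Re \<zeta> * e1 $ i - Im \<zeta> * e2 $ i) + C * R * a\<^sup>2 * Re (K2 k \<zeta>) * n $ i
        - C * R * s * a ^ 3 * Re (K3 k \<zeta>) * e1 $ i - C * R * c * a ^ 3 * Im (K3 k \<zeta>) * e2 $ i"
    proof -
      have "X_tilde \<theta> (of_real a * \<zeta>) = X_unified \<theta> (of_real a * \<zeta>)"
        using \<theta> by (intro X_tilde_eq_unified) auto
      then have "G z $ i = C * Q (X_unified \<theta> (of_real a * \<zeta>)) $ i"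
        by (simp add: G_def \<zeta>_def)
      then show ?thesis
        unfolding Q_def X_unified_nth K A_def[symmetric] R_def[symmetric] c_def[symmetric] s_def[symmetric]
        by (simp add: algebra_simps)
    qed
    also have "\<dots> = Re (f z0 $ i * \<zeta> + f1 z0 $ i * K2 k \<zeta> + f2 z0 $ i * K3 k \<zeta>)"
      unfolding co fr(7,8) n(2) \<alpha>_def[symmetric] \<beta>_def[symmetric]
      by (simp add: cvec_def algebra_simps)
    finally show ?thesis by (simp add: \<zeta>_def)
  qed
  have "has_cgrad G (f z) z" for z
  proof -
    have fz: "f z = f z0 + K1 k (z - z0) *s f1 z0 + K2 k (z - z0) *s f2 z0"
      by (rule null_jet_solution(1)[OF open_UNIV connected_UNIV j UNIV_I k UNIV_I])
    show ?thesis
      unfolding has_cgrad_component G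
      by (intro allI has_derivative_Re)
        (auto intro!: derivative_eq_intros K_deriv[THEN DERIV_chain2] simp: fz algebra_simps)
  qed
  then obtain b where b: "\<And>z. z \<in> S \<Longrightarrow> Y z = G z + b"
    using has_cgrad_unique_upto_translation[OF S Y] by blast
  show thesis
  proof (rule that[OF a])
    show "similarity (\<lambda>x. C *\<^sub>R Q x + b)"
      using C Q unfolding similarity_def by blast
    show "Y z = C *\<^sub>R Q (X_tilde \<theta> (of_real a * (z - z0))) + b" if "z \<in> S" for z
      using b[OF that] by (simp add: G_def)
  qed
qed

text \<open>The tangent of \<open>\<pi>/4 - \<theta>\<close> takes every real value, so the angle can always be matched.\<close>
lemma null_jet_surface_is_piece_of_X_tilde:
  assumes S: "open S" "connected S" "S \<noteq> {}"
    and j: "null_jet S L \<mu> f f1 f2" and L: "L > 0"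
    and Y: "\<And>z. z \<in> S \<Longrightarrow> has_cgrad Y (f z) z"
  obtains \<theta> a z0 F where "\<theta> \<in> {-pi/4<..<3*pi/4}" "a > 0" "similarity F"
    "\<And>z. z \<in> S \<Longrightarrow> Y z = F (X_tilde \<theta> (of_real a * (z - z0)))"
proof -
  obtain z1 where "z1 \<in> S" using S by blast
  then obtain g g1 g2 where g: "null_jet UNIV L \<mu> g g1 g2" "\<And>z. z \<in> S \<Longrightarrow> f z = g z"
    using null_jet_extend[OF S(1,2) j] by metis
  obtain z0 n where n: "norm n = 1" "g1 z0 = of_real L *s cvec n"
    using null_jet_critical_point[OF g(1) L] by blast
  define T where "T = \<mu> * (\<Sum>i\<in>UNIV. (norm (g z0 $ i))\<^sup>2) / (2 * L\<^sup>2)"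
  define \<theta> where "\<theta> = pi/4 - arctan T"
  have \<theta>: "\<theta> \<in> {-pi/4<..<3*pi/4}"
    using arctan_lbound[of T] arctan_ubound[of T] by (auto simp: \<theta>_def)
  have "\<theta> + pi/4 = pi/2 - arctan T" by (simp add: \<theta>_def)
  then have cs: "cos \<theta> + sin \<theta> = sqrt 2 * cos (arctan T)" "cos \<theta> - sin \<theta> = sqrt 2 * sin (arctan T)"
    using sin_plus_quarter[of \<theta>] cos_minus_sin[of \<theta>] by (simp_all add: sin_diff cos_diff)
  have "T * cos (arctan T) = sin (arctan T)"
    using cos_arctan_not_zero[of T] tan_arctan[of T] by (simp add: tan_def field_simps)
  then have "T * (cos \<theta> + sin \<theta>) = cos \<theta> - sin \<theta>"
    unfolding cs by (simp add: mult.left_commute)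
  then have "\<mu> * (\<Sum>i\<in>UNIV. (norm (g z0 $ i))\<^sup>2) * (cos \<theta> + sin \<theta>) = 2 * L\<^sup>2 * (cos \<theta> - sin \<theta>)"
    using L by (simp add: T_def field_simps)
  then show thesis
    using null_jet_similar_to_X_tilde[OF S(1,2) g(1) L n _ \<theta>, of Y] Y g(2) that[OF \<theta>] by metis
qed

section \<open>The Weierstrass models within the family\<close>

lemma similarity_compose: "similarity F \<Longrightarrow> similarity G \<Longrightarrow> similarity (\<lambda>x. F (G x))"
proof -
  assume "similarity F" "similarity G"
  then obtain c A b d B e where *: "c > 0" "orthogonal_transformation A" "F = (\<lambda>x. c *\<^sub>R A x + b)"
    "d > 0" "orthogonal_transformation B" "G = (\<lambda>x. d *\<^sub>R B x + e)"
    unfolding similarity_def by blast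
  have "linear A" using *(2) by (simp add: orthogonal_transformation_def)
  then have "(\<lambda>x. F (G x)) = (\<lambda>x. (c * d) *\<^sub>R (A \<circ> B) x + (c *\<^sub>R A e + b))"
    by (simp add: *(3,6) linear_add linear_scale algebra_simps)
  then show ?thesis
    unfolding similarity_def using * orthogonal_transformation_compose[of A B]
    by (intro exI[of _ "c * d"] exI[of _ "A \<circ> B"] exI[of _ "c *\<^sub>R A e + b"]) simp
qed

lemma similarity_inverse:
  assumes "similarity F"
  obtains G where "similarity G" "\<And>x. G (F x) = x"
proof -
  obtain c A b where *: "c > 0" "orthogonal_transformation A" "F = (\<lambda>x. c *\<^sub>R A x + b)"
    using assms unfolding similarity_def by blast
  have B: "orthogonal_transformation (inv A)" "linear (inv A)"
    using orthogonal_transformation_inv[OF *(2)] by (auto simp: orthogonal_transformation_def)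
  have "inv A (A x) = x" for x
    using orthogonal_transformation_inj[OF *(2)] by (simp add: inv_f_f)
  moreover have "inv A (c *\<^sub>R A x + b) = c *\<^sub>R inv A (A x) + inv A b" for x
    using B(2) by (simp add: linear_add linear_scale)
  ultimately have "(1 / c) *\<^sub>R inv A (F x) + - ((1 / c) *\<^sub>R inv A b) = x" for x
    using *(1) by (simp add: *(3) algebra_simps)
  moreover have "similarity (\<lambda>x. (1 / c) *\<^sub>R inv A x + - ((1 / c) *\<^sub>R inv A b))"
    unfolding similarity_def using *(1) B(1)
    by (intro exI[of _ "1 / c"] exI[of _ "inv A"] exI[of _ "- ((1 / c) *\<^sub>R inv A b)"]) simp
  ultimately show thesis using that by blast
qed

text \<open>Multiplication by a real or imaginary number permutes the two coordinate directions up to real factors;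
  so a change of this form preserves isothermic coordinates.\<close>
definition axis_similar :: "(complex \<Rightarrow> real^3) \<Rightarrow> (complex \<Rightarrow> real^3) \<Rightarrow> bool" where
  "axis_similar X Y \<longleftrightarrow> (\<exists>F p b. similarity F \<and> p \<noteq> 0 \<and> (Re p = 0 \<or> Im p = 0) \<and>
     (\<forall>z. X z = F (Y (p * z + b))))"

lemma principal_direction_scale:
  assumes X: "smooth_on S X" and z: "z \<in> S" and s: "s \<noteq> 0"
    and p: "principal_direction X z (of_real s * w)"
  shows "principal_direction X z w"
proof -
  have d: "X differentiable (at z)" "dd w' X differentiable (at z)" for w'
    by (rule smooth_on_differentiable[OF X z] smooth_on_differentiable[OF smooth_on_dd[OF X] z])+
  have lin: "dd (of_real s * w) f z = s *\<^sub>R dd w f z" if "f differentiable (at z)" for f :: "complex \<Rightarrow> real^3"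
    using dd_lincomb[OF that, of w] dd_lincomb[OF that, of "of_real s * w"] by (simp add: algebra_simps)
  obtain \<kappa> where k: "\<And>w'. second_form X z (of_real s * w) w' = \<kappa> * first_form X z (of_real s * w) w'"
    using p unfolding principal_direction_def by blast
  have "second_form X z w w' = \<kappa> * first_form X z w w'" for w'
    using k[of w'] s by (simp add: second_form_def first_form_def lin[OF d(1)] lin[OF d(2)])
  then show ?thesis
    using p unfolding principal_direction_def by auto
qed

lemma isothermic_coords_affine:
  assumes S: "open S" and X: "smooth_on S X" and iso: "isothermic_coords S X \<phi>"
    and p: "p \<noteq> 0" "Re p = 0 \<or> Im p = 0"
  shows "isothermic_coords S X (\<lambda>z. p * \<phi> z + b)"
proof -
  have ci: "conformal_immersion S \<phi>" and pr: "\<And>z w. z \<in> S \<Longrightarrow> dd w \<phi> z \<in> {1, \<i>} \<Longrightarrow> principal_direction X z w"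
    using iso unfolding isothermic_coords_def by auto
  have sm: "smooth_on S \<phi>" using ci by (simp add: conformal_immersion_def)
  have dif: "\<phi> differentiable (at z)" if "z \<in> S" for z using smooth_on_differentiable[OF sm that] .
  have dd: "dd w (\<lambda>z. p * \<phi> z + b) z = p * dd w \<phi> z" if "z \<in> S" for w z
    using dd_bounded_linear(1)[OF bounded_linear_mult_right dif[OF that]] .
  have inner: "(p * x) \<bullet> (p * y) = (norm p)\<^sup>2 * (x \<bullet> y)" for x y :: complex
    unfolding cmod_power2 by (simp add: inner_complex_def algebra_simps power2_eq_square)
  have "conformal_immersion S (\<lambda>z. p * \<phi> z + b)"
    unfolding conformal_immersion_def
    using smooth_on_bounded_linear[OF S bounded_linear_mult_right sm] ci p(1)
    by (auto simp: dd norm_mult inner conformal_immersion_def)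
  moreover have "principal_direction X z w" if z: "z \<in> S" and w: "dd w (\<lambda>z. p * \<phi> z + b) z \<in> {1, \<i>}" for z w
  proof -
    have pw: "p * dd w \<phi> z = 1 \<or> p * dd w \<phi> z = \<i>" using w dd[OF z] by auto
    have lin: "dd (of_real s * w) \<phi> z = of_real s * dd w \<phi> z" for s
      using dd_lincomb[OF dif[OF z], of w] dd_lincomb[OF dif[OF z], of "of_real s * w"]
      by (simp add: algebra_simps scaleR_conv_of_real)
    have "\<exists>s. s \<noteq> 0 \<and> of_real s * dd w \<phi> z \<in> {1, \<i>}"
      using p(2)
    proof
      assume "Im p = 0"
      then have "p = of_real (Re p)" by (simp add: complex_eq_iff)
      then show ?thesis using pw p(1) by (intro exI[of _ "Re p"]) auto
    next
      assume "Re p = 0"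
      then have pi: "p = \<i> * of_real (Im p)" by (simp add: complex_eq_iff)
      from pw show ?thesis
      proof
        assume "p * dd w \<phi> z = 1"
        then have "\<i> * (of_real (Im p) * dd w \<phi> z) = 1" using pi by (simp add: mult.assoc[symmetric])
        then have "\<i> * (\<i> * (of_real (Im p) * dd w \<phi> z)) = \<i>" by simp
        then have "of_real (Im p) * dd w \<phi> z = - \<i>" by (simp add: minus_equation_iff)
        then show ?thesis using p(1) pi by (intro exI[of _ "- Im p"]) auto
      next
        assume "p * dd w \<phi> z = \<i>"
        then have "\<i> * (of_real (Im p) * dd w \<phi> z) = \<i> * 1" using pi by (simp add: mult.assoc[symmetric])
        then have "of_real (Im p) * dd w \<phi> z = 1" by simp
        then show ?thesis using p(1) pi by (intro exI[of _ "Im p"]) auto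
      qed
    qed
    then obtain s where "s \<noteq> 0" "dd (of_real s * w) \<phi> z \<in> {1, \<i>}" unfolding lin by blast
    then show ?thesis using principal_direction_scale[OF X z] pr[OF z] by blast
  qed
  ultimately show ?thesis unfolding isothermic_coords_def by blast
qed

lemma piece_of_axis_similar:
  assumes S: "open S" and X: "smooth_on S X" and p: "piece_of S X Y" and sim: "axis_similar Y Y'"
  shows "piece_of S X Y'"
proof -
  obtain \<phi> F where 1: "isothermic_coords S X \<phi>" "\<not> in_some_plane (X ` S) \<longrightarrow> inj_on \<phi> S"
    "similarity F" "\<And>z. z \<in> S \<Longrightarrow> X z = F (Y (\<phi> z))"
    using p unfolding piece_of_def by blast
  obtain G q b where 2: "similarity G" "q \<noteq> 0" "Re q = 0 \<or> Im q = 0" "\<And>z. Y z = G (Y' (q * z + b))"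
    using sim unfolding axis_similar_def by blast
  show ?thesis
    unfolding piece_of_def
  proof (intro exI conjI)
    show "isothermic_coords S X (\<lambda>z. q * \<phi> z + b)"
      by (rule isothermic_coords_affine[OF S X 1(1) 2(2,3)])
    show "similarity (\<lambda>x. F (G x))" by (rule similarity_compose[OF 1(3) 2(1)])
    show "\<not> in_some_plane (X ` S) \<longrightarrow> inj_on (\<lambda>z. q * \<phi> z + b) S"
      using 1(2) 2(2) by (auto simp: inj_on_def)
    show "\<forall>z\<in>S. X z = F (G (Y' (q * \<phi> z + b)))" using 1(4) 2(4) by simp
  qed
qed

lemma linepath_integral_deriv:
  assumes "g holomorphic_on UNIV"
  shows "((\<lambda>z. contour_integral (linepath 0 z) g) has_field_derivative g z) (at z)"
proof -
  obtain G where G: "\<And>x. (G has_field_derivative g x) (at x)"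
    using holomorphic_convex_primitive'[OF convex_UNIV open_UNIV assms] by auto
  have "contour_integral (linepath 0 z) g = G z - G 0" for z
    using contour_integral_unique[OF contour_integral_primitive[of UNIV G g "linepath 0 z"]] G by auto
  then show ?thesis
    by (auto intro!: derivative_eq_intros G)
qed

definition weierstrass_grad :: "(complex \<Rightarrow> complex) \<Rightarrow> (complex \<Rightarrow> complex) \<Rightarrow> complex \<Rightarrow> complex^3" where
  "weierstrass_grad h \<eta> z = vector [(1 - (h z)\<^sup>2) * \<eta> z, \<i> * (1 + (h z)\<^sup>2) * \<eta> z, 2 * h z * \<eta> z]"

lemma weierstrass_has_cgrad:
  assumes "h holomorphic_on UNIV" "\<eta> holomorphic_on UNIV"
  shows "has_cgrad (weierstrass h \<eta>) (weierstrass_grad h \<eta> z) z"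
  unfolding has_cgrad_component forall_3 weierstrass_def weierstrass_grad_def vector_3
  by (intro conjI has_derivative_Re linepath_integral_deriv holomorphic_intros assms)

text \<open>The gradient of the surface with Weierstrass data \<open>(exp z + t, exp (- z))\<close> and its first two
  derivatives; \<open>t = 0\<close> is the catenoid.\<close>
definition bonnet_grad :: "real \<Rightarrow> complex \<Rightarrow> complex^3" where
  "bonnet_grad t z = vector [exp (- z) - exp z - 2 * of_real t - (of_real t)\<^sup>2 * exp (- z),
     \<i> * (exp (- z) + exp z + 2 * of_real t + (of_real t)\<^sup>2 * exp (- z)), 2 + 2 * of_real t * exp (- z)]"
definition bonnet_grad1 :: "real \<Rightarrow> complex \<Rightarrow> complex^3" where
  "bonnet_grad1 t z = vector [- exp (- z) - exp z + (of_real t)\<^sup>2 * exp (- z),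
     \<i> * (- exp (- z) + exp z - (of_real t)\<^sup>2 * exp (- z)), - 2 * of_real t * exp (- z)]"
definition bonnet_grad2 :: "real \<Rightarrow> complex \<Rightarrow> complex^3" where
  "bonnet_grad2 t z = vector [exp (- z) - exp z - (of_real t)\<^sup>2 * exp (- z),
     \<i> * (exp (- z) + exp z + (of_real t)\<^sup>2 * exp (- z)), 2 * of_real t * exp (- z)]"

lemma exp_mult_exp_minus: "exp z * exp (- z) = (1::complex)"
  by (simp add: exp_minus)

lemma weierstrass_grad_bonnet: "weierstrass_grad (\<lambda>z. exp z + of_real t) (\<lambda>z. exp (- z)) z = bonnet_grad t z"
proof -
  have "(exp z + of_real t)\<^sup>2 * exp (- z) = exp z + 2 * of_real t + (of_real t)\<^sup>2 * exp (- z)"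
    using exp_mult_exp_minus[of z] by (simp add: power2_eq_square algebra_simps)
  moreover have "2 * (exp z + of_real t) * exp (- z) = 2 + 2 * of_real t * exp (- z)"
    using exp_mult_exp_minus[of z] by (simp add: algebra_simps)
  ultimately show ?thesis
    unfolding weierstrass_grad_def bonnet_grad_def vec_eq_iff forall_3 vector_3 by (simp add: algebra_simps)
qed

lemma null_jet_bonnet: "null_jet UNIV 2 1 (bonnet_grad t) (bonnet_grad1 t) (bonnet_grad2 t)"
proof -
  have "vec_deriv (bonnet_grad t) (bonnet_grad1 t z) z" "vec_deriv (bonnet_grad1 t) (bonnet_grad2 t z) z" "vec_deriv (bonnet_grad2 t) (of_real 1 *s bonnet_grad1 t z) z" for z
    unfolding vec_deriv_def forall_3 bonnet_grad_def bonnet_grad1_def bonnet_grad2_def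
    by (auto intro!: derivative_eq_intros simp: algebra_simps)
  moreover have "cdot (bonnet_grad t z) (bonnet_grad t z) = 0" for z
  proof -
    define e where "e = exp z"
    have e: "exp z = e" "exp (- z) = 1 / e" "e \<noteq> 0" by (simp_all add: e_def exp_minus field_simps)
    show ?thesis unfolding cdot_3 bonnet_grad_def vector_3 e using e(3) by (simp add: field_simps power2_eq_square)
  qed
  moreover have "cdot (bonnet_grad1 t z) (bonnet_grad1 t z) = of_real (2\<^sup>2)" for z
  proof -
    define e where "e = exp z"
    have e: "exp z = e" "exp (- z) = 1 / e" "e \<noteq> 0" by (simp_all add: e_def exp_minus field_simps)
    show ?thesis unfolding cdot_3 bonnet_grad1_def vector_3 e using e(3) by (simp add: field_simps power2_eq_square)
  qed
  ultimately show ?thesis by (simp add: null_jet_def)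
qed

text \<open>The critical points have \<open>exp z0 = q\<close> with either sign of \<open>q\<close>. Both signs are used below, since
  \<open>(q + t)\<^sup>2\<close> is greater than \<open>1\<close> for one and less than \<open>1\<close> for the other if \<open>t > 0\<close>.\<close>
lemma bonnet_critical_point:
  assumes q: "q\<^sup>2 = 1 + t\<^sup>2" and z0: "exp z0 = of_real q"
  shows "bonnet_grad1 t z0 = of_real 2 *s cvec (vector [- 1 / q, 0, - t / q])"
    "(\<Sum>i\<in>UNIV. (norm (bonnet_grad t z0 $ i))\<^sup>2) = 8 * (q + t)\<^sup>2"
    "norm (vector [- 1 / q, 0, - t / q] :: real^3) = 1"
proof -
  have "1 + t\<^sup>2 > 0" by (smt (verit) zero_le_power2)
  then have q0: "q \<noteq> 0" using q by auto
  have tt: "t\<^sup>2 = q\<^sup>2 - 1" using q by simp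
  have e: "exp z0 = of_real q" "exp (- z0) = of_real (1 / q)"
    using z0 by (simp_all add: exp_minus divide_inverse)
  have "- (1 / q) - q + t\<^sup>2 * (1 / q) = 2 * (- 1 / q)" "- (1 / q) + q - t\<^sup>2 * (1 / q) = 0"
    unfolding tt using q0 by (simp_all add: field_simps power2_eq_square)
  note * = this[THEN arg_cong[where f = complex_of_real]]
  show "bonnet_grad1 t z0 = of_real 2 *s cvec (vector [- 1 / q, 0, - t / q])"
    unfolding vec_eq_iff forall_3 bonnet_grad1_def e using *
    by (simp add: cvec_def)
  have b1: "1 / q - q - 2 * t - t\<^sup>2 * (1 / q) = - 2 * t * (q + t) / q"
  proof -
    have "1 / q - q - 2 * t - t\<^sup>2 * (1 / q) = (1 - q\<^sup>2 - 2 * t * q - t\<^sup>2) / q"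
      using q0 by (simp add: field_simps power2_eq_square)
    also have "1 - q\<^sup>2 - 2 * t * q - t\<^sup>2 = - 2 * t * (q + t)"
      unfolding q by (simp add: algebra_simps power2_eq_square)
    finally show ?thesis .
  qed
  have b2: "1 / q + q + 2 * t + t\<^sup>2 * (1 / q) = 2 * (q + t)"
    unfolding tt using q0 by (simp add: field_simps power2_eq_square)
  have b3: "2 + 2 * t * (1 / q) = 2 * (q + t) / q"
    using q0 by (simp add: field_simps)
  have "bonnet_grad t z0 $ 1 = of_real (- 2 * t * (q + t) / q)" "bonnet_grad t z0 $ 2 = \<i> * of_real (2 * (q + t))" "bonnet_grad t z0 $ 3 = of_real (2 * (q + t) / q)"
      apply (simp only: b1[symmetric], simp add: bonnet_grad_def e)
     apply (simp only: b2[symmetric], simp add: bonnet_grad_def e)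
    apply (simp only: b3[symmetric], simp add: bonnet_grad_def e)
    done
  then have "(\<Sum>i\<in>UNIV. (norm (bonnet_grad t z0 $ i))\<^sup>2) = (- 2 * t * (q + t) / q)\<^sup>2 + (2 * (q + t))\<^sup>2 + (2 * (q + t) / q)\<^sup>2"
    by (simp only: sum_3 norm_mult norm_ii norm_of_real power2_abs mult_1_left)
  also have "\<dots> = 4 * (q + t)\<^sup>2 * ((t\<^sup>2 + q\<^sup>2 + 1) / q\<^sup>2)"
    using q0 by (simp add: field_simps power2_eq_square)
  also have "\<dots> = 8 * (q + t)\<^sup>2"
    using q0 by (simp add: tt)
  finally show "(\<Sum>i\<in>UNIV. (norm (bonnet_grad t z0 $ i))\<^sup>2) = 8 * (q + t)\<^sup>2" .
  have "(norm (vector [- 1 / q, 0, - t / q] :: real^3))\<^sup>2 = (1 + t\<^sup>2) / q\<^sup>2"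
    unfolding power2_norm_eq_inner inner_3 by (simp add: power2_eq_square add_divide_distrib)
  then show "norm (vector [- 1 / q, 0, - t / q] :: real^3) = 1"
    using q q0 by (intro power2_eq_imp_eq[of _ 1]) auto
qed

text \<open>Rotating the coordinate by a right angle exchanges the two families of curvature lines and changes the
  sign of \<open>\<mu>\<close>.\<close>
lemma null_jet_rotate:
  assumes "null_jet UNIV L \<mu> f f1 f2"
  shows "null_jet UNIV L (- \<mu>) (\<lambda>z. \<i> *s f (\<i> * z)) (\<lambda>z. - f1 (\<i> * z)) (\<lambda>z. - \<i> *s f2 (\<i> * z))"
proof -
  note d = null_jetD(1-3)[OF assms UNIV_I, unfolded vec_deriv_def, THEN spec, THEN DERIV_chain2]
  have "vec_deriv (\<lambda>z. \<i> *s f (\<i> * z)) (- f1 (\<i> * z)) z"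
    "vec_deriv (\<lambda>z. - f1 (\<i> * z)) (- \<i> *s f2 (\<i> * z)) z"
    "vec_deriv (\<lambda>z. - \<i> *s f2 (\<i> * z)) (of_real (- \<mu>) *s - f1 (\<i> * z)) z" for z
    unfolding vec_deriv_def by (auto intro!: derivative_eq_intros d simp: mult.assoc)
  then show ?thesis
    using null_jetD(4,5)[OF assms] unfolding null_jet_def by (simp add: cdot_simps)
qed

lemma has_cgrad_compose_affine:
  assumes "has_cgrad Y v (p * z + b)"
  shows "has_cgrad (\<lambda>z. Y (p * z + b)) (p *s v) z"
proof -
  have "((\<lambda>z. Y (p * z + b)) has_derivative (\<lambda>w. \<chi> i. Re (v $ i * (p * w)))) (at z)"
    by (rule has_derivative_compose[where f = "\<lambda>z. p * z + b", OF _ assms[unfolded has_cgrad_def]])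
      (auto intro!: derivative_eq_intros)
  then show ?thesis by (simp add: has_cgrad_def mult_ac)
qed

lemma axis_similar_of_inverse:
  assumes "similarity F" "a > 0" "p \<noteq> 0" "Re p = 0 \<or> Im p = 0"
    and "\<And>z. Y (p * z) = F (X (of_real a * (z - z0)))"
  shows "axis_similar X Y"
proof -
  obtain G where G: "similarity G" "\<And>x. G (F x) = x" using similarity_inverse[OF assms(1)] by blast
  have "X \<zeta> = G (Y ((p / of_real a) * \<zeta> + p * z0))" for \<zeta>
    using assms(5)[of "\<zeta> / of_real a + z0"] assms(2) G(2) by (simp add: algebra_simps)
  then show ?thesis
    unfolding axis_similar_def using G(1) assms
    by (intro exI[of _ G] exI[of _ "p / of_real a"] exI[of _ "p * z0"])
      (auto simp: Re_divide_of_real Im_divide_of_real)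
qed

lemma cos_eq_0_in_range: "\<theta> \<in> {-pi/4<..<3*pi/4} \<Longrightarrow> cos \<theta> = 0 \<longleftrightarrow> \<theta> = pi/2"
proof
  assume \<theta>: "\<theta> \<in> {-pi/4<..<3*pi/4}" and "cos \<theta> = 0"
  then have "\<theta> \<ge> 0"
    using cos_gt_zero_pi[of \<theta>] by (cases "\<theta> \<ge> 0") auto
  then show "\<theta> = pi/2"
    using \<theta> \<open>cos \<theta> = 0\<close> cos_inj_pi[of \<theta> "pi/2"] by auto
qed (metis cos_pi_half)

lemma sin_eq_0_in_range: "\<theta> \<in> {-pi/4<..<3*pi/4} \<Longrightarrow> sin \<theta> = 0 \<longleftrightarrow> \<theta> = 0"
  using sin_gt_zero[of \<theta>] sin_gt_zero[of "- \<theta>"] by (cases "\<theta>" "0::real" rule: linorder_cases) auto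

text \<open>The invariant \<open>tan (\<pi>/4 - \<theta>)\<close> of \<open>X_tilde \<theta>\<close> has absolute value \<open>T\<close>, and the one of the model is
  \<open>(q + t)\<^sup>2\<close> with \<open>q\<^sup>2 = 1 + t\<^sup>2\<close>. Equating them gives \<open>t = \<bar>r - 1 / r\<bar> / 2\<close> for \<open>r = sqrt T\<close>, which vanishes
  only for \<open>r = 1\<close>. If the tangent is negative, the coordinate is first rotated by a right angle.\<close>
lemma bonnet_axis_similar:
  assumes \<theta>: "\<theta> \<in> {-pi/4<..<3*pi/4}" "\<theta> \<noteq> pi/4"
  obtains t where "t \<ge> 0" "t = 0 \<longleftrightarrow> \<theta> \<in> {0, pi/2}"
    "axis_similar (X_tilde \<theta>) (weierstrass (\<lambda>z. exp z + of_real t) (\<lambda>z. exp (- z)))"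
proof -
  define c where "c = cos \<theta>"
  define s where "s = sin \<theta>"
  have cs: "c + s > 0"
    using cos_plus_sin_pos[OF \<theta>(1)] by (simp add: c_def s_def)
  have cs0: "c - s \<noteq> 0" using cos_minus_sin_nonzero[OF \<theta>] by (simp add: c_def s_def)
  define T where "T = \<bar>c - s\<bar> / (c + s)"
  define r where "r = sqrt T"
  have T: "T > 0" using cs cs0 by (simp add: T_def)
  have r: "r > 0" "r\<^sup>2 = T" using T by (simp_all add: r_def)
  \<comment> \<open>The sign makes \<open>t\<close> nonnegative; then \<open>q\<^sup>2 - t\<^sup>2 = 1\<close> and \<open>q + t = \<plusminus>r\<close>.\<close>
  define \<epsilon> :: real where "\<epsilon> = (if r \<ge> 1 then 1 else -1)"
  define t where "t = \<epsilon> * (r - 1 / r) / 2"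
  define q where "q = \<epsilon> * (r + 1 / r) / 2"
  have \<epsilon>: "\<epsilon> * \<epsilon> = 1" by (simp add: \<epsilon>_def)
  have t0: "t \<ge> 0"
  proof (cases "r \<ge> 1")
    case True
    then have "1 / r \<le> 1" by simp
    then have "r - 1 / r \<ge> 0" using True by linarith
    then show ?thesis using True by (simp add: t_def \<epsilon>_def)
  next
    case False
    then have "1 / r \<ge> 1" using r(1) by simp
    then have "r - 1 / r \<le> 0" using False by linarith
    then show ?thesis using False by (simp add: t_def \<epsilon>_def)
  qed
  have "q\<^sup>2 - t\<^sup>2 = \<epsilon> * \<epsilon> * (r * (1 / r))"
    by (simp add: q_def t_def power2_eq_square field_simps)
  then have q: "q\<^sup>2 = 1 + t\<^sup>2" using r(1) \<epsilon> by simp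
  have "q + t = \<epsilon> * r" by (simp add: q_def t_def field_simps)
  then have qt: "(q + t)\<^sup>2 = T" using r(2) \<epsilon> by (simp add: power_mult_distrib power2_eq_square[of \<epsilon>])
  have "t = 0 \<longleftrightarrow> r = 1 / r" using \<epsilon> by (auto simp: t_def)
  also have "\<dots> \<longleftrightarrow> r\<^sup>2 = 1" using r(1) by (simp add: field_simps power2_eq_square)
  also have "\<dots> \<longleftrightarrow> \<bar>c - s\<bar> = c + s" unfolding r(2) T_def using cs by auto
  also have "\<dots> \<longleftrightarrow> s = 0 \<or> c = 0" using cs by (auto simp: abs_if)
  also have "s = 0 \<longleftrightarrow> \<theta> = 0"
    unfolding s_def by (rule sin_eq_0_in_range[OF \<theta>(1)])
  also have "c = 0 \<longleftrightarrow> \<theta> = pi/2"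
    unfolding c_def by (rule cos_eq_0_in_range[OF \<theta>(1)])
  finally have t: "t = 0 \<longleftrightarrow> \<theta> \<in> {0, pi/2}" by simp
  have "1 + t\<^sup>2 > 0" by (smt (verit) zero_le_power2)
  then have "q \<noteq> 0" using q by auto
  then have "exp (Ln (of_real q)) = of_real q" by (intro exp_Ln) simp
  then obtain z0 where z0: "exp z0 = complex_of_real q" by blast
  define Y where "Y = weierstrass (\<lambda>z. exp z + of_real t) (\<lambda>z. exp (- z))"
  have Y: "has_cgrad Y (bonnet_grad t z) z" for z
    unfolding Y_def weierstrass_grad_bonnet[symmetric]
    by (intro weierstrass_has_cgrad holomorphic_intros)
  note crit = bonnet_critical_point[OF q z0]
  have "axis_similar (X_tilde \<theta>) Y"
  proof (cases "c - s > 0")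
    case True
    have "1 * (\<Sum>i\<in>UNIV. (norm (bonnet_grad t z0 $ i))\<^sup>2) * (cos \<theta> + sin \<theta>) = 2 * 2\<^sup>2 * (cos \<theta> - sin \<theta>)"
      unfolding crit(2) qt T_def c_def[symmetric] s_def[symmetric] using True cs by simp
    from null_jet_similar_to_X_tilde[OF open_UNIV connected_UNIV null_jet_bonnet _ crit(3,1) Y \<theta>(1) this]
    obtain a F where "a > 0" "similarity F" "\<And>z. Y z = F (X_tilde \<theta> (of_real a * (z - z0)))"
      by auto
    then show ?thesis
      by (intro axis_similar_of_inverse[of F a 1]) auto
  next
    case False
    define z1 where "z1 = - \<i> * z0"
    define n where "n = (vector [- 1 / q, 0, - t / q] :: real^3)"
    have z1: "\<i> * z1 = z0" by (simp add: z1_def mult.assoc[symmetric])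
    have n: "norm (- n) = 1" "- bonnet_grad1 t (\<i> * z1) = of_real 2 *s cvec (- n)"
      using crit by (simp_all add: n_def z1 vec_eq_iff cvec_def)
    have Y': "has_cgrad (\<lambda>z. Y (\<i> * z)) (\<i> *s bonnet_grad t (\<i> * z)) z" for z
      using has_cgrad_compose_affine[of Y _ \<i> z 0] Y by simp
    have "(- 1) * (\<Sum>i\<in>UNIV. (norm ((\<i> *s bonnet_grad t (\<i> * z1)) $ i))\<^sup>2) * (cos \<theta> + sin \<theta>) = 2 * 2\<^sup>2 * (cos \<theta> - sin \<theta>)"
      using crit(2) qt False cs cs0 unfolding c_def[symmetric] s_def[symmetric]
      by (simp add: z1 norm_mult T_def)
    from null_jet_similar_to_X_tilde[OF open_UNIV connected_UNIV null_jet_rotate[OF null_jet_bonnet] _ n Y' \<theta>(1) this]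
    obtain a F where "a > 0" "similarity F" "\<And>z. Y (\<i> * z) = F (X_tilde \<theta> (of_real a * (z - z1)))"
      by auto
    then show ?thesis
      by (intro axis_similar_of_inverse[of F a \<i>]) auto
  qed
  then show thesis using that[OF t0 t] by (simp add: Y_def)
qed

definition enneper_grad :: "complex \<Rightarrow> complex^3" where
  "enneper_grad z = vector [1 - z\<^sup>2, \<i> * (1 + z\<^sup>2), 2 * z]"
definition enneper_grad1 :: "complex \<Rightarrow> complex^3" where
  "enneper_grad1 z = vector [- 2 * z, 2 * \<i> * z, 2]"
definition enneper_grad2 :: "complex \<Rightarrow> complex^3" where
  "enneper_grad2 z = vector [- 2, 2 * \<i>, 0]"

lemma null_jet_enneper: "null_jet UNIV 2 0 enneper_grad enneper_grad1 enneper_grad2"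
proof -
  have "vec_deriv enneper_grad (enneper_grad1 z) z" "vec_deriv enneper_grad1 (enneper_grad2 z) z" "vec_deriv enneper_grad2 (of_real 0 *s enneper_grad1 z) z" for z
    unfolding vec_deriv_def forall_3 enneper_grad_def enneper_grad1_def enneper_grad2_def
    by (auto intro!: derivative_eq_intros)
  moreover have "cdot (enneper_grad z) (enneper_grad z) = 0" "cdot (enneper_grad1 z) (enneper_grad1 z) = of_real (2\<^sup>2)" for z
    unfolding cdot_3 enneper_grad_def enneper_grad1_def vector_3 by (simp_all add: algebra_simps power2_eq_square)
  ultimately show ?thesis by (simp add: null_jet_def)
qed

lemma weierstrass_grad_enneper: "weierstrass_grad (\<lambda>z. z) (\<lambda>z. 1) z = enneper_grad z"
  by (simp add: weierstrass_grad_def enneper_grad_def)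

lemma enneper_axis_similar: "axis_similar (X_tilde (pi/4)) (weierstrass (\<lambda>z. z) (\<lambda>z. 1))"
proof -
  define Y where "Y = weierstrass (\<lambda>z. z) (\<lambda>z. 1)"
  have Y: "has_cgrad Y (enneper_grad z) z" for z
    unfolding Y_def weierstrass_grad_enneper[symmetric]
    by (intro weierstrass_has_cgrad holomorphic_intros)
  have n: "norm (axis 3 1 :: real^3) = 1" "enneper_grad1 0 = of_real 2 *s cvec (axis 3 1)"
    by (rule norm_axis_1) (simp add: vec_eq_iff forall_3 enneper_grad1_def cvec_def axis_def)
  have a: "0 * (\<Sum>i\<in>UNIV. (norm (enneper_grad 0 $ i))\<^sup>2) * (cos (pi/4) + sin (pi/4)) = 2 * 2\<^sup>2 * (cos (pi/4) - sin (pi/4))"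
    by (simp add: cos_45 sin_45)
  have \<theta>: "pi/4 \<in> {-pi/4<..<3*pi/4}" by simp
  from null_jet_similar_to_X_tilde[OF open_UNIV connected_UNIV null_jet_enneper _ n Y \<theta> a]
  obtain a F where "a > 0" "similarity F" "\<And>z. Y z = F (X_tilde (pi/4) (of_real a * (z - 0)))"
    by auto
  then have "axis_similar (X_tilde (pi/4)) Y"
    by (intro axis_similar_of_inverse[of F a 1 Y _ 0]) auto
  then show ?thesis by (simp add: Y_def)
qed

lemma plane_weierstrass: "weierstrass (\<lambda>z. 0) (\<lambda>z. 1) z = vector [Re z, - Im z, 0]"
  by (simp add: weierstrass_def)

lemma plane_axis_similar:
  assumes "\<theta> = -pi/4 \<or> \<theta> = 3*pi/4"
  shows "axis_similar (X_tilde \<theta>) (weierstrass (\<lambda>z. 0) (\<lambda>z. 1))"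
proof -
  have "\<theta> \<noteq> pi/4" using assms by auto
  then have "X_tilde \<theta> z = (3 / sqrt 2) *\<^sub>R id (weierstrass (\<lambda>z. 0) (\<lambda>z. 1) (1 * z + 0)) + 0" for z
    using assms by (simp add: X_tilde_def Let_def plane_weierstrass)
  moreover have "similarity (\<lambda>x. (3 / sqrt 2) *\<^sub>R id x + 0)"
    unfolding similarity_def
    by (intro exI[of _ "3 / sqrt 2"] exI[of _ id] exI[of _ 0]) (simp add: id_def)
  ultimately show ?thesis
    unfolding axis_similar_def by (intro exI[of _ "\<lambda>x. (3 / sqrt 2) *\<^sub>R id x + 0"] exI[of _ 1] exI[of _ 0]) simp
qed

lemma axis_similar_to_model:
  assumes "\<theta> \<in> angles T"
  obtains Y where "Y \<in> models T" "axis_similar (X_tilde \<theta>) Y"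
proof (cases T)
  case Plane
  then show thesis using assms that plane_axis_similar by auto
next
  case Catenoid
  then have \<theta>: "\<theta> = 0 \<or> \<theta> = pi/2" using assms by auto
  have "0 \<in> {-pi/4<..<3*pi/4}" "0 \<noteq> pi/4" "pi/2 \<in> {-pi/4<..<3*pi/4}" "pi/2 \<noteq> pi/4"
    using pi_gt_zero by (simp_all add: field_simps)
  then have "\<theta> \<in> {-pi/4<..<3*pi/4}" "\<theta> \<noteq> pi/4" using \<theta> by metis+
  then obtain t where "t = 0 \<longleftrightarrow> \<theta> \<in> {0, pi/2}"
    "axis_similar (X_tilde \<theta>) (weierstrass (\<lambda>z. exp z + of_real t) (\<lambda>z. exp (- z)))"
    by (rule bonnet_axis_similar)
  then show thesis using \<theta> that Catenoid by auto
next
  case Enneper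
  then have "\<theta> = pi/4" using assms by (simp only: angles.simps singleton_iff)
  then have "axis_similar (X_tilde \<theta>) (weierstrass (\<lambda>z. z) (\<lambda>z. 1))"
    using enneper_axis_similar by (simp only:)
  then show thesis using Enneper by (intro that) simp_all
next
  case Bonnet
  then have \<theta>: "\<theta> \<in> {-pi/4<..<3*pi/4}" "\<theta> \<noteq> pi/4" "\<theta> \<notin> {0, pi/2}" using assms by auto
  from \<theta>(1,2) obtain t where t: "t \<ge> 0" "t = 0 \<longleftrightarrow> \<theta> \<in> {0, pi/2}"
    "axis_similar (X_tilde \<theta>) (weierstrass (\<lambda>z. exp z + of_real t) (\<lambda>z. exp (- z)))"
    by (rule bonnet_axis_similar)
  then have "t > 0" using t(1,2) \<theta>(3) by auto
  then show thesis using t(3) Bonnet by (intro that) auto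
qed

section \<open>From planar curvature lines to null jets\<close>

lemma frame_expansion:
  fixes e1 e2 e3 a b :: "real^3"
  assumes "e1 \<bullet> e1 = 1" "e2 \<bullet> e2 = 1" "e3 \<bullet> e3 = 1" "e1 \<bullet> e2 = 0" "e1 \<bullet> e3 = 0" "e2 \<bullet> e3 = 0"
  shows "a \<bullet> b = (a \<bullet> e1) * (b \<bullet> e1) + (a \<bullet> e2) * (b \<bullet> e2) + (a \<bullet> e3) * (b \<bullet> e3)"
proof -
  define Q where "Q x = x$1 *\<^sub>R e1 + x$2 *\<^sub>R e2 + x$3 *\<^sub>R e3" for x :: "real^3"
  have Q: "orthogonal_transformation Q"
    unfolding Q_def[abs_def] by (rule orthonormal_frame_transformation[OF assms])
  have *: "Q x \<bullet> e1 = x$1" "Q x \<bullet> e2 = x$2" "Q x \<bullet> e3 = x$3" for x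
    using assms inner_commute[of e2 e1] inner_commute[of e3 e1] inner_commute[of e3 e2]
    by (simp_all add: Q_def inner_add_left)
  obtain x y where "a = Q x" "b = Q y" using orthogonal_transformation_surj[OF Q] by (metis surjD)
  moreover have "Q x \<bullet> Q y = x \<bullet> y" for x y using Q by (simp add: orthogonal_transformation_def)
  ultimately show ?thesis by (simp add: * inner_3[of x y])
qed

lemma cdot_frame_expansion:
  fixes e1 e2 e3 :: "real^3"
  assumes "e1 \<bullet> e1 = 1" "e2 \<bullet> e2 = 1" "e3 \<bullet> e3 = 1" "e1 \<bullet> e2 = 0" "e1 \<bullet> e3 = 0" "e2 \<bullet> e3 = 0"
  shows "cdot v w = cdot (cvec e1) v * cdot (cvec e1) w + cdot (cvec e2) v * cdot (cvec e2) w
    + cdot (cvec e3) v * cdot (cvec e3) w"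
proof -
  have c: "cdot v w = Complex (rvec v \<bullet> rvec w - ivec v \<bullet> ivec w) (rvec v \<bullet> ivec w + ivec v \<bullet> rvec w)" for v w
    by (simp add: complex_eq_iff cdot_3 inner_3 rvec_def ivec_def)
  show ?thesis
    unfolding c[of v w] frame_expansion[OF assms, of "rvec v" "rvec w"] frame_expansion[OF assms, of "ivec v" "ivec w"]
      frame_expansion[OF assms, of "rvec v" "ivec w"] frame_expansion[OF assms, of "ivec v" "rvec w"] cdot_cvec
    by (simp add: complex_eq_iff inner_commute[of e1] inner_commute[of e2] inner_commute[of e3] algebra_simps)
qed

text \<open>The derivative maps both \<open>1\<close> and \<open>\<i>\<close> to real numbers and is therefore \<open>0\<close>.\<close>
lemma real_holomorphic_constant:
  assumes S: "open S" "connected S" and g: "g holomorphic_on S" and r: "\<And>z. z \<in> S \<Longrightarrow> Im (g z) = 0"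
    and z: "z \<in> S" "z1 \<in> S"
  shows "g z = g z1"
proof (rule zero_derivative_constant[OF S _ z])
  fix x assume x: "x \<in> S"
  have d: "(g has_field_derivative deriv g x) (at x)" using holomorphic_derivI[OF g S(1) x] .
  have "((\<lambda>y. Im (g y)) has_derivative (\<lambda>w. Im (deriv g x * w))) (at x)"
    using d unfolding has_field_derivative_def by (auto intro!: derivative_eq_intros)
  then have "((\<lambda>y. 0) has_derivative (\<lambda>w. Im (deriv g x * w))) (at x)"
    by (rule has_derivative_transform_within_open[OF _ S(1) x]) (use r in auto)
  then have "(\<lambda>w. Im (deriv g x * w)) = (\<lambda>w. 0)"
    by (rule has_derivative_unique) simp
  from fun_cong[OF this, of 1] fun_cong[OF this, of \<i>] have "deriv g x = 0"
    by (simp add: complex_eq_iff)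
  then show "(g has_field_derivative 0) (at x)" using d by simp
qed

text \<open>The determinant of \<open>X\<^sub>u\<close>, \<open>X\<^sub>u\<^sub>u\<close>, \<open>X\<^sub>u\<^sub>u\<^sub>u\<close> in coordinates of the orthonormal frame of the surface. There
  \<open>f = (\<rho>, - \<i> \<rho>, 0)\<close>, \<open>f' = (\<i> y1, y1, l)\<close>, \<open>f'' = (x2, y2, z2)\<close>, the normal of the plane of the
  curve is \<open>(0, n2, n3)\<close>, and the assumptions say \<open>f \<cdot> f'' = - l\<^sup>2\<close>, \<open>f' \<cdot> f'' = 0\<close> and that the normal is orthogonal
  to the real parts of \<open>f'\<close> and \<open>f''\<close>. The conclusion concerns \<open>f'' \<cdot> f''\<close>.\<close>
lemma Im_square_sum_zero_of_planar:
  fixes x2 y1 y2 z2 :: complex and \<rho> l n2 n3 :: real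
  assumes "\<rho> > 0" "l \<noteq> 0" and n: "n2 \<noteq> 0 \<or> n3 \<noteq> 0"
    and 1: "of_real \<rho> * (x2 - \<i> * y2) = - of_real (l\<^sup>2)"
    and 2: "\<i> * y1 * x2 + y1 * y2 + of_real l * z2 = 0"
    and 3: "Re y1 * n2 + l * n3 = 0" and 4: "Re y2 * n2 + Re z2 * n3 = 0"
  shows "Im (x2 * x2 + y2 * y2 + z2 * z2) = 0"
proof -
  define b where "b = - l\<^sup>2 / \<rho>"
  have x2: "x2 = \<i> * y2 + of_real b"
  proof -
    have "x2 - \<i> * y2 = (of_real \<rho> * (x2 - \<i> * y2)) / of_real \<rho>" using assms(1) by simp
    also have "\<dots> = of_real b" unfolding 1 by (simp add: b_def)
    finally show ?thesis by (simp add: algebra_simps)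
  qed
  have "of_real l * z2 = - (\<i> * y1 * of_real b)"
    using 2 unfolding x2 by (simp add: algebra_simps add_eq_0_iff)
  then have z2: "l * Re z2 = b * Im y1" "l * Im z2 = - (b * Re y1)"
    by (simp_all add: complex_eq_iff)
  have n3: "n3 = - (Re y1 * n2) / l" using 3 assms(2) by (simp add: field_simps)
  have n2: "n2 \<noteq> 0" using n n3 by auto
  have "(l * l * Re y2 - (l * Re z2) * Re y1) * n2 = l * l * (Re y2 * n2 + Re z2 * n3)"
    unfolding n3 using assms(2) by (simp add: field_simps)
  then have y2: "l * l * Re y2 = b * Im y1 * Re y1" using 4 n2 z2(1) by simp
  have "l * l * Im (x2 * x2 + y2 * y2 + z2 * z2)
      = 2 * b * (l * l * Re y2) + 2 * ((l * Re z2) * (l * Im z2))"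
    unfolding x2 by (simp add: algebra_simps)
  also have "\<dots> = 0" unfolding y2 z2 by (simp add: algebra_simps)
  finally show ?thesis using assms(2) by simp
qed

lemma real_deriv_zero_on_interval:
  fixes H :: "real \<Rightarrow> real"
  assumes "\<And>t. \<bar>t\<bar> < r \<Longrightarrow> H t = d" "\<bar>t\<bar> < r" "(H has_real_derivative D) (at t)"
  shows "D = 0"
proof -
  have "((\<lambda>_. d) has_real_derivative D) (at t)"
    by (rule has_field_derivative_transform_within_open[OF assms(3), of "{-r<..<r}"]) (use assms(1,2) in auto)
  then show ?thesis using DERIV_unique DERIV_const by blast
qed

lemma Re_along_line_deriv:
  assumes "(g has_field_derivative d) (at (z + of_real t))"
  shows "((\<lambda>t. Re (g (z + of_real t))) has_real_derivative Re d) (at t)"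
proof -
  have "((\<lambda>t. g (z + of_real t)) has_vector_derivative d) (at t)"
    by (rule has_vector_derivative_real_field[of "\<lambda>w. g (z + w)"])
      (use assms in \<open>simp add: DERIV_shift add.commute[of z]\<close>)
  then have "((\<lambda>t. Re (g (z + of_real t))) has_vector_derivative Re d) (at t)"
    by (rule bounded_linear.has_vector_derivative[OF bounded_linear_Re])
  then show ?thesis by (simp add: has_real_derivative_iff_has_vector_derivative)
qed

lemma dd_inner:
  fixes A B :: "complex \<Rightarrow> real^3"
  assumes "A differentiable (at z)" "B differentiable (at z)"
  shows "dd w (\<lambda>z. A z \<bullet> B z) z = dd w A z \<bullet> B z + A z \<bullet> dd w B z"
  using dd_eqI[OF has_derivative_inner[OF has_derivative_dd[OF assms(1)] has_derivative_dd[OF assms(2)]], of w]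
  by (simp add: add.commute)

lemma dd_const: "dd w (\<lambda>_. c) z = 0"
  by (rule dd_eqI) simp

text \<open>Differentiating the conformality relations shows that the Laplacian of \<open>X\<close> is orthogonal to \<open>X\<^sub>u\<close> and
  \<open>X\<^sub>v\<close>; vanishing mean curvature makes it orthogonal to the normal.\<close>
lemma minimal_harmonic:
  assumes S: "open S" and c: "conformal_immersion S X" and m: "minimal_on S X" and z: "z \<in> S"
  shows "dd 1 (dd 1 X) z + dd \<i> (dd \<i> X) z = 0"
    and "\<exists>\<rho>>0. \<exists>e1 e2. dd 1 X z = \<rho> *\<^sub>R e1 \<and> dd \<i> X z = \<rho> *\<^sub>R e2 \<and> e1 \<bullet> e1 = 1 \<and> e2 \<bullet> e2 = 1 \<and>
      unit_normal X z \<bullet> unit_normal X z = 1 \<and> e1 \<bullet> e2 = 0 \<and> e1 \<bullet> unit_normal X z = 0 \<and> e2 \<bullet> unit_normal X z = 0"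
proof -
  have sm: "smooth_on S X"
    and conf: "\<And>z. z \<in> S \<Longrightarrow> dd 1 X z \<noteq> 0" "\<And>z. z \<in> S \<Longrightarrow> norm (dd 1 X z) = norm (dd \<i> X z)"
      "\<And>z. z \<in> S \<Longrightarrow> dd 1 X z \<bullet> dd \<i> X z = 0"
    using c unfolding conformal_immersion_def by auto
  have conf2: "dd 1 X z \<bullet> dd 1 X z = dd \<i> X z \<bullet> dd \<i> X z" if "z \<in> S" for z
    using conf(2)[OF that] by (simp add: dot_square_norm)
  define xu where "xu = dd 1 X z"
  define xv where "xv = dd \<i> X z"
  define N where "N = unit_normal X z"
  define \<rho> where "\<rho> = norm xu"
  have \<rho>: "\<rho> > 0" using conf(1)[OF z] by (simp add: \<rho>_def xu_def)
  have xx: "xu \<bullet> xu = \<rho> * \<rho>" "xv \<bullet> xv = \<rho> * \<rho>" "xu \<bullet> xv = 0"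
    using conf2[OF z] conf(3)[OF z] by (simp_all add: xu_def xv_def \<rho>_def dot_square_norm power2_eq_square)
  have cr: "cross3 xu xv \<noteq> 0"
  proof
    assume 0: "cross3 xu xv = 0"
    have "(norm (cross3 xu xv))\<^sup>2 = (\<rho> * \<rho>) * (\<rho> * \<rho>)"
      by (simp add: norm_cross power2_norm_eq_inner[of xu] power2_norm_eq_inner[of xv] xx)
    then show False using 0 \<rho> by simp
  qed
  have NN: "N \<bullet> N = 1"
    using cr by (simp add: N_def unit_normal_def xu_def xv_def dot_square_norm norm_sgn)
  have Np: "xu \<bullet> N = 0" "xv \<bullet> N = 0"
    by (simp_all add: N_def unit_normal_def xu_def[symmetric] xv_def[symmetric] sgn_div_norm dot_cross_self)
  have fr: "xu = \<rho> *\<^sub>R ((1/\<rho>) *\<^sub>R xu)" "xv = \<rho> *\<^sub>R ((1/\<rho>) *\<^sub>R xv)" "((1/\<rho>) *\<^sub>R xu) \<bullet> ((1/\<rho>) *\<^sub>R xu) = 1"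
    "((1/\<rho>) *\<^sub>R xv) \<bullet> ((1/\<rho>) *\<^sub>R xv) = 1" "N \<bullet> N = 1"
    "((1/\<rho>) *\<^sub>R xu) \<bullet> ((1/\<rho>) *\<^sub>R xv) = 0" "((1/\<rho>) *\<^sub>R xu) \<bullet> N = 0" "((1/\<rho>) *\<^sub>R xv) \<bullet> N = 0"
    using \<rho> xx NN Np by simp_all
  then show "\<exists>\<rho>>0. \<exists>e1 e2. dd 1 X z = \<rho> *\<^sub>R e1 \<and> dd \<i> X z = \<rho> *\<^sub>R e2 \<and> e1 \<bullet> e1 = 1 \<and> e2 \<bullet> e2 = 1 \<and>
      unit_normal X z \<bullet> unit_normal X z = 1 \<and> e1 \<bullet> e2 = 0 \<and> e1 \<bullet> unit_normal X z = 0 \<and> e2 \<bullet> unit_normal X z = 0"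
    using \<rho> unfolding xu_def[symmetric] xv_def[symmetric] N_def[symmetric] by blast
  define xuu where "xuu = dd 1 (dd 1 X) z"
  define xuv where "xuv = dd 1 (dd \<i> X) z"
  define xvv where "xvv = dd \<i> (dd \<i> X) z"
  have xvu: "dd \<i> (dd 1 X) z = xuv" unfolding xuv_def by (rule dd_commute[OF S sm z])
  have dif: "dd 1 X differentiable (at z)" "dd \<i> X differentiable (at z)"
    by (rule smooth_on_differentiable[OF smooth_on_dd[OF sm] z])+
  have "dd w (\<lambda>z. dd 1 X z \<bullet> dd 1 X z) z = dd w (\<lambda>z. dd \<i> X z \<bullet> dd \<i> X z) z" for w
    using conf2 by (rule dd_cong_open[OF S z])
  then have e1: "dd w (dd 1 X) z \<bullet> xu = dd w (dd \<i> X) z \<bullet> xv" for w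
    unfolding dd_inner[OF dif(1,1)] dd_inner[OF dif(2,2)] xu_def xv_def
    by (simp add: inner_commute[of "dd 1 X z"] inner_commute[of "dd \<i> X z"])
  have "dd w (\<lambda>z. dd 1 X z \<bullet> dd \<i> X z) z = dd w (\<lambda>z. 0) z" for w
    using conf(3) by (rule dd_cong_open[OF S z])
  then have e2: "dd w (dd 1 X) z \<bullet> xv + dd w (dd \<i> X) z \<bullet> xu = 0" for w
    unfolding dd_inner[OF dif] dd_const xu_def xv_def by (simp add: inner_commute)
  have h: "(xuu + xvv) \<bullet> xu = 0" "(xuu + xvv) \<bullet> xv = 0"
    using e1[of 1] e1[of \<i>] e2[of 1] e2[of \<i>] xvu
    by (simp_all add: xuu_def[symmetric] xuv_def[symmetric] xvv_def[symmetric] inner_add_left)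
  have "mean_curvature X z = 0" using m z by (simp add: minimal_on_def)
  then have "(xuu \<bullet> N * (\<rho> * \<rho>) + xvv \<bullet> N * (\<rho> * \<rho>)) / (2 * (\<rho> * \<rho> * (\<rho> * \<rho>))) = 0"
    unfolding mean_curvature_def second_form_def first_form_def
    by (simp add: xuu_def[symmetric] xvv_def[symmetric] N_def[symmetric] xu_def[symmetric] xv_def[symmetric] xx)
  then have hN: "(xuu + xvv) \<bullet> N = 0"
    using \<rho> by (simp add: inner_add_left distrib_right[symmetric])
  have "(xuu + xvv) \<bullet> (xuu + xvv) = 0"
    using frame_expansion[OF fr(3-8), of "xuu + xvv" "xuu + xvv"] h hN by simp
  then show "dd 1 (dd 1 X) z + dd \<i> (dd \<i> X) z = 0" by (simp add: xuu_def xvv_def)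
qed

lemma coordinate_line_curvature_line:
  assumes "open S" "z \<in> S" and p: "\<And>x. x \<in> S \<Longrightarrow> principal_direction X x 1"
  obtains r where "r > 0" "\<And>t. \<bar>t\<bar> < r \<Longrightarrow> z + of_real t \<in> S"
    "curvature_line S X {-r<..<r} (\<lambda>t. z + of_real t)"
proof -
  obtain r where r: "r > 0" "ball z r \<subseteq> S" using assms openE by blast
  have in_S: "z + of_real t \<in> S" if "\<bar>t\<bar> < r" for t
    using r(2) that by (auto simp: dist_norm subset_iff)
  have "curvature_line S X {-r<..<r} (\<lambda>t. z + of_real t)"
    unfolding curvature_line_def
  proof (intro conjI exI[of _ "\<lambda>_. 1"] ballI)
    fix t assume t: "t \<in> {-r<..<r}"
    show "((\<lambda>t. z + of_real t) has_vector_derivative 1) (at t)"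
      using has_vector_derivative_add[OF has_vector_derivative_const has_vector_derivative_of_real[OF DERIV_ident]]
      by simp
    show "z + of_real t \<in> S" "principal_direction X (z + of_real t) 1"
      using in_S[of t] p t by auto
  qed (use r(1) in \<open>auto intro: is_interval_oo\<close>)
  then show thesis using that r(1) in_S by blast
qed

definition null_curve :: "(complex \<Rightarrow> real^3) \<Rightarrow> complex \<Rightarrow> complex^3" where
  "null_curve X z = (\<chi> i. Complex (dd 1 X z $ i) (- (dd \<i> X z $ i)))"

lemma rvec_null_curve: "rvec (null_curve X z) = dd 1 X z" "ivec (null_curve X z) = - dd \<i> X z"
  by (simp_all add: vec_eq_iff rvec_def ivec_def null_curve_def)

lemma null_curve_has_cgrad:
  assumes "X differentiable (at z)"
  shows "has_cgrad X (null_curve X z) z"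
proof -
  have "dd w X z = (\<chi> i. Re (null_curve X z $ i * w))" for w
    using dd_lincomb[OF assms, of w] by (simp add: vec_eq_iff null_curve_def mult.commute)
  then show ?thesis
    using has_derivative_dd[OF assms] unfolding has_cgrad_def by simp
qed

text \<open>The Cauchy-Riemann equations for \<open>X\<^sub>u - \<i> X\<^sub>v\<close>: one is harmonicity, the other the symmetry of the mixed
  derivatives.\<close>
lemma null_curve_deriv:
  assumes S: "open S" and sm: "smooth_on S X" and z: "z \<in> S"
    and h: "dd 1 (dd 1 X) z + dd \<i> (dd \<i> X) z = 0"
  shows "vec_deriv (null_curve X) (\<chi> i. Complex (dd 1 (dd 1 X) z $ i) (- (dd 1 (dd \<i> X) z $ i))) z"
  unfolding vec_deriv_def
proof
  fix i
  have dif: "dd 1 X differentiable (at z)" "dd \<i> X differentiable (at z)"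
    by (rule smooth_on_differentiable[OF smooth_on_dd[OF sm] z])+
  have c: "dd \<i> (dd 1 X) z = dd 1 (dd \<i> X) z" by (rule dd_commute[OF S sm z])
  have vv: "dd \<i> (dd \<i> X) z = - dd 1 (dd 1 X) z" using h by (simp add: eq_neg_iff_add_eq_0 add.commute)
  note D = has_derivative_dd[OF dif(1)] has_derivative_dd[OF dif(2)]
  have "((\<lambda>x. of_real (dd 1 X x $ i) - \<i> * of_real (dd \<i> X x $ i)) has_derivative
      (\<lambda>w. of_real (dd w (dd 1 X) z $ i) - \<i> * of_real (dd w (dd \<i> X) z $ i))) (at z)"
    by (intro derivative_intros bounded_linear.has_derivative[OF bounded_linear_vec_nth]
        bounded_linear.has_derivative[OF bounded_linear_of_real] D)
  moreover have "(of_real (dd w (dd 1 X) z $ i) - \<i> * of_real (dd w (dd \<i> X) z $ i)) =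
      Complex (dd 1 (dd 1 X) z $ i) (- (dd 1 (dd \<i> X) z $ i)) * w" for w
    unfolding dd_lincomb[OF dif(1), of w] dd_lincomb[OF dif(2), of w] c vv
    by (simp add: complex_eq_iff algebra_simps)
  moreover have "(\<lambda>x. of_real (dd 1 X x $ i) - \<i> * of_real (dd \<i> X x $ i)) = (\<lambda>x. null_curve X x $ i)"
    by (simp add: fun_eq_iff null_curve_def complex_eq_iff)
  ultimately show "((\<lambda>x. null_curve X x $ i) has_field_derivative
      (\<chi> i. Complex (dd 1 (dd 1 X) z $ i) (- (dd 1 (dd \<i> X) z $ i))) $ i) (at z)"
    unfolding has_field_derivative_def by simp
qed

lemma second_form_zero_imp_umbilic:
  assumes S: "open S" and sm: "smooth_on S X" and z: "z \<in> S"
    and 0: "second_form X z 1 1 = 0" "second_form X z 1 \<i> = 0" "second_form X z \<i> \<i> = 0"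
  shows "umbilic X z"
proof -
  have dif: "dd w X differentiable (at z)" for w
    by (rule smooth_on_differentiable[OF smooth_on_dd[OF sm] z])
  have 21: "second_form X z \<i> 1 = 0" using 0(2) dd_commute[OF S sm z, of \<i> 1] by (simp add: second_form_def)
  have "second_form X z w w' = 0" for w w'
  proof -
    have bl: "bounded_linear (\<lambda>x::real^3. r *\<^sub>R x)" for r by (rule bounded_linear_scaleR_right)
    have "dd w (dd w' X) z = dd w (\<lambda>x. Re w' *\<^sub>R dd 1 X x + Im w' *\<^sub>R dd \<i> X x) z"
      by (rule dd_cong_open[OF S z]) (rule dd_lincomb[OF smooth_on_differentiable[OF sm]])
    also have "\<dots> = Re w' *\<^sub>R dd w (dd 1 X) z + Im w' *\<^sub>R dd w (dd \<i> X) z"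
      by (rule dd_eqI) (intro derivative_intros has_derivative_dd dif)
    finally show ?thesis
      unfolding second_form_def dd_lincomb[OF dif[of 1], of w] dd_lincomb[OF dif[of \<i>], of w]
      using 0 21 by (simp add: second_form_def inner_add_left)
  qed
  then show ?thesis unfolding umbilic_def by (intro exI[of _ 0]) simp
qed

lemma surface_connected: "surface S X \<Longrightarrow> connected S"
  unfolding surface_def
  by (metis simply_connected_imp_path_connected path_connected_imp_connected)

lemma isothermic_principal_direction_1:
  assumes "isothermic_coords S X (\<lambda>z. z)" "z \<in> S"
  shows "principal_direction X z 1"
proof -
  have "dd 1 (\<lambda>z. z) z = 1" by (rule dd_eqI) (rule has_derivative_ident)
  then show ?thesis using assms unfolding isothermic_coords_def by auto
qed

lemma isothermic_second_form:
  assumes S: "open S" and ci: "conformal_immersion S X" and m: "minimal_on S X" and z: "z \<in> S"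
    and um: "\<not> umbilic X z" and pr: "principal_direction X z 1"
  shows "second_form X z 1 \<i> = 0" "second_form X z \<i> \<i> = - second_form X z 1 1" "second_form X z 1 1 \<noteq> 0"
proof -
  have sm: "smooth_on S X" using ci by (simp add: conformal_immersion_def)
  obtain \<kappa> where "second_form X z 1 \<i> = \<kappa> * first_form X z 1 \<i>"
    using pr unfolding principal_direction_def by blast
  then show 12: "second_form X z 1 \<i> = 0"
    using ci z by (simp add: first_form_def conformal_immersion_def)
  show 22: "second_form X z \<i> \<i> = - second_form X z 1 1"
    using minimal_harmonic(1)[OF S ci m z]
    by (simp add: second_form_def eq_neg_iff_add_eq_0 inner_add_left[symmetric] add.commute)
  show "second_form X z 1 1 \<noteq> 0"
    using second_form_zero_imp_umbilic[OF S sm z] 12 22 um by auto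
qed

text \<open>The passage from geometry to the linear equation. Twice a holomorphic product turns out to be real and
  hence constant: \<open>f' \<cdot> f'\<close> because the coordinates are isothermic, and \<open>f'' \<cdot> f''\<close> because the lines in the
  direction of \<open>u\<close> are planar. The equation \<open>f''' = \<mu> f'\<close> then holds because both sides have the same
  products with \<open>f, f', f''\<close>.\<close>
lemma surface_null_jet:
  assumes su: "surface S X" and m: "minimal_on S X" and pl: "planar_curvature_lines S X"
    and um: "\<And>z. z \<in> S \<Longrightarrow> \<not> umbilic X z" and iso: "isothermic_coords S X (\<lambda>z. z)"
  obtains L \<mu> f1 f2 where "L > 0" "null_jet S L \<mu> (null_curve X) f1 f2"
proof -
  have S: "open S" "S \<noteq> {}" and ci: "conformal_immersion S X"
    using su by (auto simp: surface_def)
  have con: "connected S" by (rule surface_connected[OF su])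
  have sm: "smooth_on S X" using ci by (simp add: conformal_immersion_def)
  obtain z1 where z1: "z1 \<in> S" using S by blast
  note pr = isothermic_principal_direction_1[OF iso]
  define f where "f = null_curve X"
  define f1 where "f1 z = (\<chi> i. Complex (dd 1 (dd 1 X) z $ i) (- (dd 1 (dd \<i> X) z $ i)))" for z
  define f2 where "f2 z = (\<chi> i. deriv (\<lambda>x. f1 x $ i) z)" for z
  define f3 where "f3 z = (\<chi> i. deriv (\<lambda>x. f2 x $ i) z)" for z
  define l where "l z = second_form X z 1 1" for z
  have d0: "vec_deriv f (f1 z) z" if "z \<in> S" for z
    unfolding f_def f1_def using null_curve_deriv[OF S(1) sm that minimal_harmonic(1)[OF S(1) ci m that]] .
  have hol0: "(\<lambda>x. f x $ i) holomorphic_on S" for i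
    using d0 S(1) by (auto simp: holomorphic_on_open vec_deriv_def)
  have eq1: "f1 z $ i = deriv (\<lambda>x. f x $ i) z" if "z \<in> S" for z i
    using DERIV_imp_deriv[OF d0[OF that, unfolded vec_deriv_def, THEN spec[of _ i]]] by (rule sym)
  have hol1: "(\<lambda>x. f1 x $ i) holomorphic_on S" for i
    using holomorphic_deriv[OF hol0 S(1)] by (rule holomorphic_transform) (simp add: eq1)
  have hol2: "(\<lambda>x. f2 x $ i) holomorphic_on S" for i
    using holomorphic_deriv[OF hol1 S(1)] by (simp add: f2_def)
  have d1: "vec_deriv f1 (f2 z) z" and d2: "vec_deriv f2 (f3 z) z" if "z \<in> S" for z
    using holomorphic_derivI[OF hol1 S(1) that] holomorphic_derivI[OF hol2 S(1) that]
    by (simp_all add: vec_deriv_def f2_def f3_def)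
  \<comment> \<open>In the orthonormal frame of the surface \<open>f\<close> is \<open>(\<rho>, - \<i> \<rho>, 0)\<close>, and the normal component of \<open>f'\<close> is
    real because the mixed coefficient of the second form vanishes.\<close>
  define adapted where "adapted z \<rho> e1 e2 N \<longleftrightarrow> \<rho> > 0 \<and> e1 \<bullet> e1 = 1 \<and> e2 \<bullet> e2 = 1 \<and> N \<bullet> N = 1 \<and> e1 \<bullet> e2 = 0 \<and> e1 \<bullet> N = 0 \<and> e2 \<bullet> N = 0 \<and>
      cdot (cvec e1) (f z) = of_real \<rho> \<and> cdot (cvec e2) (f z) = - \<i> * of_real \<rho> \<and> cdot (cvec N) (f z) = 0 \<and>
      cdot (cvec N) (f1 z) = of_real (l z)"
    for z \<rho> e1 e2 N
  have adaptedD: "\<rho> > 0" "e1 \<bullet> e1 = 1" "e2 \<bullet> e2 = 1" "N \<bullet> N = 1" "e1 \<bullet> e2 = 0" "e1 \<bullet> N = 0" "e2 \<bullet> N = 0"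
    "cdot (cvec e1) (f z) = of_real \<rho>" "cdot (cvec e2) (f z) = - \<i> * of_real \<rho>" "cdot (cvec N) (f z) = 0"
    "cdot (cvec N) (f1 z) = of_real (l z)" if "adapted z \<rho> e1 e2 N" for z \<rho> e1 e2 N
    using that unfolding adapted_def by blast+
  have frame: "\<exists>\<rho> e1 e2 N. adapted z \<rho> e1 e2 N" if z: "z \<in> S" for z
  proof -
    obtain \<rho> e1 e2 where fr: "\<rho> > 0" "dd 1 X z = \<rho> *\<^sub>R e1" "dd \<i> X z = \<rho> *\<^sub>R e2" "e1 \<bullet> e1 = 1" "e2 \<bullet> e2 = 1"
      "unit_normal X z \<bullet> unit_normal X z = 1" "e1 \<bullet> e2 = 0" "e1 \<bullet> unit_normal X z = 0" "e2 \<bullet> unit_normal X z = 0"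
      using minimal_harmonic(2)[OF S(1) ci m z] by blast
    have "second_form X z 1 \<i> = 0" by (rule isothermic_second_form(1)[OF S(1) ci m z um[OF z] pr[OF z]])
    then have "cdot (cvec (unit_normal X z)) (f1 z) = of_real (l z)"
      unfolding cdot_cvec
      by (simp add: complex_eq_iff f1_def rvec_def ivec_def l_def second_form_def inner_3 algebra_simps)
    moreover have "cdot (cvec e1) (f z) = of_real \<rho>" "cdot (cvec e2) (f z) = - \<i> * of_real \<rho>"
      "cdot (cvec (unit_normal X z)) (f z) = 0"
      using fr unfolding cdot_cvec f_def rvec_null_curve
      by (simp_all add: complex_eq_iff inner_commute[of e2 e1] inner_commute[of "unit_normal X z" e1]
          inner_commute[of "unit_normal X z" e2])
    ultimately show ?thesis using fr unfolding adapted_def by blast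
  qed
  have ff: "cdot (f z) (f z) = 0" if z: "z \<in> S" for z
  proof -
    obtain \<rho> e1 e2 N where "adapted z \<rho> e1 e2 N" using frame[OF z] by blast
    note fr = adaptedD[OF this]
    show ?thesis unfolding cdot_frame_expansion[OF fr(2-7), of "f z" "f z"] fr(8-11)
      by (simp add: complex_eq_iff)
  qed
  have ff1: "cdot (f z) (f1 z) = 0" if "z \<in> S" for z
    using deriv_eq_0_if_const_on_open[OF S(1) that _ vec_deriv_cdot[OF d0 d0]] ff that
    by (simp add: cdot_commute)
  have f1f1: "cdot (f1 z) (f1 z) = of_real ((l z)\<^sup>2)" if z: "z \<in> S" for z
  proof -
    obtain \<rho> e1 e2 N where "adapted z \<rho> e1 e2 N" using frame[OF z] by blast
    note fr = adaptedD[OF this]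
    have "of_real \<rho> * (cdot (cvec e1) (f1 z) - \<i> * cdot (cvec e2) (f1 z)) = 0"
      using ff1[OF z] unfolding cdot_frame_expansion[OF fr(2-7), of "f z" "f1 z"] fr(8-11)
      by (simp add: algebra_simps)
    then have x1: "cdot (cvec e1) (f1 z) = \<i> * cdot (cvec e2) (f1 z)" using fr(1) by simp
    show ?thesis unfolding cdot_frame_expansion[OF fr(2-7), of "f1 z" "f1 z"] fr(8-11) x1
      by (simp add: algebra_simps power2_eq_square)
  qed
  have cdot_hol: "(\<lambda>z. cdot (g z) (h z)) holomorphic_on S"
    if "\<And>i. (\<lambda>x. g x $ i) holomorphic_on S" "\<And>i. (\<lambda>x. h x $ i) holomorphic_on S" for g h
    unfolding cdot_3 by (intro holomorphic_intros that)
  define L where "L = \<bar>l z1\<bar>"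
  have f1f1': "cdot (f1 z) (f1 z) = of_real (L\<^sup>2)" if z: "z \<in> S" for z
    using real_holomorphic_constant[OF S(1) con cdot_hol[OF hol1 hol1] _ z z1] f1f1 z1
    by (simp add: L_def)
  have l0: "l z \<noteq> 0" if z: "z \<in> S" for z
    unfolding l_def by (rule isothermic_second_form(3)[OF S(1) ci m z um[OF z] pr[OF z]])
  have L: "L > 0" using l0[OF z1] by (simp add: L_def)
  have f1f2: "cdot (f1 z) (f2 z) = 0" if "z \<in> S" for z
    using deriv_eq_0_if_const_on_open[OF S(1) that _ vec_deriv_cdot[OF d1 d1]] f1f1' that
    by (simp add: cdot_commute)
  have ff2: "cdot (f z) (f2 z) = - of_real (L\<^sup>2)" if "z \<in> S" for z
    using deriv_eq_0_if_const_on_open[OF S(1) that _ vec_deriv_cdot[OF d0 d1], of 0] ff1 f1f1' that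
    by (simp add: add_eq_0_iff)
  have Lz: "L\<^sup>2 = (l z)\<^sup>2" if "z \<in> S" for z
    using f1f1[OF that] f1f1'[OF that] by (metis of_real_eq_iff)
  have imP: "Im (cdot (f2 z) (f2 z)) = 0" if z: "z \<in> S" for z
  proof -
    obtain r where r: "r > 0" "\<And>t. \<bar>t\<bar> < r \<Longrightarrow> z + of_real t \<in> S"
      "curvature_line S X {-r<..<r} (\<lambda>t. z + of_real t)"
      using coordinate_line_curvature_line[OF S(1) z pr] by metis
    have "in_some_plane (X ` (\<lambda>t. z + of_real t) ` {-r<..<r})"
      using pl r(3) unfolding planar_curvature_lines_def by blast
    then obtain n d where nd: "n \<noteq> 0" "\<forall>x\<in>X ` (\<lambda>t. z + of_real t) ` {-r<..<r}. n \<bullet> x = d"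
      unfolding in_some_plane_def by blast
    have n: "n \<bullet> X (z + of_real t) = d" if "\<bar>t\<bar> < r" for t
    proof -
      have "X (z + of_real t) \<in> X ` (\<lambda>t. z + of_real t) ` {-r<..<r}"
        using that by (intro imageI) auto
      then show ?thesis using nd(2) by blast
    qed
    have step: "Re (cdot (cvec n) (g' (z + of_real t))) = 0"
      if t: "\<bar>t\<bar> < r" and 0: "\<And>t. \<bar>t\<bar> < r \<Longrightarrow> Re (cdot (cvec n) (g (z + of_real t))) = 0"
        and g: "\<And>z. z \<in> S \<Longrightarrow> vec_deriv g (g' z) z" for g g' t
    proof -
      have "((\<lambda>x. cdot (cvec n) (g x)) has_field_derivative cdot (cvec n) (g' (z + of_real t))) (at (z + of_real t))"
        using vec_deriv_cdot[OF vec_deriv_const[of "cvec n"] g[OF r(2)[OF t]]] by (simp add: cdot_def)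
      from real_deriv_zero_on_interval[OF 0 t Re_along_line_deriv[OF this]] show ?thesis .
    qed
    have n0: "Re (cdot (cvec n) (f (z + of_real t))) = 0" if t: "\<bar>t\<bar> < r" for t
    proof -
      have D: "X differentiable (at (z + of_real t))" by (rule smooth_on_differentiable[OF sm r(2)[OF t]])
      have dd_real: "dd (of_real s) X (z + of_real t) = s *\<^sub>R dd 1 X (z + of_real t)" for s
        using dd_lincomb[OF D, of "of_real s"] by simp
      have "((\<lambda>t. X (z + of_real t)) has_derivative (\<lambda>s. dd (of_real s) X (z + of_real t))) (at t)"
        by (rule has_derivative_compose[where f = "\<lambda>t. z + of_real t", OF _ has_derivative_dd[OF D]])
          (auto intro!: derivative_eq_intros)
      from has_derivative_inner_right[OF this, of n]
      have "((\<lambda>t. n \<bullet> X (z + of_real t)) has_real_derivative n \<bullet> dd 1 X (z + of_real t)) (at t)"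
        unfolding has_field_derivative_def
        by (rule has_derivative_eq_rhs) (simp add: dd_real mult.commute fun_eq_iff)
      from real_deriv_zero_on_interval[OF n t this] show ?thesis
        by (simp add: cdot_cvec f_def rvec_null_curve)
    qed
    have n1: "Re (cdot (cvec n) (f1 (z + of_real t))) = 0" if "\<bar>t\<bar> < r" for t
      using step[OF that n0 d0] .
    have n2: "Re (cdot (cvec n) (f2 (z + of_real t))) = 0" if "\<bar>t\<bar> < r" for t
      using step[OF that n1 d1] .
    obtain \<rho> e1 e2 N where "adapted z \<rho> e1 e2 N" using frame[OF z] by blast
    note fr = adaptedD[OF this]
    note ex = cdot_frame_expansion[OF fr(2-7)]
    have cn: "cdot (cvec a) (cvec n) = of_real (a \<bullet> n)" for a by (rule cdot_cvec_cvec)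
    have "Re (cdot (cvec n) (f z)) = 0" "Re (cdot (cvec n) (f1 z)) = 0" "Re (cdot (cvec n) (f2 z)) = 0"
      using n0[of 0] n1[of 0] n2[of 0] r(1) by simp_all
    note R = this[unfolded ex[of "cvec n" "f z"] ex[of "cvec n" "f1 z"] ex[of "cvec n" "f2 z"] fr(8-11) cn]
    have e1n: "e1 \<bullet> n = 0" using R(1) fr(1) by simp
    have en: "e2 \<bullet> n \<noteq> 0 \<or> N \<bullet> n \<noteq> 0"
    proof (rule ccontr)
      assume "\<not> ?thesis"
      then have "n \<bullet> n = 0"
        using frame_expansion[OF fr(2-7), of n n] e1n
        by (simp add: inner_commute[of n e1] inner_commute[of n e2] inner_commute[of n N])
      then show False using nd(1) by simp
    qed
    have x1: "cdot (cvec e1) (f1 z) = \<i> * cdot (cvec e2) (f1 z)"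
    proof -
      have "of_real \<rho> * (cdot (cvec e1) (f1 z) - \<i> * cdot (cvec e2) (f1 z)) = 0"
        using ff1[OF z] unfolding ex[of "f z" "f1 z"] fr(8-11) by (simp add: algebra_simps)
      then show ?thesis using fr(1) by simp
    qed
    show ?thesis
      unfolding ex[of "f2 z" "f2 z"]
    proof (rule Im_square_sum_zero_of_planar[OF fr(1) l0[OF z] en])
      show "of_real \<rho> * (cdot (cvec e1) (f2 z) - \<i> * cdot (cvec e2) (f2 z)) = - of_real ((l z)\<^sup>2)"
        using ff2[OF z] unfolding ex[of "f z" "f2 z"] fr(8-11) Lz[OF z] by (simp add: algebra_simps)
      show "\<i> * cdot (cvec e2) (f1 z) * cdot (cvec e1) (f2 z) + cdot (cvec e2) (f1 z) * cdot (cvec e2) (f2 z)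
          + of_real (l z) * cdot (cvec N) (f2 z) = 0"
        using f1f2[OF z] unfolding ex[of "f1 z" "f2 z"] fr(8-11) x1 .
      show "Re (cdot (cvec e2) (f1 z)) * (e2 \<bullet> n) + l z * (N \<bullet> n) = 0"
        using R(2) e1n by (simp add: algebra_simps)
      show "Re (cdot (cvec e2) (f2 z)) * (e2 \<bullet> n) + Re (cdot (cvec N) (f2 z)) * (N \<bullet> n) = 0"
        using R(3) e1n by (simp add: algebra_simps)
    qed
  qed
  define P where "P = Re (cdot (f2 z1) (f2 z1))"
  have f2f2: "cdot (f2 z) (f2 z) = of_real P" if z: "z \<in> S" for z
    using real_holomorphic_constant[OF S(1) con cdot_hol[OF hol2 hol2] imP z z1] imP[OF z1]
    by (simp add: P_def complex_eq_iff)
  define \<mu> where "\<mu> = - P / L\<^sup>2"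
  have P: "P = - (\<mu> * L\<^sup>2)" using L by (simp add: \<mu>_def)
  have "f3 z = of_real \<mu> *s f1 z" if z: "z \<in> S" for z
  proof -
    have "cdot (f z) (f3 z) = 0"
      using deriv_eq_0_if_const_on_open[OF S(1) z ff2 vec_deriv_cdot[OF d0[OF z] d2[OF z]]] f1f2[OF z] by simp
    moreover have "cdot (f1 z) (f3 z) = - of_real P"
      using deriv_eq_0_if_const_on_open[OF S(1) z f1f2 vec_deriv_cdot[OF d1[OF z] d2[OF z]]] f2f2[OF z]
      by (simp add: add_eq_0_iff)
    moreover have "cdot (f2 z) (f3 z) = 0"
      using deriv_eq_0_if_const_on_open[OF S(1) z f2f2 vec_deriv_cdot[OF d2[OF z] d2[OF z]]]
      by (simp add: cdot_commute)
    ultimately have "f3 z - of_real \<mu> *s f1 z = 0"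
      using L ff1[OF z] f1f1'[OF z] f1f2[OF z]
      by (intro gram_nondegenerate[OF _ ff[OF z] ff1[OF z] ff2[OF z] f1f1'[OF z] f1f2[OF z]])
        (simp_all add: cdot_simps cdot_commute[of "f1 z" "f z"] cdot_commute[of "f3 z" "f z"]
          cdot_commute[of "f3 z" "f1 z"] cdot_commute[of "f3 z" "f2 z"] P)
    then show ?thesis by simp
  qed
  then have "null_jet S L \<mu> f f1 f2"
    unfolding null_jet_def using d0 d1 d2 ff f1f1' by metis
  then show thesis using that L unfolding f_def by blast
qed

section \<open>Rigidity of isothermic coordinates\<close>

text \<open>The complex linear extension of a real linear map.\<close>
definition complexify :: "(real^3 \<Rightarrow> real^3) \<Rightarrow> complex^3 \<Rightarrow> complex^3" where
  "complexify A v = cvec (A (rvec v)) + \<i> *s cvec (A (ivec v))"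

lemma rvec_complexify [simp]: "rvec (complexify A v) = A (rvec v)" "ivec (complexify A v) = A (ivec v)"
  by (simp_all add: vec_eq_iff complexify_def rvec_def ivec_def cvec_def)

lemma cvec_rvec_ivec: "v = cvec (rvec v) + \<i> *s cvec (ivec v)"
  by (simp add: vec_eq_iff cvec_def rvec_def ivec_def complex_eq_iff)

lemma cvec_eqI: "rvec v = rvec w \<Longrightarrow> ivec v = ivec w \<Longrightarrow> v = w"
  using cvec_rvec_ivec[of v] cvec_rvec_ivec[of w] by simp

text \<open>The Hermitian norm, which is invariant under real orthogonal maps like \<open>cdot\<close> is, and differs from
  the absolute value of \<open>cdot v v\<close> unless \<open>v\<close> is a complex multiple of a real vector.\<close>
definition norm_sq :: "complex^3 \<Rightarrow> real" where
  "norm_sq v = (\<Sum>i\<in>UNIV. (norm (v $ i))\<^sup>2)"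

lemma norm_sq_inner: "norm_sq v = rvec v \<bullet> rvec v + ivec v \<bullet> ivec v"
  unfolding norm_sq_def sum_3 inner_3 cmod_power2
  by (simp add: rvec_def ivec_def power2_eq_square)

lemma norm_sq_scale: "norm_sq (c *s v) = (norm c)\<^sup>2 * norm_sq v"
  by (simp add: norm_sq_def sum_3 norm_mult power_mult_distrib distrib_left)

lemma complexify_isometry:
  assumes "orthogonal_transformation A"
  shows "norm_sq (complexify A v) = norm_sq v" "cdot (complexify A v) (complexify A v) = cdot v v"
  using assms by (simp_all add: norm_sq_inner cdot_self orthogonal_transformation_def)

lemma complexify_linear:
  assumes "linear A"
  shows "complexify A (v - w) = complexify A v - complexify A w" "complexify A (c *s v) = c *s complexify A v"
proof -
  have r: "rvec (v - w) = rvec v - rvec w" "ivec (v - w) = ivec v - ivec w" for v w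
    by (simp_all add: vec_eq_iff rvec_def ivec_def)
  have s: "rvec (c *s v) = Re c *\<^sub>R rvec v - Im c *\<^sub>R ivec v" "ivec (c *s v) = Re c *\<^sub>R ivec v + Im c *\<^sub>R rvec v" for c v
    by (simp_all add: vec_eq_iff rvec_def ivec_def)
  show "complexify A (v - w) = complexify A v - complexify A w" "complexify A (c *s v) = c *s complexify A v"
    by (auto intro!: cvec_eqI simp: r s linear_diff[OF assms] linear_add[OF assms] linear_scale[OF assms])
qed

lemma complexify_component:
  assumes "linear A"
  shows "complexify A v $ i = (\<Sum>j\<in>UNIV. of_real (A (axis j 1) $ i) * v $ j)"
proof -
  have A: "A x $ i = (\<Sum>j\<in>UNIV. A (axis j 1) $ i * x $ j)" for x
  proof -
    have "A x = A (\<Sum>j\<in>UNIV. x $ j *\<^sub>R axis j 1)"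
      by (simp add: basis_expansion flip: scalar_mult_eq_scaleR)
    then show ?thesis
      by (simp add: linear_sum[OF assms] linear_scale[OF assms] mult.commute)
  qed
  have "complexify A v $ i = of_real (A (rvec v) $ i) + \<i> * of_real (A (ivec v) $ i)"
    by (simp add: complexify_def cvec_def)
  then show ?thesis
    unfolding A[of "rvec v"] A[of "ivec v"] sum_3
    by (simp add: rvec_def ivec_def complex_eq_iff)
qed

lemma vec_deriv_complexify:
  assumes "linear A" "vec_deriv g g' (\<psi> z)" "(\<psi> has_field_derivative p) (at z)"
  shows "vec_deriv (\<lambda>z. c *s complexify A (g (\<psi> z))) ((c * p) *s complexify A g') z"
proof -
  have d: "((\<lambda>z. g (\<psi> z) $ j) has_field_derivative g' $ j * p) (at z)" for j
    using assms(2,3) unfolding vec_deriv_def by (intro DERIV_chain2) auto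
  show ?thesis
    unfolding vec_deriv_def vector_smult_component complexify_component[OF assms(1)] sum_3
    by (auto intro!: derivative_eq_intros d simp: algebra_simps)
qed

lemma has_cgrad_unique:
  assumes "has_cgrad X v z" "has_cgrad X v' z"
  shows "v = v'"
proof -
  have "(\<lambda>w. \<chi> i. Re (v $ i * w)) = (\<lambda>w. \<chi> i. Re (v' $ i * w))"
    using assms unfolding has_cgrad_def by (rule has_derivative_unique)
  from fun_cong[OF this, of 1] fun_cong[OF this, of \<i>] show ?thesis
    by (simp add: vec_eq_iff complex_eq_iff)
qed

lemma has_cgrad_similarity:
  assumes A: "linear A" and Y: "has_cgrad Y v (\<psi> z)" and p: "(\<psi> has_field_derivative p) (at z)"
  shows "has_cgrad (\<lambda>z. c *\<^sub>R A (Y (\<psi> z)) + b) ((of_real c * p) *s complexify A v) z"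
proof -
  have "((\<lambda>z. Y (\<psi> z)) has_derivative (\<lambda>w. \<chi> i. Re (v $ i * (p * w)))) (at z)"
    by (rule has_derivative_compose[OF p[unfolded has_field_derivative_def] Y[unfolded has_cgrad_def]])
  then have "((\<lambda>z. c *\<^sub>R A (Y (\<psi> z)) + b) has_derivative (\<lambda>w. c *\<^sub>R A (\<chi> i. Re (v $ i * (p * w))))) (at z)"
    using bounded_linear.has_derivative[OF linear_linear[THEN iffD2, OF A]]
    by (auto intro!: derivative_eq_intros)
  moreover have "c *\<^sub>R A (\<chi> i. Re (v $ i * (p * w))) = (\<chi> i. Re (((of_real c * p) *s complexify A v) $ i * w))" for w
  proof -
    have "(\<chi> i. Re (v $ i * (p * w))) = Re (p * w) *\<^sub>R rvec v - Im (p * w) *\<^sub>R ivec v"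
      by (simp add: vec_eq_iff rvec_def ivec_def mult.commute)
    then have e: "A (\<chi> i. Re (v $ i * (p * w))) = Re (p * w) *\<^sub>R A (rvec v) - Im (p * w) *\<^sub>R A (ivec v)"
      by (simp only: linear_diff[OF A] linear_scale[OF A])
    show ?thesis
      unfolding e by (simp add: vec_eq_iff complexify_def cvec_def algebra_simps)
  qed
  ultimately show ?thesis unfolding has_cgrad_def by simp
qed

text \<open>In isothermic coordinates the second form is \<open>diag(l, -l)\<close> and the first form is a multiple of the
  identity; as \<open>l \<noteq> 0\<close>, no other directions are principal.\<close>
lemma principal_direction_axis:
  assumes S: "open S" and ci: "conformal_immersion S X" and m: "minimal_on S X" and z: "z \<in> S"
    and um: "\<not> umbilic X z" and pr: "principal_direction X z 1" and w: "principal_direction X z w"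
  shows "Re w = 0 \<or> Im w = 0"
proof -
  have sm: "smooth_on S X" using ci by (simp add: conformal_immersion_def)
  note sf = isothermic_second_form[OF S ci m z um pr]
  have dif: "X differentiable (at z)" "dd w X differentiable (at z)" for w
    by (rule smooth_on_differentiable[OF sm z] smooth_on_differentiable[OF smooth_on_dd[OF sm] z])+
  obtain \<kappa> where k: "\<And>w'. second_form X z w w' = \<kappa> * first_form X z w w'"
    using w unfolding principal_direction_def by blast
  have s21: "second_form X z \<i> 1 = 0" using sf(1) dd_commute[OF S sm z, of \<i> 1] by (simp add: second_form_def)
  define E where "E = first_form X z 1 1"
  have E: "first_form X z \<i> \<i> = E" "first_form X z 1 \<i> = 0" "first_form X z \<i> 1 = 0"
    using ci z by (simp_all add: E_def first_form_def conformal_immersion_def dot_square_norm inner_commute)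
  have "second_form X z w w' = Re w * second_form X z 1 w' + Im w * second_form X z \<i> w'"
    "first_form X z w w' = Re w * first_form X z 1 w' + Im w * first_form X z \<i> w'" for w'
    unfolding second_form_def first_form_def dd_lincomb[OF dif(1), of w] dd_lincomb[OF dif(2), of w w']
    by (simp_all add: inner_add_left)
  then have "Re w * second_form X z 1 1 = \<kappa> * (Re w * E)" "- (Im w * second_form X z 1 1) = \<kappa> * (Im w * E)"
    using k[of 1] k[of \<i>] sf(1,2) s21 E by (simp_all add: E_def)
  then have "Re w * (second_form X z 1 1 - \<kappa> * E) = 0" "Im w * (second_form X z 1 1 + \<kappa> * E) = 0"
    by (simp_all add: algebra_simps)
  then show ?thesis using sf(3) by auto
qed

text \<open>The quotient of the two partial derivatives is \<open>\<plusminus>\<i>\<close>, with a constant sign by continuity.\<close>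
lemma conformal_immersion_holomorphic:
  fixes \<phi> :: "complex \<Rightarrow> complex"
  assumes S: "open S" "connected S" and ci: "conformal_immersion S \<phi>"
  obtains p where "\<And>z. z \<in> S \<Longrightarrow> p z \<noteq> 0"
    "(\<forall>z\<in>S. (\<phi> has_field_derivative p z) (at z)) \<or> (\<forall>z\<in>S. ((\<lambda>z. cnj (\<phi> z)) has_field_derivative p z) (at z))"
proof -
  have sm: "smooth_on S \<phi>"
    and conf: "\<And>z. z \<in> S \<Longrightarrow> dd 1 \<phi> z \<noteq> 0" "\<And>z. z \<in> S \<Longrightarrow> norm (dd 1 \<phi> z) = norm (dd \<i> \<phi> z)"
      "\<And>z. z \<in> S \<Longrightarrow> dd 1 \<phi> z \<bullet> dd \<i> \<phi> z = 0"
    using ci unfolding conformal_immersion_def by auto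
  define r where "r z = dd \<i> \<phi> z / dd 1 \<phi> z" for z
  have q: "dd \<i> \<phi> z = r z * dd 1 \<phi> z" if "z \<in> S" for z using conf(1)[OF that] by (simp add: r_def)
  have r: "r z \<in> {\<i>, - \<i>}" if z: "z \<in> S" for z
  proof -
    have "x \<bullet> (y * x) = (norm x)\<^sup>2 * Re y" for x y :: complex
      unfolding cmod_power2 by (simp add: inner_complex_def algebra_simps power2_eq_square)
    then have "Re (r z) = 0" using conf(1,3)[OF z] unfolding q[OF z] by simp
    moreover have "norm (r z) = 1" using conf(1,2)[OF z] unfolding q[OF z] by (simp add: norm_mult)
    ultimately have "\<bar>Im (r z)\<bar> = 1" by (simp add: cmod_def)
    then show ?thesis using \<open>Re (r z) = 0\<close> by (auto simp: complex_eq_iff abs_if split: if_splits)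
  qed
  have "continuous_on S r"
    unfolding r_def[abs_def]
    by (intro continuous_on_divide smooth_on_continuous smooth_on_dd sm) (use conf(1) in auto)
  moreover have "finite (r ` S)" by (rule finite_subset[of _ "{\<i>, - \<i>}"]) (use r in auto)
  ultimately have "r constant_on S" by (rule continuous_finite_range_constant[OF S(2)])
  then consider "\<And>z. z \<in> S \<Longrightarrow> r z = \<i>" | "\<And>z. z \<in> S \<Longrightarrow> r z = - \<i>"
    using r unfolding constant_on_def by (metis empty_iff insert_iff)
  then show thesis
  proof cases
    case 1
    have "(\<phi> has_field_derivative dd 1 \<phi> z) (at z)" if z: "z \<in> S" for z
    proof -
      have D: "\<phi> differentiable (at z)" by (rule smooth_on_differentiable[OF sm z])
      have "dd w \<phi> z = dd 1 \<phi> z * w" for w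
        using dd_lincomb[OF D, of w] by (simp add: q[OF z] 1[OF z] complex_eq_iff)
      then show ?thesis
        unfolding has_field_derivative_def
        by (intro has_derivative_eq_rhs[OF has_derivative_dd[OF D]] ext)
    qed
    then show thesis using that[of "\<lambda>z. dd 1 \<phi> z"] conf(1) by blast
  next
    case 2
    have "((\<lambda>z. cnj (\<phi> z)) has_field_derivative cnj (dd 1 \<phi> z)) (at z)" if z: "z \<in> S" for z
    proof -
      have D: "\<phi> differentiable (at z)" by (rule smooth_on_differentiable[OF sm z])
      have "cnj (dd w \<phi> z) = cnj (dd 1 \<phi> z) * w" for w
        using dd_lincomb[OF D, of w] by (simp add: q[OF z] 2[OF z] complex_eq_iff)
      then show ?thesis
        unfolding has_field_derivative_def
        by (intro has_derivative_eq_rhs[OF bounded_linear.has_derivative[OF bounded_linear_cnj has_derivative_dd[OF D]]] ext)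
    qed
    then show thesis using that[of "\<lambda>z. cnj (dd 1 \<phi> z)"] conf(1) by auto
  qed
qed

text \<open>Conjugating the coordinate amounts to a reflection of space. This allows an antiholomorphic change of
  coordinates to be replaced by a holomorphic one.\<close>
definition reflected :: "(complex \<Rightarrow> real^3) \<Rightarrow> bool" where
  "reflected Y \<longleftrightarrow> (\<exists>D b. orthogonal_transformation D \<and> (\<forall>z. Y (cnj z) = D (Y z) + b))"

text \<open>The derivative \<open>q\<close> of the change of coordinates is real or imaginary, since a principal direction is mapped
  to a coordinate direction. So \<open>q\<^sup>2\<close> is real and holomorphic, hence constant.\<close>
lemma piece_of_null_curve:
  assumes su: "surface S X" and m: "minimal_on S X"
    and um: "\<And>z. z \<in> S \<Longrightarrow> \<not> umbilic X z" and iso: "isothermic_coords S X (\<lambda>z. z)"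
    and pc: "piece_of S X Y" and Y: "\<And>z. has_cgrad Y (g z) z" and refl: "reflected Y"
  obtains \<psi> c p A where "c > 0" "orthogonal_transformation A" "p \<noteq> 0" "Im (p\<^sup>2) = 0"
    "\<And>z. z \<in> S \<Longrightarrow> (\<psi> has_field_derivative p) (at z)"
    "\<And>z. z \<in> S \<Longrightarrow> null_curve X z = (of_real c * p) *s complexify A (g (\<psi> z))"
proof -
  have S: "open S" "S \<noteq> {}" and ci: "conformal_immersion S X"
    using su by (auto simp: surface_def)
  have con: "connected S" by (rule surface_connected[OF su])
  have sm: "smooth_on S X" using ci by (simp add: conformal_immersion_def)
  note pr1 = isothermic_principal_direction_1[OF iso]
  obtain \<phi> F where 1: "isothermic_coords S X \<phi>" "similarity F" "\<And>z. z \<in> S \<Longrightarrow> X z = F (Y (\<phi> z))"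
    using pc unfolding piece_of_def by blast
  have ci\<phi>: "conformal_immersion S \<phi>"
    and pr: "\<And>z w. z \<in> S \<Longrightarrow> dd w \<phi> z \<in> {1, \<i>} \<Longrightarrow> principal_direction X z w"
    using 1(1) unfolding isothermic_coords_def by auto
  obtain c A b where F: "c > 0" "orthogonal_transformation A" "F = (\<lambda>x. c *\<^sub>R A x + b)"
    using 1(2) unfolding similarity_def by blast
  have lA: "linear A" using F(2) by (simp add: orthogonal_transformation_def)
  obtain q where q: "\<And>z. z \<in> S \<Longrightarrow> q z \<noteq> 0"
    "(\<forall>z\<in>S. (\<phi> has_field_derivative q z) (at z)) \<or> (\<forall>z\<in>S. ((\<lambda>z. cnj (\<phi> z)) has_field_derivative q z) (at z))"
    using conformal_immersion_holomorphic[OF S(1) con ci\<phi>] by metis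
  have "\<exists>\<psi> A b. orthogonal_transformation A \<and> (\<forall>z\<in>S. (\<psi> has_field_derivative q z) (at z)) \<and>
      (\<forall>z\<in>S. dd (1 / q z) \<phi> z = 1) \<and> (\<forall>z\<in>S. X z = c *\<^sub>R A (Y (\<psi> z)) + b)"
    using q(2)
  proof
    assume a: "\<forall>z\<in>S. (\<phi> has_field_derivative q z) (at z)"
    have "dd (1 / q z) \<phi> z = 1" if "z \<in> S" for z
      using dd_eqI[of \<phi> "(*) (q z)" z "1 / q z"] a q(1)[OF that] that by (simp add: has_field_derivative_def)
    then show ?thesis using a F 1(3) by (intro exI[of _ \<phi>] exI[of _ A] exI[of _ b]) simp
  next
    assume a: "\<forall>z\<in>S. ((\<lambda>z. cnj (\<phi> z)) has_field_derivative q z) (at z)"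
    have "dd (1 / q z) \<phi> z = 1" if z: "z \<in> S" for z
    proof -
      have "((\<lambda>z. cnj (cnj (\<phi> z))) has_derivative (\<lambda>w. cnj (q z * w))) (at z)"
        by (rule bounded_linear.has_derivative[OF bounded_linear_cnj a[rule_format, OF z, unfolded has_field_derivative_def]])
      then show ?thesis using dd_eqI[of \<phi> _ z "1 / q z"] q(1)[OF z] by simp
    qed
    moreover obtain D e where D: "orthogonal_transformation D" "\<And>z. Y (cnj z) = D (Y z) + e"
      using refl unfolding reflected_def by blast
    have "X z = c *\<^sub>R (A \<circ> D) (Y (cnj (\<phi> z))) + (c *\<^sub>R A e + b)" if "z \<in> S" for z
      using 1(3)[OF that] D(2)[of "cnj (\<phi> z)"] by (simp add: F(3) linear_add[OF lA] algebra_simps)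
    ultimately show ?thesis
      using a orthogonal_transformation_compose[OF F(2) D(1)]
      by (intro exI[of _ "\<lambda>z. cnj (\<phi> z)"] exI[of _ "A \<circ> D"] exI[of _ "c *\<^sub>R A e + b"]) simp
  qed
  then obtain \<psi> A b where *: "orthogonal_transformation A" "\<And>z. z \<in> S \<Longrightarrow> (\<psi> has_field_derivative q z) (at z)"
    "\<And>z. z \<in> S \<Longrightarrow> dd (1 / q z) \<phi> z = 1" "\<And>z. z \<in> S \<Longrightarrow> X z = c *\<^sub>R A (Y (\<psi> z)) + b"
    by blast
  have lA: "linear A" using *(1) by (simp add: orthogonal_transformation_def)
  have q2: "Im ((q z)\<^sup>2) = 0" if z: "z \<in> S" for z
  proof -
    have "Re (1 / q z) = 0 \<or> Im (1 / q z) = 0"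
      by (rule principal_direction_axis[OF S(1) ci m z um[OF z] pr1[OF z] pr[OF z]]) (simp add: *(3)[OF z])
    then show ?thesis using q(1)[OF z] by (auto simp: Re_divide Im_divide Im_power2)
  qed
  have qd: "q z = deriv \<psi> z" if "z \<in> S" for z using DERIV_imp_deriv[OF *(2)[OF that]] by simp
  have "\<psi> holomorphic_on S" using *(2) S(1) by (auto simp: holomorphic_on_open)
  then have qh: "q holomorphic_on S"
    using holomorphic_deriv[OF _ S(1)] by (rule_tac holomorphic_transform[of "deriv \<psi>"]) (auto simp: qd)
  obtain z1 where z1: "z1 \<in> S" using S(2) by blast
  have sq: "(q z)\<^sup>2 = (q z1)\<^sup>2" if "z \<in> S" for z
    by (rule real_holomorphic_constant[OF S(1) con _ q2 that z1]) (intro holomorphic_intros qh)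
  have qc: "q z = q z1" if z: "z \<in> S" for z
  proof (rule zero_derivative_constant[OF S(1) con _ z z1])
    fix x assume x: "x \<in> S"
    have d: "(q has_field_derivative deriv q x) (at x)" by (rule holomorphic_derivI[OF qh S(1) x])
    have "((\<lambda>x. (q x)\<^sup>2) has_field_derivative 2 * q x * deriv q x) (at x)"
      using d by (auto intro!: derivative_eq_intros)
    from deriv_eq_0_if_const_on_open[OF S(1) x sq this] have "deriv q x = 0" using q(1)[OF x] by simp
    then show "(q has_field_derivative 0) (at x)" using d by simp
  qed
  have "null_curve X z = (of_real c * q z1) *s complexify A (g (\<psi> z))" if z: "z \<in> S" for z
  proof (rule has_cgrad_unique)
    show "has_cgrad X (null_curve X z) z"
      by (rule null_curve_has_cgrad[OF smooth_on_differentiable[OF sm z]])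
    have "has_cgrad (\<lambda>z. c *\<^sub>R A (Y (\<psi> z)) + b) ((of_real c * q z) *s complexify A (g (\<psi> z))) z"
      by (rule has_cgrad_similarity[OF lA Y *(2)[OF z]])
    then show "has_cgrad X ((of_real c * q z1) *s complexify A (g (\<psi> z))) z"
      unfolding has_cgrad_def qc[OF z]
      by (rule has_derivative_transform_within_open[OF _ S(1) z]) (simp add: *(4))
  qed
  then show thesis
    using that[OF F(1) *(1) q(1)[OF z1] q2[OF z1], of \<psi>] *(2) qc by metis
qed

section \<open>Uniqueness of the type and the classification\<close>

text \<open>The reflection changes the sign of the second coordinate.\<close>
lemma reflected_of_symmetric_gradient:
  assumes Y: "\<And>z. has_cgrad Y (g z) z"
    and sym: "\<And>z. g (cnj z) = vector [cnj (g z $ 1), - cnj (g z $ 2), cnj (g z $ 3)]"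
  shows "reflected Y"
proof -
  define D :: "real^3 \<Rightarrow> real^3" where "D x = x$1 *\<^sub>R axis 1 1 + x$2 *\<^sub>R (- axis 2 1) + x$3 *\<^sub>R axis 3 1" for x :: "real^3"
  have D: "orthogonal_transformation D"
    unfolding D_def[abs_def]
    by (rule orthonormal_frame_transformation) (simp_all add: inner_axis_axis)
  then have lD: "linear D" by (simp add: orthogonal_transformation_def)
  have D_nth: "D x $ 1 = x $ 1" "D x $ 2 = - x $ 2" "D x $ 3 = x $ 3" for x
    by (simp_all add: D_def axis_def)
  have 1: "has_cgrad (\<lambda>z. Y (cnj z)) (complexify D (g z)) z" for z
  proof -
    have "((\<lambda>z. Y (cnj z)) has_derivative (\<lambda>w. \<chi> i. Re (g (cnj z) $ i * cnj w))) (at z)"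
      by (rule has_derivative_compose[OF bounded_linear.has_derivative[OF bounded_linear_cnj has_derivative_ident]
            Y[of "cnj z", unfolded has_cgrad_def]])
    moreover have "(\<chi> i. Re (g (cnj z) $ i * cnj w)) = (\<chi> i. Re (complexify D (g z) $ i * w))" for w
      unfolding vec_eq_iff forall_3 vec_lambda_beta sym
      by (simp add: complexify_def cvec_def D_nth rvec_def ivec_def)
    ultimately show ?thesis unfolding has_cgrad_def by simp
  qed
  have 2: "has_cgrad (\<lambda>z. D (Y z)) (complexify D (g z)) z" for z
    using has_cgrad_similarity[OF lD, of Y "g z" "\<lambda>z. z" z 1 1 0] Y[of z] by simp
  obtain b where "\<And>z. Y (cnj z) = D (Y z) + b"
    using has_cgrad_unique_upto_translation[OF open_UNIV connected_UNIV 1 2] by auto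
  then show ?thesis unfolding reflected_def using D by blast
qed

text \<open>Here \<open>M\<close> is the coefficient in \<open>f''' = M f'\<close> and \<open>D\<close> the constant vector \<open>f'' - M f\<close>. For \<open>t \<ge> 0\<close> the model
  with data \<open>(exp z + t, exp (- z))\<close> has \<open>D = (2 t, - 2 \<i> t, - 2)\<close>, whose two quantities are \<open>8 t\<^sup>2 + 4\<close> and \<open>4\<close>.
  The plane is told apart by being planar.\<close>
fun type_invariant :: "surface_type \<Rightarrow> complex \<Rightarrow> complex^3 \<Rightarrow> bool" where
  "type_invariant Plane M D \<longleftrightarrow> False"
| "type_invariant Enneper M D \<longleftrightarrow> M = 0"
| "type_invariant Catenoid M D \<longleftrightarrow> M \<noteq> 0 \<and> norm_sq D = norm (cdot D D)"
| "type_invariant Bonnet M D \<longleftrightarrow> M \<noteq> 0 \<and> norm_sq D \<noteq> norm (cdot D D)"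

lemma type_invariant_unique: "type_invariant T M D \<Longrightarrow> type_invariant T' M D \<Longrightarrow> T = T'"
  by (cases T; cases T') auto

text \<open>Under similarities of space and affine changes of the coordinates \<open>M\<close> acquires a nonzero factor, and \<open>D\<close> is
  transformed by an orthogonal map and a complex factor.\<close>
lemma type_invariant_similar:
  assumes "type_invariant T M D" "orthogonal_transformation A" "p \<noteq> 0" "c \<noteq> 0"
  shows "type_invariant T (p * M) (c *s complexify A D)"
proof -
  have "norm_sq (c *s complexify A D) = (norm c)\<^sup>2 * norm_sq D"
    by (simp add: norm_sq_scale complexify_isometry(1)[OF assms(2)])
  moreover have "norm (cdot (c *s complexify A D) (c *s complexify A D)) = (norm c)\<^sup>2 * norm (cdot D D)"
    by (simp add: cdot_simps complexify_isometry(2)[OF assms(2)] norm_mult power2_eq_square)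
  ultimately show ?thesis using assms(1,3,4) by (cases T) simp_all
qed

lemma model_jet:
  assumes "Y \<in> models T" "T \<noteq> Plane"
  obtains \<mu> g g1 g2 where "null_jet UNIV 2 \<mu> g g1 g2" "\<And>z. has_cgrad Y (g z) z" "reflected Y"
    "\<And>z. type_invariant T (of_real \<mu>) (g2 z - of_real \<mu> *s g z)"
proof -
  have bonnet: "\<exists>t\<ge>0. Y = weierstrass (\<lambda>z. exp z + of_real t) (\<lambda>z. exp (- z)) \<and> (t = 0 \<longleftrightarrow> T = Catenoid)"
    if "T = Catenoid \<or> T = Bonnet"
    using that
  proof
    assume "T = Catenoid"
    then show ?thesis using assms by (intro exI[of _ 0]) simp
  next
    assume T: "T = Bonnet"
    then obtain t where "t > 0" "Y = weierstrass (\<lambda>z. exp z + of_real t) (\<lambda>z. exp (- z))"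
      using assms by auto
    then show ?thesis using T by (intro exI[of _ t]) simp
  qed
  consider "T = Enneper" | "T = Catenoid \<or> T = Bonnet" using assms(2) by (cases T) auto
  then show thesis
  proof cases
    case 1
    have Y: "has_cgrad Y (enneper_grad z) z" for z
      using assms 1 weierstrass_has_cgrad[of "\<lambda>z. z" "\<lambda>z. 1" z]
      by (simp add: weierstrass_grad_enneper)
    have "enneper_grad (cnj z) = vector [cnj (enneper_grad z $ 1), - cnj (enneper_grad z $ 2), cnj (enneper_grad z $ 3)]" for z
      by (simp add: enneper_grad_def)
    then have "reflected Y" using Y reflected_of_symmetric_gradient by blast
    then show thesis using that[OF null_jet_enneper Y] 1 by simp
  next
    case 2
    then obtain t where t: "t \<ge> 0" "Y = weierstrass (\<lambda>z. exp z + of_real t) (\<lambda>z. exp (- z))" "t = 0 \<longleftrightarrow> T = Catenoid"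
      using bonnet by blast
    have Y: "has_cgrad Y (bonnet_grad t z) z" for z
      unfolding t(2) weierstrass_grad_bonnet[symmetric] by (intro weierstrass_has_cgrad holomorphic_intros)
    have "bonnet_grad t (cnj z) = vector [cnj (bonnet_grad t z $ 1), - cnj (bonnet_grad t z $ 2), cnj (bonnet_grad t z $ 3)]" for z
      unfolding vec_eq_iff forall_3 by (simp add: bonnet_grad_def exp_cnj)
    then have r: "reflected Y" using Y reflected_of_symmetric_gradient by blast
    have D: "bonnet_grad2 t z - of_real 1 *s bonnet_grad t z = vector [of_real (2 * t), - \<i> * of_real (2 * t), - 2]" for z
      unfolding vec_eq_iff forall_3 by (simp add: bonnet_grad_def bonnet_grad2_def algebra_simps)
    have "norm_sq (bonnet_grad2 t z - of_real 1 *s bonnet_grad t z) = 8 * t\<^sup>2 + 4" for z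
      unfolding D norm_sq_def sum_3 vector_3 norm_mult norm_minus_cancel norm_ii norm_of_real by (simp add: power2_eq_square)
    moreover have "cdot (bonnet_grad2 t z - of_real 1 *s bonnet_grad t z) (bonnet_grad2 t z - of_real 1 *s bonnet_grad t z) = 4" for z
      unfolding D cdot_3 vector_3 by (simp add: complex_eq_iff)
    ultimately have "type_invariant T (of_real 1) (bonnet_grad2 t z - of_real 1 *s bonnet_grad t z)" for z
      using 2 t(3) by auto
    then show thesis using that[OF null_jet_bonnet Y r] by blast
  qed
qed

text \<open>The null curve of \<open>X\<close> determines \<open>M\<close> and \<open>D\<close>, and these determine the type.\<close>
lemma piece_of_type_unique_nonplanar:
  assumes su: "surface S X" and m: "minimal_on S X"
    and um: "\<And>z. z \<in> S \<Longrightarrow> \<not> umbilic X z" and iso: "isothermic_coords S X (\<lambda>z. z)"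
    and T: "piece_of_type S X T" "T \<noteq> Plane" and T': "piece_of_type S X T'" "T' \<noteq> Plane"
  shows "T = T'"
proof -
  have S: "open S" "S \<noteq> {}" using su by (auto simp: surface_def)
  have inv: "\<exists>M f1 f2. (\<forall>z\<in>S. vec_deriv (null_curve X) (f1 z) z \<and> vec_deriv f1 (f2 z) z \<and> vec_deriv f2 (M *s f1 z) z
      \<and> f1 z \<noteq> 0 \<and> type_invariant T M (f2 z - M *s null_curve X z))"
    if T: "piece_of_type S X T" "T \<noteq> Plane" for T
  proof -
    obtain Y where Y: "Y \<in> models T" "piece_of S X Y" using T unfolding piece_of_type_def by blast
    obtain \<mu> g g1 g2 where g: "null_jet UNIV 2 \<mu> g g1 g2" "\<And>z. has_cgrad Y (g z) z" "reflected Y"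
      "\<And>z. type_invariant T (of_real \<mu>) (g2 z - of_real \<mu> *s g z)"
      using model_jet[OF Y(1) T(2)] by metis
    obtain \<psi> c p A where *: "c > 0" "orthogonal_transformation A" "p \<noteq> 0"
      "\<And>z. z \<in> S \<Longrightarrow> (\<psi> has_field_derivative p) (at z)"
      "\<And>z. z \<in> S \<Longrightarrow> null_curve X z = (of_real c * p) *s complexify A (g (\<psi> z))"
      using piece_of_null_curve[OF su m um iso Y(2) g(2,3)] by metis
    have lA: "linear A" using *(2) by (simp add: orthogonal_transformation_def)
    define C where "C = of_real c * p"
    have C: "C \<noteq> 0" using *(1,3) by (simp add: C_def)
    define f1 where "f1 z = (C * p) *s complexify A (g1 (\<psi> z))" for z
    define f2 where "f2 z = (C * p * p) *s complexify A (g2 (\<psi> z))" for z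
    define M where "M = p * p * of_real \<mu>"
    note gd = null_jetD[OF g(1) UNIV_I]
    have "vec_deriv (null_curve X) (f1 z) z" if z: "z \<in> S" for z
    proof (rule vec_deriv_cong_open[OF _ S(1) z])
      show "vec_deriv (\<lambda>z. C *s complexify A (g (\<psi> z))) (f1 z) z"
        unfolding f1_def by (rule vec_deriv_complexify[OF lA gd(1) *(4)[OF z]])
    qed (simp add: *(5) C_def)
    moreover have "vec_deriv f1 (f2 z) z" if z: "z \<in> S" for z
      unfolding f1_def[abs_def] f2_def by (rule vec_deriv_complexify[OF lA gd(2) *(4)[OF z]])
    moreover have "vec_deriv f2 (M *s f1 z) z" if z: "z \<in> S" for z
      using vec_deriv_complexify[OF lA gd(3) *(4)[OF z], of "C * p * p"]
      unfolding f2_def[abs_def] f1_def M_def complexify_linear(2)[OF lA] vector_smult_assoc by (simp add: mult_ac)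
    moreover have "f1 z \<noteq> 0" for z
    proof
      assume "f1 z = 0"
      then have "cdot (f1 z) (f1 z) = 0" by (simp add: cdot_3)
      then show False
        using C *(3) gd(5)[of "\<psi> z"] by (simp add: f1_def cdot_simps complexify_isometry(2)[OF *(2)])
    qed
    moreover have "type_invariant T M (f2 z - M *s null_curve X z)" if z: "z \<in> S" for z
    proof -
      have "f2 z - M *s null_curve X z = (C * p * p) *s complexify A (g2 (\<psi> z) - of_real \<mu> *s g (\<psi> z))"
        unfolding f2_def M_def *(5)[OF z] C_def complexify_linear[OF lA]
        by (simp add: vec_eq_iff algebra_simps)
      then show ?thesis
        using type_invariant_similar[OF g(4) *(2), of "p * p" "C * p * p"] C *(3) by (simp add: M_def)
    qed
    ultimately show ?thesis by blast
  qed
  obtain M f1 f2 where 1: "\<And>z. z \<in> S \<Longrightarrow> vec_deriv (null_curve X) (f1 z) z" "\<And>z. z \<in> S \<Longrightarrow> vec_deriv f1 (f2 z) z"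
    "\<And>z. z \<in> S \<Longrightarrow> vec_deriv f2 (M *s f1 z) z" "\<And>z. z \<in> S \<Longrightarrow> f1 z \<noteq> 0" "\<And>z. z \<in> S \<Longrightarrow> type_invariant T M (f2 z - M *s null_curve X z)"
    using inv[OF T] by blast
  obtain M' g1 g2 where 2: "\<And>z. z \<in> S \<Longrightarrow> vec_deriv (null_curve X) (g1 z) z" "\<And>z. z \<in> S \<Longrightarrow> vec_deriv g1 (g2 z) z"
    "\<And>z. z \<in> S \<Longrightarrow> vec_deriv g2 (M' *s g1 z) z" "\<And>z. z \<in> S \<Longrightarrow> type_invariant T' M' (g2 z - M' *s null_curve X z)"
    using inv[OF T'] by blast
  have e1: "f1 z = g1 z" if "z \<in> S" for z using vec_deriv_unique[OF 1(1) 2(1)] that by blast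
  have e2: "f2 z = g2 z" if z: "z \<in> S" for z
    using vec_deriv_unique[OF vec_deriv_cong_open[OF 1(2)[OF z] S(1) z e1] 2(2)[OF z]] .
  obtain z where z: "z \<in> S" using S(2) by blast
  have "M *s f1 z = M' *s g1 z"
    using vec_deriv_unique[OF vec_deriv_cong_open[OF 1(3)[OF z] S(1) z e2] 2(3)[OF z]] .
  then have "M = M'" using 1(4)[OF z] e1[OF z] by (auto simp: vec_eq_iff)
  then show ?thesis using type_invariant_unique[OF 1(5)[OF z]] 2(4)[OF z] e2[OF z] by simp
qed

lemma conformal_differential_surj:
  fixes \<phi> :: "complex \<Rightarrow> complex"
  assumes ci: "conformal_immersion S \<phi>" and z: "z \<in> S"
  shows "\<exists>w. dd w \<phi> z = v"
proof -
  have D: "\<phi> differentiable (at z)"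
    using ci z smooth_on_differentiable unfolding conformal_immersion_def by blast
  define a where "a = dd 1 \<phi> z"
  define b where "b = dd \<i> \<phi> z"
  have ab: "a \<noteq> 0" "a \<bullet> b = 0" "b \<noteq> 0"
    using ci z unfolding conformal_immersion_def a_def b_def by fastforce+
  have lin: "linear (\<lambda>w. dd w \<phi> z)"
    using has_derivative_dd[OF D] by (rule has_derivative_linear)
  have "inj (\<lambda>w. dd w \<phi> z)"
    unfolding linear_injective_0[OF lin]
  proof (intro allI impI)
    fix w assume "dd w \<phi> z = 0"
    then have 0: "Re w *\<^sub>R a + Im w *\<^sub>R b = 0" using dd_lincomb[OF D, of w] by (simp add: a_def b_def)
    have "Re w * (a \<bullet> a) = 0" using arg_cong[OF 0, of "\<lambda>x. a \<bullet> x"] ab(2) by (simp add: inner_add_right)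
    moreover have "Im w * (b \<bullet> b) = 0"
      using arg_cong[OF 0, of "\<lambda>x. b \<bullet> x"] ab(2) by (simp add: inner_add_right inner_commute[of b a])
    ultimately have "Re w = 0" "Im w = 0" using ab(1,3) by simp_all
    then show "w = 0" by (simp add: complex_eq_iff)
  qed
  then have "surj (\<lambda>w. dd w \<phi> z)" by (rule linear_inj_imp_surj[OF lin])
  then show ?thesis by (metis surjD)
qed

lemma in_some_plane_similarity:
  assumes "similarity F" "in_some_plane (F ` A)"
  shows "in_some_plane A"
proof -
  obtain c B b where F: "c > 0" "orthogonal_transformation B" "F = (\<lambda>x. c *\<^sub>R B x + b)"
    using assms(1) unfolding similarity_def by blast
  obtain n d where n: "n \<noteq> 0" "\<forall>x\<in>F ` A. n \<bullet> x = d" using assms(2) unfolding in_some_plane_def by blast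
  obtain n' where n': "n = B n'" using orthogonal_transformation_surj[OF F(2)] by (metis surjD)
  have "n' \<noteq> 0" using n(1) n' F(2) by (metis linear_0 orthogonal_transformation_def)
  moreover have "n' \<bullet> x = (d - n \<bullet> b) / c" if "x \<in> A" for x
  proof -
    have "c * (B n' \<bullet> B x) + n \<bullet> b = d" using n(2) that F(3) n' by (auto simp: inner_add_right)
    moreover have "B n' \<bullet> B x = n' \<bullet> x" using F(2) by (simp add: orthogonal_transformation_def)
    ultimately show ?thesis using F(1) by (simp add: field_simps)
  qed
  ultimately show ?thesis unfolding in_some_plane_def by blast
qed

text \<open>If a linear function is constant on the surface, its coefficient vector has product zero with the
  gradient \<open>f\<close> and, by differentiation, with \<open>f'\<close> and \<open>f''\<close>; but these form a basis.\<close>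
lemma planar_not_piece_of_null_jet:
  assumes S: "open S" "S \<noteq> {}" and pl: "in_some_plane (X ` S)" and pc: "piece_of S X Y"
    and j: "null_jet UNIV L \<mu> g g1 g2" and L: "L > 0" and Y: "\<And>z. has_cgrad Y (g z) z"
  shows False
proof -
  obtain \<phi> F where 1: "isothermic_coords S X \<phi>" "similarity F" "\<And>z. z \<in> S \<Longrightarrow> X z = F (Y (\<phi> z))"
    using pc unfolding piece_of_def by blast
  have ci: "conformal_immersion S \<phi>" using 1(1) by (simp add: isothermic_coords_def)
  have D: "(\<phi> has_derivative (\<lambda>w. dd w \<phi> z)) (at z)" if "z \<in> S" for z
    using ci that smooth_on_differentiable has_derivative_dd unfolding conformal_immersion_def by blast
  have "X ` S = F ` ((\<lambda>z. Y (\<phi> z)) ` S)" using 1(3) by force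
  then have "in_some_plane ((\<lambda>z. Y (\<phi> z)) ` S)" 
    using in_some_plane_similarity[OF 1(2), of "(\<lambda>z. Y (\<phi> z)) ` S"] pl by (simp only:)
  then obtain n d where n: "n \<noteq> 0" "\<And>z. z \<in> S \<Longrightarrow> n \<bullet> Y (\<phi> z) = d"
    unfolding in_some_plane_def by blast
  have 0: "cdot (cvec n) (g (\<phi> z)) = 0" if z: "z \<in> S" for z
  proof -
    define k where "k = cdot (cvec n) (g (\<phi> z))"
    have "((\<lambda>z. n \<bullet> Y (\<phi> z)) has_derivative (\<lambda>w. n \<bullet> (\<chi> i. Re (g (\<phi> z) $ i * dd w \<phi> z)))) (at z)"
      by (intro has_derivative_inner_right has_derivative_compose[OF D[OF z] Y[unfolded has_cgrad_def]])
    then have "((\<lambda>z. d) has_derivative (\<lambda>w. n \<bullet> (\<chi> i. Re (g (\<phi> z) $ i * dd w \<phi> z)))) (at z)"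
      by (rule has_derivative_transform_within_open[OF _ S(1) z]) (simp add: n(2))
    then have "(\<lambda>w. n \<bullet> (\<chi> i. Re (g (\<phi> z) $ i * dd w \<phi> z))) = (\<lambda>w. 0)"
      by (rule has_derivative_unique) simp
    moreover have "n \<bullet> (\<chi> i. Re (g (\<phi> z) $ i * v)) = Re (k * v)" for v
      unfolding inner_3 vec_lambda_beta k_def cdot_3 by (simp add: cvec_def algebra_simps)
    ultimately have *: "Re (k * dd w \<phi> z) = 0" for w by (metis (no_types))
    obtain w where "dd w \<phi> z = cnj k" using conformal_differential_surj[OF ci z] by blast
    then have "Re (k * cnj k) = 0" using *[of w] by simp
    then show ?thesis by (simp add: k_def[symmetric] complex_mult_cnj complex_eq_iff sum_power2_eq_zero_iff flip: of_real_power of_real_add)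
  qed
  have step: "cdot (cvec n) (h' (\<phi> z)) = 0"
    if h: "\<And>z. z \<in> S \<Longrightarrow> cdot (cvec n) (h (\<phi> z)) = 0" "\<And>z. vec_deriv h (h' z) z" and z: "z \<in> S" for h h' z
  proof -
    have "((\<lambda>x. cdot (cvec n) (h x)) has_field_derivative cdot (cvec n) (h' (\<phi> z))) (at (\<phi> z))"
      using vec_deriv_cdot[OF vec_deriv_const h(2)] by (simp add: cdot_def)
    then have "((\<lambda>z. cdot (cvec n) (h (\<phi> z))) has_derivative (\<lambda>w. cdot (cvec n) (h' (\<phi> z)) * dd w \<phi> z)) (at z)"
      unfolding has_field_derivative_def by (rule has_derivative_compose[OF D[OF z]])
    then have "((\<lambda>z. 0) has_derivative (\<lambda>w. cdot (cvec n) (h' (\<phi> z)) * dd w \<phi> z)) (at z)"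
      by (rule has_derivative_transform_within_open[OF _ S(1) z]) (simp add: h(1))
    then have "(\<lambda>w. cdot (cvec n) (h' (\<phi> z)) * dd w \<phi> z) = (\<lambda>w. 0)"
      by (rule has_derivative_unique) simp
    then have "cdot (cvec n) (h' (\<phi> z)) * dd 1 \<phi> z = 0" by (rule fun_cong)
    moreover have "dd 1 \<phi> z \<noteq> 0" using ci z by (simp add: conformal_immersion_def)
    ultimately show ?thesis by simp
  qed
  note gd = null_jetD[OF j UNIV_I]
  obtain z where z: "z \<in> S" using S(2) by blast
  have 1: "cdot (cvec n) (g1 (\<phi> z)) = 0" if "z \<in> S" for z by (rule step[OF 0 gd(1) that])
  have 2: "cdot (cvec n) (g2 (\<phi> z)) = 0" by (rule step[OF 1 gd(2) z])
  note gram = null_jetD(4,5)[OF j UNIV_I, of "\<phi> z"] null_jet_gram[OF j open_UNIV UNIV_I, of "\<phi> z"]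
  have "cvec n = 0"
    by (rule gram_nondegenerate[OF _ gram(1,3,5,2,4) 0[OF z] 1[OF z] 2]) (use L in simp)
  then show False using n(1) by (simp add: vec_eq_iff cvec_def)
qed

lemma plane_model_planar:
  assumes "piece_of S X Y" "Y \<in> models Plane"
  shows "in_some_plane (X ` S)"
proof -
  obtain \<phi> F where 1: "similarity F" "\<And>z. z \<in> S \<Longrightarrow> X z = F (Y (\<phi> z))"
    using assms(1) unfolding piece_of_def by blast
  obtain G where G: "similarity G" "\<And>x. G (F x) = x" using similarity_inverse[OF 1(1)] by blast
  have "G (X z) $ 3 = 0" if "z \<in> S" for z
    using assms(2) 1(2)[OF that] G(2) by (simp add: plane_weierstrass)
  then have "\<forall>x\<in>G ` (X ` S). axis 3 1 \<bullet> x = 0" by (auto simp: inner_axis')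
  moreover have "axis 3 1 \<noteq> (0::real^3)" by (simp add: axis_eq_0_iff)
  ultimately have "in_some_plane (G ` (X ` S))" unfolding in_some_plane_def by blast
  then show ?thesis by (rule in_some_plane_similarity[OF G(1)])
qed

text \<open>Cartesian coordinates in the plane, conjugated and scaled to fit \<open>X_tilde\<close>, serve as isothermic coordinates:
  the second form vanishes, so every direction is principal.\<close>
lemma planar_piece_of_X_tilde:
  assumes su: "surface S X" and m: "minimal_on S X" and pl: "in_some_plane (X ` S)"
  shows "piece_of S X (X_tilde (-pi/4))"
proof -
  have S: "open S" and ci: "conformal_immersion S X" using su by (auto simp: surface_def)
  have sm: "smooth_on S X" using ci by (simp add: conformal_immersion_def)
  obtain n0 d0 where n0: "n0 \<noteq> 0" "\<And>z. z \<in> S \<Longrightarrow> n0 \<bullet> X z = d0"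
    using pl unfolding in_some_plane_def by blast
  define n where "n = sgn n0"
  define d where "d = d0 / norm n0"
  have n: "norm n = 1" "\<And>z. z \<in> S \<Longrightarrow> n \<bullet> X z = d"
    using n0 by (simp_all add: n_def d_def norm_sgn sgn_div_norm divide_inverse mult.commute)
  obtain e1 where e1: "norm e1 = 1" "e1 \<bullet> n = 0" using unit_orthogonal_to_two by blast
  obtain e2 where e2: "norm e2 = 1" "e2 \<bullet> n = 0" "e2 \<bullet> e1 = 0" using unit_orthogonal_to_two by blast
  have fr: "e1 \<bullet> e1 = 1" "e2 \<bullet> e2 = 1" "n \<bullet> n = 1" "e1 \<bullet> e2 = 0" "e1 \<bullet> n = 0" "e2 \<bullet> n = 0"
    using n e1 e2 by (simp_all add: dot_square_norm inner_commute)
  have perp: "dd w Z z \<bullet> n = 0" if "z \<in> S" "\<And>x. x \<in> S \<Longrightarrow> Z x \<bullet> n = k" "smooth_on S Z" for w Z z k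
  proof -
    have "((\<lambda>x. Z x \<bullet> n) has_derivative (\<lambda>w. dd w Z z \<bullet> n)) (at z)"
      by (intro has_derivative_inner_left has_derivative_dd smooth_on_differentiable[OF that(3,1)])
    then have "dd w (\<lambda>x. Z x \<bullet> n) z = dd w Z z \<bullet> n" by (rule dd_eqI)
    moreover have "dd w (\<lambda>x. Z x \<bullet> n) z = dd w (\<lambda>x. k) z" by (rule dd_cong_open[OF S that(1,2)])
    ultimately show ?thesis by (simp add: dd_const)
  qed
  have p1: "dd w X z \<bullet> n = 0" if "z \<in> S" for w z
    by (rule perp[OF that _ sm, of d]) (simp add: n(2) inner_commute)
  have p2: "dd w (dd w' X) z \<bullet> n = 0" if "z \<in> S" for w w' z
    by (rule perp[OF that p1 smooth_on_dd[OF sm]])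
  have principal: "principal_direction X z w" if z: "z \<in> S" and w: "w \<noteq> 0" for z w
  proof -
    obtain \<rho> a b where ab: "\<rho> > 0" "dd 1 X z = \<rho> *\<^sub>R a" "dd \<i> X z = \<rho> *\<^sub>R b" "a \<bullet> a = 1" "b \<bullet> b = 1"
      "unit_normal X z \<bullet> unit_normal X z = 1" "a \<bullet> b = 0" "a \<bullet> unit_normal X z = 0" "b \<bullet> unit_normal X z = 0"
      using minimal_harmonic(2)[OF S ci m z] by blast
    note ex = frame_expansion[OF ab(4-9)]
    have an: "n \<bullet> a = 0" "n \<bullet> b = 0"
      using p1[OF z, of 1] p1[OF z, of \<i>] ab(1) unfolding ab(2,3) by (simp_all add: inner_commute)
    have "n \<bullet> unit_normal X z \<noteq> 0" using ex[of n n] fr(3) an by auto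
    then have "second_form X z w w' = 0" for w w'
      using ex[of n "dd w (dd w' X) z"] p2[OF z, of w w'] an
      by (simp add: second_form_def inner_commute[of n])
    then show ?thesis unfolding principal_direction_def using w by (intro conjI exI[of _ 0]) auto
  qed
  define T where "T x = Complex ((x \<bullet> e1) * (sqrt 2 / 3)) (- ((x \<bullet> e2) * (sqrt 2 / 3)))" for x :: "real^3"
  have T: "bounded_linear T"
  proof -
    have "linear T" by (rule linearI) (simp_all add: T_def complex_eq_iff inner_add_left algebra_simps)
    then show ?thesis by (simp add: linear_linear)
  qed
  have Tin: "T x \<bullet> T y = (2 / 9) * (x \<bullet> y)" if "x \<bullet> n = 0" "y \<bullet> n = 0" for x y
    unfolding frame_expansion[OF fr, of x y] using that
    by (simp add: T_def inner_complex_def algebra_simps)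
  define \<phi> where "\<phi> z = T (X z) + 0" for z
  have dd\<phi>: "dd w \<phi> z = T (dd w X z)" if "z \<in> S" for w z
    unfolding \<phi>_def[abs_def] by (rule dd_bounded_linear(1)[OF T smooth_on_differentiable[OF sm that]])
  have ci\<phi>: "conformal_immersion S \<phi>"
    unfolding conformal_immersion_def
  proof (intro conjI ballI)
    show "smooth_on S \<phi>" unfolding \<phi>_def[abs_def] by (rule smooth_on_bounded_linear[OF S T sm])
    fix z assume z: "z \<in> S"
    have c: "dd 1 X z \<noteq> 0" "norm (dd 1 X z) = norm (dd \<i> X z)" "dd 1 X z \<bullet> dd \<i> X z = 0"
      using ci z by (auto simp: conformal_immersion_def)
    show "dd 1 \<phi> z \<bullet> dd \<i> \<phi> z = 0" using Tin[OF p1[OF z] p1[OF z], of 1 \<i>] c(3) by (simp add: dd\<phi>[OF z])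
    have "(norm (T (dd 1 X z)))\<^sup>2 = (norm (T (dd \<i> X z)))\<^sup>2"
      using Tin[OF p1[OF z] p1[OF z], of 1 1] Tin[OF p1[OF z] p1[OF z], of \<i> \<i>]
      unfolding dot_square_norm c(2) by linarith
    then show "norm (dd 1 \<phi> z) = norm (dd \<i> \<phi> z)"
      by (simp add: dd\<phi>[OF z])
    show "dd 1 \<phi> z \<noteq> 0"
      using Tin[OF p1[OF z] p1[OF z], of 1 1] c(1) by (auto simp: dd\<phi>[OF z])
  qed
  have "isothermic_coords S X \<phi>"
    unfolding isothermic_coords_def
  proof (intro conjI ballI allI impI ci\<phi>)
    fix z w assume z: "z \<in> S" and w: "dd w \<phi> z \<in> {1, \<i>}"
    have "w \<noteq> 0"
    proof
      assume "w = 0"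
      then have "dd w \<phi> z = 0"
        using dd_lincomb[of \<phi> z w] ci\<phi> z smooth_on_differentiable[of S \<phi> z] by (simp add: conformal_immersion_def)
      then show False using w by auto
    qed
    then show "principal_direction X z w" by (rule principal[OF z])
  qed
  moreover define Q where "Q x = x$1 *\<^sub>R e1 + x$2 *\<^sub>R e2 + x$3 *\<^sub>R n" for x :: "real^3"
  have "orthogonal_transformation Q"
    unfolding Q_def[abs_def] by (rule orthonormal_frame_transformation[OF fr])
  then have "similarity (\<lambda>x. 1 *\<^sub>R Q x + d *\<^sub>R n)" unfolding similarity_def using zero_less_one by blast
  moreover have "X z = 1 *\<^sub>R Q (X_tilde (-pi/4) (\<phi> z)) + d *\<^sub>R n" if z: "z \<in> S" for z
  proof -
    have "X_tilde (-pi/4) (\<phi> z) = vector [X z \<bullet> e1, X z \<bullet> e2, 0]"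
      unfolding vec_eq_iff forall_3 by (simp add: X_tilde_def Let_def \<phi>_def T_def)
    then have "1 *\<^sub>R Q (X_tilde (-pi/4) (\<phi> z)) + d *\<^sub>R n = (X z \<bullet> e1) *\<^sub>R e1 + (X z \<bullet> e2) *\<^sub>R e2 + (X z \<bullet> n) *\<^sub>R n"
      using n(2)[OF z] by (simp add: Q_def inner_commute)
    moreover have "\<dots> \<bullet> y = X z \<bullet> y" for y
      unfolding frame_expansion[OF fr, of "X z" y]
      by (simp add: inner_add_left inner_commute[of y])
    ultimately show ?thesis by (metis vector_eq_rdot)
  qed
  ultimately show ?thesis using pl unfolding piece_of_def by blast
qed

lemma X_tilde_piece_of_type:
  assumes "open S" "smooth_on S X" "piece_of S X (X_tilde \<theta>)" "\<theta> \<in> angles T"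
  shows "piece_of_type S X T"
  using axis_similar_to_model[OF assms(4)] piece_of_axis_similar[OF assms(1-3)]
  unfolding piece_of_type_def by metis

lemma angles_cover:
  assumes "\<theta> \<in> {-pi/4..3*pi/4}"
  obtains T where "\<theta> \<in> angles T"
proof -
  have "\<theta> \<in> angles Plane \<or> \<theta> \<in> angles Catenoid \<or> \<theta> \<in> angles Enneper \<or> \<theta> \<in> angles Bonnet"
    using assms by auto
  then show thesis using that by blast
qed

lemma piece_of_type_unique:
  assumes su: "surface S X" and m: "minimal_on S X"
    and np: "\<not> in_some_plane (X ` S) \<Longrightarrow> (\<forall>z\<in>S. \<not> umbilic X z) \<and> isothermic_coords S X (\<lambda>z. z)"
    and T: "piece_of_type S X T" and T': "piece_of_type S X T'"
  shows "T = T'"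
proof (cases "in_some_plane (X ` S)")
  case True
  have "T = Plane" if T: "piece_of_type S X T" for T
  proof (rule ccontr)
    assume T': "T \<noteq> Plane"
    obtain Y where Y: "Y \<in> models T" "piece_of S X Y" using T unfolding piece_of_type_def by blast
    obtain \<mu> g g1 g2 where g: "null_jet UNIV 2 \<mu> g g1 g2" "\<And>z. has_cgrad Y (g z) z"
      using model_jet[OF Y(1) T'] by metis
    have "open S" "S \<noteq> {}" using su by (auto simp: surface_def)
    from planar_not_piece_of_null_jet[OF this True Y(2) g(1) _ g(2)] show False by simp
  qed
  from this[OF T] this[OF T'] show ?thesis by simp
next
  case False
  have "T \<noteq> Plane" if T: "piece_of_type S X T" for T
    using plane_model_planar False T unfolding piece_of_type_def by blast
  then show ?thesis
    using piece_of_type_unique_nonplanar[OF su m] np[OF False] T T' by blast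
qed

lemma surface_piece_of_X_tilde:
  assumes su: "surface S X" and m: "minimal_on S X" and pl: "planar_curvature_lines S X"
    and np: "\<not> in_some_plane (X ` S) \<Longrightarrow> (\<forall>z\<in>S. \<not> umbilic X z) \<and> isothermic_coords S X (\<lambda>z. z)"
  shows "\<exists>\<theta>\<in>{-pi/4..3*pi/4}. piece_of S X (X_tilde \<theta>)"
proof (cases "in_some_plane (X ` S)")
  case True
  then show ?thesis using planar_piece_of_X_tilde[OF su m] by (intro bexI[of _ "-pi/4"]) auto
next
  case False
  have um: "\<not> umbilic X z" if "z \<in> S" for z using np[OF False] that by blast
  have iso: "isothermic_coords S X (\<lambda>z. z)" using np[OF False] by blast
  have S: "open S" "S \<noteq> {}" and ci: "conformal_immersion S X" using su by (auto simp: surface_def)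
  have con: "connected S" by (rule surface_connected[OF su])
  have sm: "smooth_on S X" using ci by (simp add: conformal_immersion_def)
  obtain L \<mu> f1 f2 where L: "L > 0" "null_jet S L \<mu> (null_curve X) f1 f2"
    using surface_null_jet[OF su m pl um iso] by metis
  have "has_cgrad X (null_curve X z) z" if "z \<in> S" for z
    by (rule null_curve_has_cgrad[OF smooth_on_differentiable[OF sm that]])
  from null_jet_surface_is_piece_of_X_tilde[OF S(1) con S(2) L(2,1) this]
  obtain \<theta> a z0 F where *: "\<theta> \<in> {-pi/4<..<3*pi/4}" "a > 0" "similarity F"
    "\<And>z. z \<in> S \<Longrightarrow> X z = F (X_tilde \<theta> (of_real a * (z - z0)))"
    by metis
  have "isothermic_coords S X (\<lambda>z. of_real a * z + - (of_real a * z0))"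
    using *(2) by (intro isothermic_coords_affine[OF S(1) sm iso]) auto
  then have "piece_of S X (X_tilde \<theta>)"
    unfolding piece_of_def using *(2-4)
    by (intro exI[of _ "\<lambda>z. of_real a * z + - (of_real a * z0)"] exI[of _ F])
      (auto simp: inj_on_def algebra_simps)
  then show ?thesis using *(1) by (intro bexI[of _ \<theta>]) auto
qed

theorem theorem2:
  shows "(\<forall>\<Sigma> X. surface \<Sigma> X \<and> minimal_on \<Sigma> X \<and> planar_curvature_lines \<Sigma> X \<and>
             (\<not> in_some_plane (X ` \<Sigma>) \<longrightarrow>
                (\<forall>z\<in>\<Sigma>. \<not> umbilic X z) \<and> isothermic_coords \<Sigma> X (\<lambda>z. z)) \<longrightarrow>
           (\<exists>\<theta>\<in>{-pi/4..3*pi/4}. piece_of \<Sigma> X (X_tilde \<theta>)) \<and>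
           (\<exists>!T. piece_of_type \<Sigma> X T) \<and>
           (\<forall>\<theta>\<in>{-pi/4..3*pi/4}. piece_of \<Sigma> X (X_tilde \<theta>) \<longrightarrow>
              (\<forall>T. piece_of_type \<Sigma> X T \<longleftrightarrow> \<theta> \<in> angles T))) \<and>
         (\<forall>\<theta>\<^sub>0\<in>{-pi/4..3*pi/4}. \<forall>K i. compact K \<longrightarrow>
            uniform_limit K (\<lambda>\<theta> z. X_tilde \<theta> z $ i) (\<lambda>z. X_tilde \<theta>\<^sub>0 z $ i)
              (at \<theta>\<^sub>0 within {-pi/4..3*pi/4}))"
proof (intro conjI allI impI ballI)
  fix \<Sigma> :: "complex set" and X
  assume h: "surface \<Sigma> X \<and> minimal_on \<Sigma> X \<and> planar_curvature_lines \<Sigma> X \<and>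
             (\<not> in_some_plane (X ` \<Sigma>) \<longrightarrow>
                (\<forall>z\<in>\<Sigma>. \<not> umbilic X z) \<and> isothermic_coords \<Sigma> X (\<lambda>z. z))"
  then have su: "surface \<Sigma> X" and m: "minimal_on \<Sigma> X" and pl: "planar_curvature_lines \<Sigma> X"
    and np: "\<not> in_some_plane (X ` \<Sigma>) \<Longrightarrow> (\<forall>z\<in>\<Sigma>. \<not> umbilic X z) \<and> isothermic_coords \<Sigma> X (\<lambda>z. z)"
    by blast+
  have S: "open \<Sigma>" "smooth_on \<Sigma> X" using su by (auto simp: surface_def conformal_immersion_def)
  have uniq: "T = T'" if "piece_of_type \<Sigma> X T" "piece_of_type \<Sigma> X T'" for T T'
    using piece_of_type_unique[OF su m np that] .
  show 1: "\<exists>\<theta>\<in>{-pi/4..3*pi/4}. piece_of \<Sigma> X (X_tilde \<theta>)"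
    by (rule surface_piece_of_X_tilde[OF su m pl np])
  show "\<exists>!T. piece_of_type \<Sigma> X T"
  proof -
    obtain \<theta> T where "piece_of \<Sigma> X (X_tilde \<theta>)" "\<theta> \<in> angles T" using 1 angles_cover by metis
    then show ?thesis using X_tilde_piece_of_type[OF S] uniq by blast
  qed
  fix \<theta> T
  assume \<theta>: "\<theta> \<in> {-pi/4..3*pi/4}" and p: "piece_of \<Sigma> X (X_tilde \<theta>)"
  obtain T0 where T0: "\<theta> \<in> angles T0" using angles_cover[OF \<theta>] by blast
  show "piece_of_type \<Sigma> X T \<longleftrightarrow> \<theta> \<in> angles T"
    using X_tilde_piece_of_type[OF S p] T0 uniq by blast
next
  fix \<theta>\<^sub>0 K i
  assume "\<theta>\<^sub>0 \<in> {-pi/4..3*pi/4}" "compact (K :: complex set)"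
  then show "uniform_limit K (\<lambda>\<theta> z. X_tilde \<theta> z $ i) (\<lambda>z. X_tilde \<theta>\<^sub>0 z $ i)
              (at \<theta>\<^sub>0 within {-pi/4..3*pi/4})"
    by (rule X_tilde_uniform_limit)
qed

end
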